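(* Let $A\in\mathrm{GL}(n,\mathbb{Z})$ be a Kato matrix and let $M_A$ be the associated Kato manifold. Then $H^0(M_A,\Omega^1)=0$, i.e. $M_A$ admits no non-zero holomorphic one-forms.
   Context: Kato matrices. Let $e_1,\dots,e_n$ be the standard basis (column vectors) and $c=\sum_j e_j$. For $1\le j\le n$ let $A_j$ be the $n\times n$ matrix with columns $e_1,\dots,e_{j-1},e_{j+1},\dots,e_n,c$ (elementary matrices). A Kato matrix is a product $A=A_{j_1}\cdots A_{j_k}$, $k\ge1$, repetitions allowed, which is not of the form $A_n^p$, $p\ge 1$; the factorization is unique. For $A=(a_{pq})$ put $F_A(z)=(\prod_q z_q^{a_{1q}},\dots,\prod_q z_q^{a_{nq}})$. The manifold $M_A$. Let $D=\{z\in\mathbb{C}^n:\sum_{j<n}|z_j|^2+2|z_n|^2<1\}$, let $\Pi:\hat{\mathbb{C}}^n\to\mathbb{C}^n$ be the blow-up at $0$, $\hat D=\Pi^{-1}(D)$, with standard charts $f_j:\mathbb{C}^n\to\hat{\mathbb{C}}^n\subset\mathbb{C}^n\times\mathbb{CP}^{n-1}$, $f_j(z)=(F_{A_j}(z),[z_1:\dots:z_{j-1}:1:z_j:\dots:z_{n-1}])$. Put $\hat D^{(0)}=D$, $\sigma_0=\mathrm{id}$; for $1\le p\le k$ let $\pi_p:\hat D^{(p)}\to\hat D^{(p-1)}$ be the blow-up at the point $\sigma_{p-1}(0)$, $\iota_p:\hat D\to\hat D^{(p)}$ the embedding with $\pi_p\circ\iota_p=\sigma_{p-1}\circ\Pi$,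 and $\sigma_p=\iota_p\circ f_{j_p}:D\to\hat D^{(p)}$. Let $\pi=\pi_1\circ\dots\circ\pi_k:\hat D^{(k)}\to D$, $\sigma=\sigma_k$, so $\pi\circ\sigma=F_A$; $\sigma$ extends to an embedding of $\overline D$ in $\hat D^{(k)}$. With $W=\hat D^{(k)}\setminus\sigma(D)$, $M_A$ is the compact complex manifold obtained from $W$ completed with its outer boundary $\partial\hat D^{(k)}\cong\partial D$ by gluing $x\in\partial\hat D^{(k)}$ with $\sigma(\pi(x))\in\sigma(\partial D)$. *)

theory Defs
  imports "HOL-Analysis.Analysis"
begin

section \<open>Kato matrices\<close>

text \<open>The coordinates \<open>1, \<dots>, n\<close> are the elements of a finite well-ordered index type \<open>'n\<close>.\<close>

type_synonym 'n int_mat = "((int, 'n) vec, 'n) vec"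

type_synonym 'n cspace = "(complex, 'n) vec"

definition last_ix :: "'n::{finite,wellorder}" where
  "last_ix = Max UNIV"

definition next_ix :: "'n \<Rightarrow> 'n::{finite,wellorder}" where
  "next_ix q = Min {p. q < p}"

definition prev_ix :: "'n \<Rightarrow> 'n::{finite,wellorder}" where
  "prev_ix p = Max {q. q < p}"

definition elem_matrix :: "'n::{finite,wellorder} \<Rightarrow> 'n int_mat" where
  "elem_matrix j = (\<chi> p q.
     (if q = last_ix then (\<Sum>i\<in>UNIV. axis i 1)
      else if q < j then axis q 1
      else axis (next_ix q) 1) $ p)"

definition word_matrix :: "'n::{finite,wellorder} list \<Rightarrow> 'n int_mat" where
  "word_matrix js = foldr (\<lambda>j B. elem_matrix j ** B) js (mat 1)"

definition kato_matrix :: "'n::{finite,wellorder} int_mat \<Rightarrow> bool" where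
  "kato_matrix A \<longleftrightarrow>
     (\<exists>js. js \<noteq> [] \<and> A = word_matrix js) \<and>
     \<not> (\<exists>p\<ge>1. A = word_matrix (replicate p last_ix))"

definition kato_word :: "'n::{finite,wellorder} int_mat \<Rightarrow> 'n list" where
  "kato_word A = (THE js. A = word_matrix js)"

definition monomial_map :: "'n::finite int_mat \<Rightarrow> 'n cspace \<Rightarrow> 'n cspace" where
  "monomial_map A z = (\<chi> p. \<Prod>q\<in>UNIV. (z $ q) powi (A $ p $ q))"


section \<open>Complex manifolds and holomorphic one-forms\<close>

text \<open>A chart is an open set \<open>V\<close> of \<open>\<complex>\<^sup>n\<close> together with an injective parametrisation
  of a part of the manifold by \<open>V\<close>; an atlas is a set of charts. The topology and the complex
  structure of the manifold are those induced by its atlas.\<close>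

type_synonym ('n, 'p) chart = "'n cspace set \<times> ('n cspace \<Rightarrow> 'p)"

definition holo_on :: "'n::finite cspace set \<Rightarrow> ('n cspace \<Rightarrow> 'm::finite cspace) \<Rightarrow> bool" where
  "holo_on V f \<longleftrightarrow>
     (\<forall>v\<in>V. \<exists>f'. (f has_derivative f') (at v) \<and> (\<forall>c h. f' (c *s h) = c *s f' h))"

definition transition :: "('n::finite, 'p) chart \<Rightarrow> ('n, 'p) chart \<Rightarrow> 'n cspace \<Rightarrow> 'n cspace" where
  "transition = (\<lambda>(V, \<phi>) (U, \<psi>). inv_into U \<psi> \<circ> \<phi>)"

definition overlap :: "('n::finite, 'p) chart \<Rightarrow> ('n, 'p) chart \<Rightarrow> 'n cspace set" where
  "overlap = (\<lambda>(V, \<phi>) (U, \<psi>). {v \<in> V. \<phi> v \<in> \<psi> ` U})"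

text \<open>\<open>\<A>\<close> is the atlas of a (Hausdorff) complex manifold with underlying set \<open>X\<close>.\<close>

definition complex_manifold :: "'p set \<Rightarrow> ('n::finite, 'p) chart set \<Rightarrow> bool" where
  "complex_manifold X \<A> \<longleftrightarrow>
     (\<forall>(V, \<phi>)\<in>\<A>. open V \<and> inj_on \<phi> V) \<and>
     X = (\<Union>(V, \<phi>)\<in>\<A>. \<phi> ` V) \<and>
     (\<forall>c\<in>\<A>. \<forall>d\<in>\<A>. open (overlap c d) \<and> holo_on (overlap c d) (transition c d)) \<and>
     (\<forall>(V, \<phi>)\<in>\<A>. \<forall>(U, \<psi>)\<in>\<A>. \<forall>v\<in>V. \<forall>u\<in>U. \<phi> v \<noteq> \<psi> u \<longrightarrow>
        (\<exists>V' U'. open V' \<and> v \<in> V' \<and> V' \<subseteq> V \<and> open U' \<and> u \<in> U' \<and> U' \<subseteq> U \<and>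
           \<phi> ` V' \<inter> \<psi> ` U' = {}))"

text \<open>The coefficients of the pull-back under a holomorphic map \<open>\<tau>\<close>, at the point \<open>v\<close>,
  of the covector \<open>\<Sum>j. a\<^sub>j dz\<^sub>j\<close>; the real derivative of \<open>\<tau>\<close> along \<open>e\<^sub>i\<close> is
  \<open>\<partial>\<tau>/\<partial>z\<^sub>i\<close> because \<open>\<tau>\<close> is holomorphic.\<close>

definition pullback_covector ::
  "('n::finite cspace \<Rightarrow> 'n cspace) \<Rightarrow> 'n cspace \<Rightarrow> 'n cspace \<Rightarrow> 'n cspace" where
  "pullback_covector \<tau> v a =
     (\<chi> i. \<Sum>j\<in>UNIV. a $ j * frechet_derivative \<tau> (at v) (axis i 1) $ j)"

text \<open>The space \<open>H\<^sup>0(M, \<Omega>\<^sup>1)\<close>. A one-form is given by its local expressions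
  \<open>\<Sum>i. (\<omega> (V, \<phi>) z)\<^sub>i dz\<^sub>i\<close>, \<open>z \<in> V\<close>, in the charts; the value \<open>0\<close> outside the charts
  only makes the representation unique.\<close>

definition holomorphic_one_forms ::
  "('n::finite, 'p) chart set \<Rightarrow> (('n, 'p) chart \<Rightarrow> 'n cspace \<Rightarrow> 'n cspace) set" where
  "holomorphic_one_forms \<A> = {\<omega>.
     (\<forall>c\<in>\<A>. holo_on (fst c) (\<omega> c)) \<and>
     (\<forall>c\<in>\<A>. \<forall>d\<in>\<A>. \<forall>v\<in>overlap c d.
        \<omega> c v = pullback_covector (transition c d) v (\<omega> d (transition c d v))) \<and>
     (\<forall>c v. c \<notin> \<A> \<or> v \<notin> fst c \<longrightarrow> \<omega> c v = 0)}"


section \<open>The blow-up of the origin\<close>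

definition line :: "'n::finite cspace \<Rightarrow> 'n cspace set" where
  "line v = range (\<lambda>c. c *s v)"

definition proj_space :: "'n::finite cspace set set" where
  "proj_space = line ` (- {0})"

definition blowup_origin :: "('n::finite cspace \<times> 'n cspace set) set" where
  "blowup_origin = {(z, l). l \<in> proj_space \<and> z \<in> l}"

definition blowup_chart ::
  "'n::{finite,wellorder} \<Rightarrow> 'n cspace \<Rightarrow> 'n cspace \<times> 'n cspace set" where
  "blowup_chart j z =
     (monomial_map (elem_matrix j) z,
      line (\<chi> p. if p < j then z $ p else if p = j then 1 else z $ (prev_ix p)))"


section \<open>Iterated blow-ups\<close>

text \<open>All blow-ups are performed on \<open>\<complex>\<^sup>n\<close> instead of \<open>D\<close>; the manifold \<open>D^(p)\<close> (hats
  omitted) is the preimage of \<open>D\<close>. As a set, blowing up a point of a manifold replaces this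
  point by a projective space: \<open>Exceptional p l\<close> is the point \<open>l\<close> of the exceptional
  divisor of the \<open>p\<close>-th blow-up, and \<open>Ambient z\<close> is a point of \<open>\<complex>\<^sup>n\<close>.\<close>

datatype 'v blowup_point = Ambient (ambient_coord: 'v) | Exceptional nat "'v set"

text \<open>The embedding \<open>\<iota>\<^sub>p\<close> of \<open>blowup_origin\<close>, given \<open>s = \<sigma>\<^sub>p\<^sub>-\<^sub>1\<close>: it lifts \<open>s\<close> along the blow-ups at \<open>0\<close>
  and \<open>s 0\<close>.\<close>

definition blowup_embed ::
  "nat \<Rightarrow> ('n::finite cspace \<Rightarrow> 'n cspace blowup_point) \<Rightarrow>
   'n cspace \<times> 'n cspace set \<Rightarrow> 'n cspace blowup_point" where
  "blowup_embed p s = (\<lambda>(z, l). if z = 0 then Exceptional p l else s z)"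

text \<open>In the following, the word \<open>js = [j\<^sub>1, \<dots>, j\<^sub>k]\<close> is fixed; note that
  \<open>js ! p\<close> is \<open>j\<close> with index \<open>p + 1\<close>.\<close>

primrec sigma_map ::
  "'n::{finite,wellorder} list \<Rightarrow> nat \<Rightarrow> 'n cspace \<Rightarrow> 'n cspace blowup_point" where
  "sigma_map js 0 = Ambient"
| "sigma_map js (Suc p) = blowup_embed (Suc p) (sigma_map js p) \<circ> blowup_chart (js ! p)"

primrec tower :: "'n::{finite,wellorder} list \<Rightarrow> nat \<Rightarrow> 'n cspace blowup_point set" where
  "tower js 0 = range Ambient"
| "tower js (Suc p) = (tower js p - {sigma_map js p 0}) \<union> Exceptional (Suc p) ` proj_space"

text \<open>The complex structure: off the centre, that of the blown-up manifold; near the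
  exceptional divisor, that of the blow-up of \<open>\<complex>\<^sup>n\<close> at \<open>0\<close>, via \<open>\<iota>\<^sub>p\<close>.\<close>

primrec tower_atlas ::
  "'n::{finite,wellorder} list \<Rightarrow> nat \<Rightarrow> ('n, 'n cspace blowup_point) chart set" where
  "tower_atlas js 0 = {(UNIV, Ambient)}"
| "tower_atlas js (Suc p) =
     {({v \<in> V. \<phi> v \<noteq> sigma_map js p 0}, \<phi>) | V \<phi>. (V, \<phi>) \<in> tower_atlas js p} \<union>
     {(UNIV, blowup_embed (Suc p) (sigma_map js p) \<circ> blowup_chart j) | j. True}"

text \<open>The blow-down map \<open>\<pi>\<^sub>p\<close> to the level \<open>p - 1\<close>, for \<open>p \<ge> 1\<close>, and the composition
  \<open>\<pi>\<^sub>1 \<circ> \<dots> \<circ> \<pi>\<^sub>p\<close>.\<close>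

definition blow_down ::
  "'n::{finite,wellorder} list \<Rightarrow> nat \<Rightarrow> 'n cspace blowup_point \<Rightarrow> 'n cspace blowup_point"
  where
  "blow_down js p x = (if x \<in> range (Exceptional p) then sigma_map js (p - 1) 0 else x)"

primrec blow_down_comp ::
  "'n::{finite,wellorder} list \<Rightarrow> nat \<Rightarrow> 'n cspace blowup_point \<Rightarrow> 'n cspace blowup_point"
  where
  "blow_down_comp js 0 = id"
| "blow_down_comp js (Suc p) = blow_down_comp js p \<circ> blow_down js (Suc p)"


section \<open>Kato manifolds\<close>

definition kato_domain :: "'n::{finite,wellorder} cspace set" where
  "kato_domain =
     {z. (\<Sum>j\<in>UNIV - {last_ix}. (cmod (z $ j))\<^sup>2) + 2 * (cmod (z $ last_ix))\<^sup>2 < 1}"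

definition kato_sigma ::
  "'n::{finite,wellorder} list \<Rightarrow> 'n cspace \<Rightarrow> 'n cspace blowup_point" where
  "kato_sigma js = sigma_map js (length js)"

definition kato_pi ::
  "'n::{finite,wellorder} list \<Rightarrow> 'n cspace blowup_point \<Rightarrow> 'n cspace" where
  "kato_pi js = ambient_coord \<circ> blow_down_comp js (length js)"

text \<open>The set \<open>W\<close> completed with the outer boundary.\<close>

definition kato_pre ::
  "'n::{finite,wellorder} list \<Rightarrow> 'n cspace blowup_point set" where
  "kato_pre js =
     {x \<in> tower js (length js). kato_pi js x \<in> closure kato_domain} - kato_sigma js ` kato_domain"

text \<open>Two points are glued iff they agree after each \<open>x\<close> on the outer boundary has been
  replaced by \<open>\<sigma> (\<pi> x)\<close>. Since \<open>\<sigma>\<close> is injective and maps \<open>\<partial>D\<close> into \<open>D^(k)\<close>, off the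
  outer boundary, this is the equivalence relation generated by \<open>x \<sim> \<sigma> (\<pi> x)\<close>.\<close>

definition kato_glue ::
  "'n::{finite,wellorder} list \<Rightarrow> 'n cspace blowup_point \<Rightarrow> 'n cspace blowup_point" where
  "kato_glue js x = (if kato_pi js x \<in> frontier kato_domain then kato_sigma js (kato_pi js x) else x)"

definition kato_class ::
  "'n::{finite,wellorder} list \<Rightarrow> 'n cspace blowup_point \<Rightarrow> 'n cspace blowup_point set" where
  "kato_class js x = {y \<in> kato_pre js. kato_glue js y = kato_glue js x}"

text \<open>Points of \<open>M\<^sub>A\<close> are classes of points of \<open>kato_pre\<close>. The charts of the first family
  cover the interior of \<open>W\<close>; they are charts of \<open>D^(k)\<close>. Those of the second family cover the
  glued hypersurface: the gluing map \<open>\<sigma> \<circ> \<pi>\<close> is biholomorphic near the outer boundary, so the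
  two sides of \<open>\<partial>D\<close> in \<open>\<complex>\<^sup>n\<close> parametrise the two sides of the hypersurface. Inside \<open>D\<close>,
  the point \<open>z\<close> stands for \<open>\<pi>\<^sup>-\<^sup>1 z = Ambient z\<close> (which requires \<open>z \<noteq> 0\<close>), and on or outside
  \<open>\<partial>D\<close> it stands for \<open>\<sigma> z\<close>. On \<open>\<partial>D\<close> the points \<open>\<pi>\<^sup>-\<^sup>1 z\<close> and \<open>\<sigma> z\<close> are glued.\<close>

definition kato_collar :: "'n::{finite,wellorder} list \<Rightarrow> 'n cspace set" where
  "kato_collar js = {z.
     if z \<in> kato_domain then z \<noteq> 0 \<and> Ambient z \<notin> kato_sigma js ` closure kato_domain
     else kato_pi js (kato_sigma js z) \<in> kato_domain}"

definition kato_collar_map ::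
  "'n::{finite,wellorder} list \<Rightarrow> 'n cspace \<Rightarrow> 'n cspace blowup_point set" where
  "kato_collar_map js z =
     kato_class js (if z \<in> kato_domain then Ambient z else kato_sigma js z)"

definition kato_word_atlas ::
  "'n::{finite,wellorder} list \<Rightarrow> ('n, 'n cspace blowup_point set) chart set" where
  "kato_word_atlas js =
     {({v \<in> V. kato_pi js (\<phi> v) \<in> kato_domain \<and> \<phi> v \<notin> kato_sigma js ` closure kato_domain},
       kato_class js \<circ> \<phi>) | V \<phi>. (V, \<phi>) \<in> tower_atlas js (length js)} \<union>
     {(N, kato_collar_map js) | N.
        open N \<and> N \<subseteq> kato_collar js \<and> inj_on (kato_collar_map js) N}"

text \<open>The manifold \<open>M\<^sub>A\<close>: its underlying set, and the atlas by which it is given.\<close>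

definition kato_space :: "'n::{finite,wellorder} int_mat \<Rightarrow> 'n cspace blowup_point set set" where
  "kato_space A = kato_class (kato_word A) ` kato_pre (kato_word A)"

definition kato_manifold ::
  "'n::{finite,wellorder} int_mat \<Rightarrow> ('n, 'n cspace blowup_point set) chart set" where
  "kato_manifold A = kato_word_atlas (kato_word A)"


section \<open>The Kato manifold is a complex manifold\<close>

text \<open>The rest of this theory shows that the factorisation of a Kato matrix is unique, that
  \<open>\<pi> \<circ> \<sigma> = F\<^sub>A\<close> and that the atlases above define complex manifolds. No further definitions
  needed for the main statement occur below.\<close>

subsection \<open>Elementary matrices and the charts of the blow-up\<close>

lemma last_ix_ge: "(q::'n::{finite,wellorder}) \<le> last_ix"
  unfolding last_ix_def by simp

lemma next_ix_props:
  fixes q :: "'n::{finite,wellorder}"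
  assumes "q \<noteq> last_ix"
  shows "q < next_ix q" "\<And>p. q < p \<Longrightarrow> next_ix q \<le> p"
proof -
  have "q < last_ix" using assms last_ix_ge[of q] by simp
  then have ne: "{p. q < p} \<noteq> {}" by auto
  show "q < next_ix q" unfolding next_ix_def using Min_in[OF _ ne] by simp
  show "\<And>p. q < p \<Longrightarrow> next_ix q \<le> p" unfolding next_ix_def by simp
qed

lemma prev_ix_props:
  fixes p :: "'n::{finite,wellorder}"
  assumes "j < p"
  shows "prev_ix p < p" "\<And>q. q < p \<Longrightarrow> q \<le> prev_ix p"
proof -
  have ne: "{q. q < p} \<noteq> {}" using assms by auto
  show "prev_ix p < p" unfolding prev_ix_def using Max_in[OF _ ne] by simp
  show "\<And>q. q < p \<Longrightarrow> q \<le> prev_ix p" unfolding prev_ix_def by simp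
qed

lemma next_ix_eq_iff:
  fixes p q j :: "'n::{finite,wellorder}"
  assumes "q \<noteq> last_ix" "j < p"
  shows "p = next_ix q \<longleftrightarrow> q = prev_ix p"
proof
  assume p: "p = next_ix q"
  have "q < p" using next_ix_props(1)[OF assms(1)] p by simp
  then have "q \<le> prev_ix p" using prev_ix_props(2)[OF assms(2)] by blast
  moreover have "\<not> q < prev_ix p"
    using next_ix_props(2)[OF assms(1)] prev_ix_props(1)[OF assms(2)] p by force
  ultimately show "q = prev_ix p" by simp
next
  assume q: "q = prev_ix p"
  have "q < p" using q prev_ix_props(1)[OF assms(2)] by simp
  then have "next_ix q \<le> p" using next_ix_props(2)[OF assms(1)] by blast
  moreover have "\<not> next_ix q < p"
    using next_ix_props(1)[OF assms(1)] prev_ix_props(2)[OF assms(2)] q by force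
  ultimately show "p = next_ix q" by simp
qed

definition row_ix :: "'n \<Rightarrow> 'n \<Rightarrow> 'n::{finite,wellorder}" where
  "row_ix j p = (if p < j then p else prev_ix p)"

lemma row_ix_ne_last: "p \<noteq> j \<Longrightarrow> row_ix j p \<noteq> last_ix"
  using prev_ix_props(1)[of j p] last_ix_ge[of p] last_ix_ge[of j] unfolding row_ix_def
  by (metis linorder_less_linear order_less_le_trans order_less_irrefl)

lemma elem_matrix_entry:
  "elem_matrix j $ p $ q = (if q = last_ix then 1 else if p \<noteq> j \<and> q = row_ix j p then 1 else 0)"
proof (cases "q = last_ix")
  case True
  then show ?thesis by (simp add: elem_matrix_def axis_def)
next
  case False
  note nx = next_ix_props[OF False]
  show ?thesis
  proof (cases "q < j")
    case True
    have "q = row_ix j p \<longleftrightarrow> p = q" if "p \<noteq> j"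
      using True that prev_ix_props(2)[of j p j] unfolding row_ix_def by force
    then show ?thesis using False True by (auto simp: elem_matrix_def axis_def)
  next
    case ge: False
    have "p = next_ix q \<longleftrightarrow> p \<noteq> j \<and> q = row_ix j p"
    proof (cases "j < p")
      case True
      then show ?thesis using next_ix_eq_iff[OF False True] by (auto simp: row_ix_def)
    next
      case False
      then show ?thesis using ge nx(1) by (auto simp: row_ix_def)
    qed
    then show ?thesis using False ge by (auto simp: elem_matrix_def axis_def)
  qed
qed

lemma elem_matrix_mult:
  "(elem_matrix j ** B) $ p $ r = B $ last_ix $ r + (if p = j then 0 else B $ row_ix j p $ r)"
proof -
  have "(elem_matrix j ** B) $ p $ r =
      (\<Sum>q\<in>UNIV. (if q = last_ix then B $ q $ r else 0) +
                (if q = row_ix j p then (if p = j then 0 else B $ q $ r) else 0))"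
    unfolding matrix_matrix_mult_def using row_ix_ne_last[of p j]
    by (auto simp: elem_matrix_entry intro!: sum.cong)
  also have "\<dots> = B $ last_ix $ r + (if p = j then 0 else B $ row_ix j p $ r)"
    by (simp add: sum.distrib)
  finally show ?thesis .
qed

definition chart_vec :: "'n \<Rightarrow> 'n cspace \<Rightarrow> 'n::{finite,wellorder} cspace" where
  "chart_vec j z = (\<chi> p. if p < j then z $ p else if p = j then 1 else z $ (prev_ix p))"

lemma chart_vec_nth: "chart_vec j z $ p = (if p = j then 1 else z $ row_ix j p)"
  by (simp add: chart_vec_def row_ix_def)

lemma monomial_elem: "monomial_map (elem_matrix j) z = z $ last_ix *s chart_vec j z"
proof -
  have "(\<Prod>q\<in>UNIV. z $ q powi (elem_matrix j $ p $ q)) =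
      (\<Prod>q\<in>UNIV. (if q = last_ix then z $ q else 1) *
                (if q = row_ix j p then (if p = j then 1 else z $ q) else 1))" for p
    using row_ix_ne_last[of p j] by (auto simp: elem_matrix_entry intro!: prod.cong)
  then show ?thesis
    by (simp add: vec_eq_iff monomial_map_def prod.distrib chart_vec_nth)
qed

lemma blowup_chart_eq: "blowup_chart j z = (z $ last_ix *s chart_vec j z, line (chart_vec j z))"
  by (simp add: blowup_chart_def monomial_elem chart_vec_def)

lemma chart_vec_nonzero: "chart_vec j z \<noteq> 0"
  using chart_vec_nth[of j z j] by (metis one_neq_zero zero_index)

lemma blowup_chart_in: "blowup_chart j z \<in> blowup_origin"
  unfolding blowup_chart_eq blowup_origin_def proj_space_def line_def
  using chart_vec_nonzero by auto

lemma row_ix_surj: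
  assumes "q \<noteq> last_ix"
  obtains p where "p \<noteq> j" "row_ix j p = q"
proof (cases "q < j")
  case True
  then show ?thesis using that[of q] by (simp add: row_ix_def)
next
  case False
  have "j < next_ix q" using False next_ix_props(1)[OF assms] by simp
  moreover from this have "\<not> next_ix q < j" "next_ix q \<noteq> j" by auto
  ultimately show ?thesis using that[of "next_ix q"] next_ix_eq_iff[OF assms, of j "next_ix q"]
    by (simp add: row_ix_def)
qed

lemma row_ix_inj:
  assumes "x \<noteq> j" "y \<noteq> j" "row_ix j x = row_ix j y"
  shows "x = y"
proof (cases "x < j")
  case True
  then show ?thesis using assms prev_ix_props(2)[of j y j] by (force simp: row_ix_def split: if_splits)
next
  case False
  then have jx: "j < x" using assms by simp
  have jy: "j < y"
    using False assms prev_ix_props(2)[OF jx jx] by (force simp: row_ix_def split: if_splits)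
  have "prev_ix x = prev_ix y" using assms(3) jx jy order.asym unfolding row_ix_def by metis
  then show ?thesis
    using next_ix_eq_iff[OF row_ix_ne_last[OF assms(1)], of j x]
      next_ix_eq_iff[OF row_ix_ne_last[OF assms(1)], of j y] jx jy order.asym
    unfolding row_ix_def by metis
qed

lemma blowup_chart_inj:
  assumes "blowup_chart j z = blowup_chart j w"
  shows "z = w"
proof -
  have 1: "z $ last_ix *s chart_vec j z = w $ last_ix *s chart_vec j w"
    and 2: "line (chart_vec j z) = line (chart_vec j w)"
    using assms by (auto simp: blowup_chart_eq)
  have l: "z $ last_ix = w $ last_ix"
    using 1 chart_vec_nth[of j z j] chart_vec_nth[of j w j]
    by (metis mult.right_neutral vector_smult_component)
  have "chart_vec j z \<in> line (chart_vec j z)"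
    unfolding line_def by (metis rangeI vector_smult_lid)
  then obtain c where c: "chart_vec j z = c *s chart_vec j w" using 2 unfolding line_def by auto
  have "c = 1" using arg_cong[OF c, of "\<lambda>v. v $ j"] by (simp add: chart_vec_nth)
  with c have e: "chart_vec j z = chart_vec j w" by simp
  have "z $ q = w $ q" for q
  proof (cases "q = last_ix")
    case False
    then obtain p where "p \<noteq> j" "row_ix j p = q" by (rule row_ix_surj)
    then show ?thesis using arg_cong[OF e, of "\<lambda>v. v $ p"] by (simp add: chart_vec_nth)
  qed (use l in simp)
  then show ?thesis by (simp add: vec_eq_iff)
qed

subsection \<open>The factorisation of a Kato matrix is unique\<close>

lemma word_matrix_Cons: "word_matrix (j # js) = elem_matrix j ** word_matrix js"
  by (simp add: word_matrix_def)

lemma word_matrix_nonneg: "0 \<le> word_matrix js $ p $ q"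
proof (induction js arbitrary: p)
  case Nil then show ?case by (simp add: word_matrix_def mat_def)
next
  case (Cons j js)
  then show ?case by (simp add: word_matrix_Cons elem_matrix_mult)
qed

lemma word_matrix_row_pos: "(\<Sum>q\<in>UNIV. word_matrix js $ p $ q) > 0"
proof (induction js arbitrary: p)
  case Nil then show ?case by (simp add: word_matrix_def mat_def)
next
  case (Cons j js)
  have "(\<Sum>q\<in>UNIV. word_matrix (j#js) $ p $ q) = (\<Sum>q\<in>UNIV. word_matrix js $ last_ix $ q) +
     (if p = j then 0 else (\<Sum>q\<in>UNIV. word_matrix js $ row_ix j p $ q))"
    by (simp add: word_matrix_Cons elem_matrix_mult sum.distrib)
  then show ?case using Cons.IH[of last_ix] Cons.IH[of "row_ix j p"] by simp
qed

lemma word_matrix_row_Cons: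
  "(\<Sum>q\<in>UNIV. word_matrix (j#js) $ p $ q) = (\<Sum>q\<in>UNIV. word_matrix js $ last_ix $ q) +
     (if p = j then 0 else (\<Sum>q\<in>UNIV. word_matrix js $ row_ix j p $ q))"
  by (simp add: word_matrix_Cons elem_matrix_mult sum.distrib)

lemma word_matrix_Cons_min:
  assumes "p \<noteq> j"
  shows "(\<Sum>q\<in>UNIV. word_matrix (j#js) $ j $ q) < (\<Sum>q\<in>UNIV. word_matrix (j#js) $ p $ q)"
  unfolding word_matrix_row_Cons using assms word_matrix_row_pos by simp

lemma word_matrix_Cons_ne_mat:
  assumes "p \<noteq> (q :: 'n::{finite,wellorder})"
  shows "word_matrix (j # js) \<noteq> (mat 1 :: int^'n::{finite,wellorder}^'n::{finite,wellorder})"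
proof
  assume e: "word_matrix (j # js) = mat 1"
  obtain r where "r \<noteq> j" using assms by metis
  then show False using word_matrix_Cons_min[of r j js] unfolding e by (simp add: mat_def)
qed

lemma word_matrix_inj:
  assumes "p \<noteq> (q :: 'n::{finite,wellorder})" and "word_matrix js = word_matrix (ks :: 'n list)"
  shows "js = ks"
  using assms(2)
proof (induction js arbitrary: ks)
  case Nil
  then have "word_matrix ks = mat 1" by (simp add: word_matrix_def)
  then show ?case using word_matrix_Cons_ne_mat[OF assms(1)] by (cases ks) auto
next
  case (Cons j js)
  show ?case
  proof (cases ks)
    case Nil
    then have "word_matrix (j # js) = mat 1" using Cons.prems by (simp add: word_matrix_def)
    then show ?thesis using word_matrix_Cons_ne_mat[OF assms(1)] by blast
  next
    case (Cons k ks')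
    have jk: "j = k"
    proof (rule ccontr)
      assume "j \<noteq> k"
      then show False using word_matrix_Cons_min[of k j js] word_matrix_Cons_min[of j k ks']
        Cons.prems Cons by simp
    qed
    have e: "(elem_matrix j ** word_matrix js) $ p $ r = (elem_matrix j ** word_matrix ks') $ p $ r" for p r
      using Cons.prems Cons jk by (simp add: word_matrix_Cons)
    have l: "word_matrix js $ last_ix $ r = word_matrix ks' $ last_ix $ r" for r
      using e[of j r] by (simp add: elem_matrix_mult)
    have "word_matrix js $ q $ r = word_matrix ks' $ q $ r" for q r
    proof (cases "q = last_ix")
      case False
      then obtain p where "p \<noteq> j" "row_ix j p = q" by (rule row_ix_surj)
      then show ?thesis using e[of p r] l by (simp add: elem_matrix_mult)
    qed (use l in simp)
    then have "word_matrix js = word_matrix ks'" by (simp add: vec_eq_iff)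
    then show ?thesis using Cons.IH jk Cons by simp
  qed
qed

lemma kato_word:
  assumes "kato_matrix (A :: int^'n::{finite,wellorder}^'n::{finite,wellorder})" "A = word_matrix js"
  shows "kato_word A = js" "\<exists>j\<in>set js. j \<noteq> last_ix"
proof -
  obtain ks where ks: "ks \<noteq> []" "A = word_matrix ks" and n: "\<not> (\<exists>p\<ge>1. A = word_matrix (replicate p last_ix))"
    using assms(1) unfolding kato_matrix_def by blast
  have *: "\<exists>j\<in>set ks. j \<noteq> last_ix"
  proof (rule ccontr)
    assume "\<not> ?thesis"
    then have "ks = replicate (length ks) last_ix" by (metis replicate_eqI)
    moreover have "length ks \<ge> 1" using ks(1) by (cases ks) auto
    ultimately show False using n ks(2) by metis
  qed
  then obtain j :: 'n where j: "j \<noteq> last_ix" by blast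
  have u: "A = word_matrix ls \<Longrightarrow> ls = js" for ls using word_matrix_inj[OF j] assms(2) by metis
  then show "kato_word A = js" unfolding kato_word_def using assms(2) by blast
  show "\<exists>j\<in>set js. j \<noteq> last_ix" using * u[OF ks(2)] by simp
qed


subsection \<open>The maps \<open>\<sigma>\<close> and \<open>\<pi>\<close>, and \<open>\<pi> \<circ> \<sigma> = F\<^sub>A\<close>\<close>

lemma powi_sum_nonneg:
  assumes "finite S" "\<And>r. r \<in> S \<Longrightarrow> 0 \<le> f r"
  shows "(x::complex) powi (\<Sum>r\<in>S. f r) = (\<Prod>r\<in>S. x powi f r)"
  using assms
proof (induction S rule: finite_induct)
  case (insert a S)
  have "0 \<le> sum f S" "0 \<le> f a" using insert by (auto intro: sum_nonneg)
  then have "x powi (f a + sum f S) = x powi f a * x powi sum f S"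
    by (simp add: power_int_def nat_add_distrib power_add)
  then show ?case using insert by simp
qed simp

lemma prod_powi: "(\<Prod>r\<in>S. f r) powi (a::int) = (\<Prod>r\<in>S. f r powi a :: complex)"
  by (induction S rule: infinite_finite_induct) (auto simp: power_int_mult_distrib)

lemma monomial_mult:
  assumes "\<And>p q. 0 \<le> A $ p $ q" "\<And>p q. 0 \<le> B $ p $ q"
  shows "monomial_map (A ** B) z = monomial_map A (monomial_map B z)"
proof -
  have "monomial_map (A ** B) z $ p = monomial_map A (monomial_map B z) $ p" for p
  proof -
    have "monomial_map (A ** B) z $ p = (\<Prod>q\<in>UNIV. \<Prod>r\<in>UNIV. z $ q powi (A $ p $ r * B $ r $ q))"
      using assms by (simp add: monomial_map_def matrix_matrix_mult_def powi_sum_nonneg)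
    also have "\<dots> = (\<Prod>r\<in>UNIV. \<Prod>q\<in>UNIV. (z $ q powi (B $ r $ q)) powi (A $ p $ r))"
      by (subst prod.swap) (intro prod.cong refl, metis power_int_mult mult.commute)
    also have "\<dots> = monomial_map A (monomial_map B z) $ p"
      by (simp add: monomial_map_def prod_powi)
    finally show ?thesis .
  qed
  then show ?thesis by (simp add: vec_eq_iff)
qed

lemma elem_matrix_nonneg: "0 \<le> elem_matrix j $ p $ q"
  by (simp add: elem_matrix_entry)

lemma word_matrix_snoc: "word_matrix (js @ [j]) = word_matrix js ** elem_matrix j"
  by (induction js) (auto simp: word_matrix_def matrix_mul_assoc)

lemma monomial_elem_eq_0: "monomial_map (elem_matrix j) z = 0 \<longleftrightarrow> z $ last_ix = 0"
  using chart_vec_nonzero[of j z] by (auto simp: monomial_elem vec_eq_iff)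

lemma sigma_map_Suc: "sigma_map js (Suc p) z =
  (if z $ last_ix = 0 then Exceptional (Suc p) (line (chart_vec (js ! p) z))
   else sigma_map js p (monomial_map (elem_matrix (js ! p)) z))"
  by (simp add: blowup_embed_def blowup_chart_def monomial_elem_eq_0 chart_vec_def)

declare sigma_map.simps(2) [simp del]

lemma sigma_map_tower:
  "sigma_map js p z \<in> tower js p \<and> (sigma_map js p z = sigma_map js p w \<longrightarrow> z = w) \<and>
   (\<forall>i l. Exceptional i l \<in> tower js p \<longrightarrow> i \<le> p)"
proof (induction p arbitrary: z w)
  case (Suc p)
  let ?j = "js ! p" let ?F = "monomial_map (elem_matrix ?j)"
  have P: "line (chart_vec ?j x) \<in> proj_space" for x
    unfolding proj_space_def using chart_vec_nonzero[of ?j x] by blast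
  have ne: "sigma_map js p x \<noteq> Exceptional (Suc p) m" for x m
    using Suc.IH[of x] by (metis not_less_eq_eq order_refl)
  have inj: "sigma_map js p x = sigma_map js p y \<longleftrightarrow> x = y" for x y using Suc.IH by blast
  have 1: "sigma_map js (Suc p) z \<in> tower js (Suc p)"
  proof (cases "z $ last_ix = 0")
    case False
    then show ?thesis using Suc.IH[of "?F z"] inj[of "?F z" 0] by (simp add: sigma_map_Suc monomial_elem_eq_0)
  qed (use P in \<open>simp add: sigma_map_Suc\<close>)
  have 2: "z = w" if e: "sigma_map js (Suc p) z = sigma_map js (Suc p) w"
  proof -
    have z: "z $ last_ix = 0 \<longleftrightarrow> w $ last_ix = 0"
      using e ne ne[symmetric] by (auto simp: sigma_map_Suc split: if_splits)
    have "blowup_chart ?j z = blowup_chart ?j w"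
    proof (cases "z $ last_ix = 0")
      case True
      then show ?thesis using e z by (simp add: sigma_map_Suc blowup_chart_eq)
    next
      case False
      then have F: "?F z = ?F w" using e z inj by (simp add: sigma_map_Suc)
      then have F': "z $ last_ix *s chart_vec ?j z = w $ last_ix *s chart_vec ?j w" by (simp add: monomial_elem)
      from arg_cong[OF this, of "\<lambda>v. v $ ?j"] have "z $ last_ix = w $ last_ix" by (simp add: chart_vec_nth)
      then have "chart_vec ?j z = chart_vec ?j w" using F' False by (metis vector_mul_lcancel)
      then show ?thesis using F by (simp add: blowup_chart_def chart_vec_def)
    qed
    then show ?thesis by (rule blowup_chart_inj)
  qed
  have 3: "i \<le> Suc p" if "Exceptional i l \<in> tower js (Suc p)" for i l
    using that Suc.IH[of 0 0] by (auto intro: le_SucI)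
  show ?case using 1 2 3 by blast
qed auto

lemma sigma_map_in_tower: "sigma_map js p z \<in> tower js p"
  and tower_index: "Exceptional i l \<in> tower js p \<Longrightarrow> i \<le> p"
  and sigma_map_inj: "sigma_map js p z = sigma_map js p w \<Longrightarrow> z = w"
  using sigma_map_tower by blast+

lemma kato_pi_sigma_aux:
  "p \<le> length js \<Longrightarrow> blow_down_comp js p (sigma_map js p z) =
    Ambient (monomial_map (word_matrix (take p js)) z)"
proof (induction p arbitrary: z)
  case 0
  have "monomial_map (mat 1) z = z"
  proof -
    have "(\<Prod>q\<in>UNIV. z $ q powi (mat 1 $ p $ q)) = (\<Prod>q\<in>UNIV. if q = p then z $ q else 1)" for p
      by (intro prod.cong) (auto simp: mat_def)
    then show ?thesis by (simp add: monomial_map_def vec_eq_iff)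
  qed
  then show ?case by (simp add: word_matrix_def)
next
  case (Suc p)
  let ?w = "monomial_map (elem_matrix (js ! p)) z"
  have ne: "sigma_map js p x \<notin> range (Exceptional (Suc p))" for x
    using sigma_map_in_tower[of js p x] tower_index[of "Suc p" _ js p] by force
  have "blow_down js (Suc p) (sigma_map js (Suc p) z) = sigma_map js p ?w"
    using ne by (auto simp: blow_down_def sigma_map_Suc monomial_elem_eq_0[THEN iffD2])
  then show ?case using Suc
    by (simp add: take_Suc_conv_app_nth word_matrix_snoc monomial_mult word_matrix_nonneg elem_matrix_nonneg)
qed

lemma kato_pi_sigma: "kato_pi js (kato_sigma js z) = monomial_map (word_matrix js) z"
  by (simp add: kato_pi_def kato_sigma_def kato_pi_sigma_aux)

subsection \<open>Kato words map the closed domain into the domain\<close>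

definition knorm :: "'n::{finite,wellorder} cspace \<Rightarrow> real" where
  "knorm z = (\<Sum>j\<in>UNIV - {last_ix}. (cmod (z $ j))\<^sup>2) + 2 * (cmod (z $ last_ix))\<^sup>2"

lemma kato_domain_eq: "kato_domain = {z. knorm z < 1}"
  by (simp add: kato_domain_def knorm_def)

lemma continuous_knorm: "continuous_on UNIV knorm"
  unfolding knorm_def by (intro continuous_intros)

lemma open_kato_domain: "open kato_domain"
  unfolding kato_domain_eq by (intro open_Collect_less continuous_knorm continuous_intros)

lemma closure_kato_domain: "z \<in> closure kato_domain \<Longrightarrow> knorm z \<le> 1"
proof -
  have "closed {z::'a cspace. knorm z \<le> 1}"
    by (intro closed_Collect_le continuous_knorm continuous_intros)
  then have "closure kato_domain \<subseteq> {z::'a cspace. knorm z \<le> 1}"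
    by (intro closure_minimal) (auto simp: kato_domain_eq)
  then show "z \<in> closure kato_domain \<Longrightarrow> knorm z \<le> 1" by auto
qed

lemma frontier_kato_domain: "frontier kato_domain = closure kato_domain - kato_domain"
  by (simp add: frontier_def interior_open open_kato_domain)

lemma knorm_elem:
  fixes z :: "'n::{finite,wellorder} cspace"
  shows "knorm z \<le> 1 \<Longrightarrow> j \<noteq> last_ix \<Longrightarrow> knorm (monomial_map (elem_matrix j) z) < 1"
    "knorm z \<le> 1 \<Longrightarrow> knorm (monomial_map (elem_matrix j) z) \<le> 1"
    "knorm z < 1 \<Longrightarrow> knorm (monomial_map (elem_matrix j) z) < 1"
proof -
  define u where "u = (cmod (z $ last_ix))\<^sup>2"
  define s where "s = (\<Sum>j\<in>UNIV - {last_ix}. (cmod (z $ j))\<^sup>2)"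
  define t where "t = (if j = last_ix then 1 else (cmod (z $ row_ix j last_ix))\<^sup>2)"
  have nz: "knorm z = s + 2 * u" by (simp add: knorm_def u_def s_def)
  have s0: "0 \<le> s" "0 \<le> u" "0 \<le> t" by (auto simp: s_def u_def t_def intro: sum_nonneg)
  have bij: "bij_betw (row_ix j) (UNIV - {j}) (UNIV - {last_ix})"
  proof (rule bij_betw_imageI)
    show "inj_on (row_ix j) (UNIV - {j})" by (rule inj_onI) (auto intro: row_ix_inj)
    show "row_ix j ` (UNIV - {j}) = UNIV - {last_ix}"
    proof (intro equalityI subsetI)
      fix q :: 'n assume "q \<in> UNIV - {last_ix}"
      then obtain p where "p \<noteq> j" "row_ix j p = q" using row_ix_surj[of q j] by blast
      then show "q \<in> row_ix j ` (UNIV - {j})" by blast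
    qed (auto dest: row_ix_ne_last)
  qed
  have "(\<Sum>p\<in>UNIV. (cmod (chart_vec j z $ p))\<^sup>2) = 1 + (\<Sum>p\<in>UNIV - {j}. (cmod (z $ row_ix j p))\<^sup>2)"
    by (subst sum.remove[of _ j]) (auto simp: chart_vec_nth)
  also have "(\<Sum>p\<in>UNIV - {j}. (cmod (z $ row_ix j p))\<^sup>2) = s"
    unfolding s_def using sum.reindex_bij_betw[OF bij] by simp
  finally have c: "(\<Sum>p\<in>UNIV. (cmod (chart_vec j z $ p))\<^sup>2) = 1 + s" .
  have n: "knorm w = (\<Sum>p\<in>UNIV. (cmod (w $ p))\<^sup>2) + (cmod (w $ last_ix))\<^sup>2" for w :: "'n cspace"
    unfolding knorm_def by (subst (2) sum.remove[of _ last_ix]) auto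
  have "knorm (z $ last_ix *s chart_vec j z) = u * (\<Sum>p\<in>UNIV. (cmod (chart_vec j z $ p))\<^sup>2) + u * t"
    by (auto simp: n norm_mult power_mult_distrib u_def t_def chart_vec_nth sum_distrib_left)
  then have k: "knorm (monomial_map (elem_matrix j) z) = u * (1 + s + t)"
    by (simp add: monomial_elem c algebra_simps)
  have ts: "t \<le> s" if "j \<noteq> last_ix"
    using that row_ix_ne_last[of last_ix j] unfolding t_def s_def
    by (auto intro!: member_le_sum[where f = "\<lambda>j. (cmod (z $ j))\<^sup>2"])
  have tl: "t = 1" if "j = last_ix" using that by (simp add: t_def)
  show "knorm (monomial_map (elem_matrix j) z) < 1" if "knorm z \<le> 1" "j \<noteq> last_ix"
  proof -
    have "u * (1 + s + t) \<le> u * (1 + 2 * s)" using ts that s0 by (intro mult_left_mono) auto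
    also have "\<dots> \<le> ((1 - s) / 2) * (1 + 2 * s)" using that s0 nz by (intro mult_right_mono) auto
    also have "\<dots> = 9/16 - (s - 1/4)\<^sup>2" by (simp add: field_simps power2_eq_square)
    also have "\<dots> < 1" by (smt (verit) divide_less_eq_1 zero_le_power2)
    finally show ?thesis using k by simp
  qed note A = this
  have B: "((1 - s) / 2) * (2 + s) \<le> 1" using s0 by (simp add: field_simps)
  show "knorm (monomial_map (elem_matrix j) z) \<le> 1" if "knorm z \<le> 1"
  proof (cases "j = last_ix")
    case True
    have "u * (1 + s + t) \<le> ((1 - s) / 2) * (2 + s)"
      using that s0 nz tl[OF True] by (intro mult_mono) auto
    then show ?thesis using k B by simp
  qed (use A that in force)
  show "knorm (monomial_map (elem_matrix j) z) < 1" if "knorm z < 1"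
  proof (cases "j = last_ix")
    case True
    have "u * (2 + s) < ((1 - s) / 2) * (2 + s)"
      using that s0 nz by (intro mult_strict_right_mono) auto
    then show ?thesis using k B tl[OF True] by simp
  qed (use A that in force)
qed

lemma knorm_word:
  "knorm z \<le> 1 \<Longrightarrow> knorm (monomial_map (word_matrix js) z) \<le> 1"
  "knorm z \<le> 1 \<Longrightarrow> \<exists>j\<in>set js. j \<noteq> last_ix \<Longrightarrow> knorm (monomial_map (word_matrix js) z) < 1"
proof -
  have e: "monomial_map (word_matrix []) z = z" for z :: "'a cspace"
    using kato_pi_sigma[of "[]" z] by (simp add: kato_pi_def kato_sigma_def)
  have C: "monomial_map (word_matrix (j # js)) z = monomial_map (elem_matrix j) (monomial_map (word_matrix js) z)"
    for z j js unfolding word_matrix_Cons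
    by (intro monomial_mult elem_matrix_nonneg word_matrix_nonneg)
  show 1: "knorm z \<le> 1 \<Longrightarrow> knorm (monomial_map (word_matrix js) z) \<le> 1" for js
    by (induction js) (auto simp: e C intro: knorm_elem)
  show "knorm z \<le> 1 \<Longrightarrow> \<exists>j\<in>set js. j \<noteq> last_ix \<Longrightarrow> knorm (monomial_map (word_matrix js) z) < 1"
    by (induction js) (use 1 in \<open>auto simp: e C intro: knorm_elem\<close>)
qed

subsection \<open>Holomorphic maps\<close>

definition holo_at :: "('n::finite cspace \<Rightarrow> 'm::finite cspace) \<Rightarrow> 'n cspace \<Rightarrow> bool" where
  "holo_at f v \<longleftrightarrow> (\<exists>f'. (f has_derivative f') (at v) \<and> (\<forall>c h. f' (c *s h) = c *s f' h))"

definition cholo_at :: "('n::finite cspace \<Rightarrow> complex) \<Rightarrow> 'n cspace \<Rightarrow> bool" where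
  "cholo_at f v \<longleftrightarrow> (\<exists>f'. (f has_derivative f') (at v) \<and> (\<forall>c h. f' (c *s h) = c * f' h))"

lemma holo_on_eq: "holo_on V f \<longleftrightarrow> (\<forall>v\<in>V. holo_at f v)"
  by (simp add: holo_on_def holo_at_def)

lemma bounded_linear_axis: "bounded_linear (axis i :: complex \<Rightarrow> 'n::finite cspace)"
proof -
  have "linear (axis i :: complex \<Rightarrow> 'n cspace)"
    by (rule linearI) (auto simp: vec_eq_iff axis_def)
  then show ?thesis by (simp add: linear_conv_bounded_linear)
qed

lemma holo_atI:
  fixes f :: "'n::finite cspace \<Rightarrow> 'm::finite cspace"
  assumes "\<And>i. cholo_at (\<lambda>v. f v $ i) v"
  shows "holo_at f v"
proof -
  obtain F where F: "\<And>i. ((\<lambda>v. f v $ i) has_derivative F i) (at v)"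
    "\<And>i c h. F i (c *s h) = c * F i h"
    using assms unfolding cholo_at_def by metis
  have e: "(\<Sum>i\<in>UNIV. axis i (x $ i)) = x" for x :: "'m cspace"
    by (simp add: vec_eq_iff axis_def)
  have "((\<lambda>v. \<Sum>i\<in>UNIV. axis i (f v $ i)) has_derivative (\<lambda>h. \<Sum>i\<in>UNIV. axis i (F i h))) (at v)"
    by (intro has_derivative_sum bounded_linear.has_derivative[OF bounded_linear_axis] F)
  then have "(f has_derivative (\<lambda>h. \<Sum>i\<in>UNIV. axis i (F i h))) (at v)" by (simp add: e)
  moreover have "(\<Sum>i\<in>UNIV. axis i (F i (c *s h))) = c *s (\<Sum>i\<in>UNIV. axis i (F i h))" for c h
    by (simp add: vec_eq_iff axis_def F(2))
  ultimately show ?thesis unfolding holo_at_def by blast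
qed

lemma holo_at_comp:
  assumes "holo_at f v" "holo_at g (f v)"
  shows "holo_at (\<lambda>x. g (f x)) v"
proof -
  obtain f' g' where "(f has_derivative f') (at v)" "\<forall>c h. f' (c *s h) = c *s f' h"
    "(g has_derivative g') (at (f v))" "\<forall>c h. g' (c *s h) = c *s g' h"
    using assms unfolding holo_at_def by blast
  then show ?thesis unfolding holo_at_def
    by (intro exI[of _ "\<lambda>h. g' (f' h)"]) (auto intro: has_derivative_compose)
qed

lemma holo_at_cong:
  assumes "holo_at f v" "open O'" "v \<in> O'" "\<And>x. x \<in> O' \<Longrightarrow> f x = g x"
  shows "holo_at g v"
  using assms has_derivative_transform_within_open[of f _ v UNIV O' g]
  unfolding holo_at_def by (metis)

lemma holo_at_continuous: "holo_at f v \<Longrightarrow> isCont f v"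
  unfolding holo_at_def using has_derivative_continuous by blast

lemma cholo_at_const: "cholo_at (\<lambda>_. 1) v"
  unfolding cholo_at_def by (intro exI[of _ "\<lambda>_. 0"]) auto

lemma cholo_at_nth: "cholo_at (\<lambda>v. v $ i) v"
  unfolding cholo_at_def
  by (intro exI[of _ "\<lambda>h. h $ i"]) (auto intro: bounded_linear_imp_has_derivative)

lemma cholo_at_mult:
  assumes "cholo_at f v" "cholo_at g v"
  shows "cholo_at (\<lambda>x. f x * g x) v"
proof -
  obtain f' g' where "(f has_derivative f') (at v)" "\<forall>c h. f' (c *s h) = c * f' h"
    "(g has_derivative g') (at v)" "\<forall>c h. g' (c *s h) = c * g' h"
    using assms unfolding cholo_at_def by blast
  then show ?thesis unfolding cholo_at_def
    by (intro exI[of _ "\<lambda>h. f v * g' h + f' h * g v"]) (auto intro: has_derivative_mult simp: algebra_simps)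
qed

lemma cholo_at_divide:
  assumes "cholo_at f v" "cholo_at g v" "g v \<noteq> 0"
  shows "cholo_at (\<lambda>x. f x / g x) v"
proof -
  obtain f' g' where "(f has_derivative f') (at v)" "\<forall>c h. f' (c *s h) = c * f' h"
    "(g has_derivative g') (at v)" "\<forall>c h. g' (c *s h) = c * g' h"
    using assms unfolding cholo_at_def by blast
  then show ?thesis unfolding cholo_at_def using assms(3)
    by (intro exI[of _ "\<lambda>h. (f' h * g v - f v * g' h) / (g v * g v)"])
      (auto intro: has_derivative_divide' simp: algebra_simps divide_simps)
qed

lemma cholo_chart_vec: "cholo_at (\<lambda>v. chart_vec j v $ p) v"
  by (cases "p = j") (simp_all add: chart_vec_nth cholo_at_const cholo_at_nth)

lemma holo_elem: "holo_at (monomial_map (elem_matrix j)) v"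
  by (rule holo_atI) (auto simp: monomial_elem intro!: cholo_at_mult cholo_at_nth cholo_chart_vec)

lemma monomial_map_one: "monomial_map (word_matrix []) z = z"
  using kato_pi_sigma[of "[]" z] by (simp add: kato_pi_def kato_sigma_def)

lemma monomial_map_Cons:
  "monomial_map (word_matrix (j # js)) z = monomial_map (elem_matrix j) (monomial_map (word_matrix js) z)"
  unfolding word_matrix_Cons by (intro monomial_mult elem_matrix_nonneg word_matrix_nonneg)

lemma holo_word: "holo_at (monomial_map (word_matrix js)) v"
proof (induction js)
  case Nil
  show ?case by (rule holo_atI) (simp add: monomial_map_one cholo_at_nth)
next
  case (Cons j js)
  then show ?case using holo_at_comp[OF Cons holo_elem, of j] by (simp add: monomial_map_Cons[abs_def])
qed

subsection \<open>Coordinate changes of a blow-up\<close>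

definition col_ix :: "'n \<Rightarrow> 'n \<Rightarrow> 'n::{finite,wellorder}" where
  "col_ix j q = (if q < j then q else next_ix q)"

lemma col_row_ix: "p \<noteq> j \<Longrightarrow> col_ix j (row_ix j p) = p"
  using next_ix_eq_iff[OF row_ix_ne_last[of p j], of j p] prev_ix_props(2)[of j p j]
  by (force simp: col_ix_def row_ix_def)

text \<open>The inverse of \<open>blowup_chart j\<close> at a point with homogeneous coordinates \<open>u\<close>,
  \<open>u\<^sub>j \<noteq> 0\<close>, and with \<open>j\<close>-th coordinate \<open>a\<close>.\<close>

definition chart_inv :: "'n \<Rightarrow> 'n cspace \<Rightarrow> complex \<Rightarrow> 'n::{finite,wellorder} cspace" where
  "chart_inv j u a = (\<chi> q. if q = last_ix then a else u $ col_ix j q / u $ j)"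

lemma chart_vec_inv:
  assumes "u $ j \<noteq> 0"
  shows "u $ j *s chart_vec j (chart_inv j u a) = u"
proof -
  have "u $ j * (chart_vec j (chart_inv j u a) $ p) = u $ p" for p
    using assms row_ix_ne_last[of p j] col_row_ix[of p j] by (simp add: chart_vec_nth chart_inv_def)
  then show ?thesis by (simp add: vec_eq_iff)
qed

lemma line_scale:
  assumes "c \<noteq> 0"
  shows "line (c *s v) = line v"
proof -
  have "d *s v = (d / c) *s (c *s v)" for d using assms by (simp add: vector_smult_assoc)
  then have "d *s v \<in> line (c *s v)" for d unfolding line_def by (metis rangeI)
  moreover have "d *s (c *s v) \<in> line v" for d
    unfolding line_def vector_smult_assoc by (rule rangeI)
  ultimately show ?thesis unfolding line_def by blast
qed

lemma blowup_chart_inv: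
  assumes "u $ j \<noteq> 0"
  shows "blowup_chart j (chart_inv j u (a * u $ j)) = (a *s u, line u)"
proof -
  let ?w = "chart_inv j u (a * u $ j)"
  have "?w $ last_ix = a * u $ j" by (simp add: chart_inv_def)
  moreover have e: "u $ j *s chart_vec j ?w = u" by (rule chart_vec_inv[OF assms])
  moreover have "line (chart_vec j ?w) = line u" using line_scale[OF assms, of "chart_vec j ?w"] e by simp
  ultimately show ?thesis by (simp add: blowup_chart_eq flip: vector_smult_assoc)
qed

lemma blowup_chart_overlap:
  assumes "chart_vec i z $ j \<noteq> 0"
  shows "blowup_chart j (chart_inv j (chart_vec i z) (z $ last_ix * chart_vec i z $ j)) = blowup_chart i z"
  using blowup_chart_inv[OF assms, of "z $ last_ix"] by (simp add: blowup_chart_eq)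

lemma elem_chart_inv:
  assumes "w $ j \<noteq> 0"
  shows "monomial_map (elem_matrix j) (chart_inv j w (w $ j)) = w" "chart_inv j w (w $ j) $ last_ix \<noteq> 0"
  using blowup_chart_inv[OF assms, of 1] assms by (auto simp: blowup_chart_def chart_inv_def)

lemma holo_chart_inv_self:
  assumes "w $ j \<noteq> 0"
  shows "holo_at (\<lambda>w. chart_inv j w (w $ j)) w"
proof (rule holo_atI)
  fix i show "cholo_at (\<lambda>v. chart_inv j v (v $ j) $ i) w"
    using assms by (cases "i = last_ix") (auto simp: chart_inv_def intro!: cholo_at_divide cholo_at_nth)
qed

lemma holo_chart_inv_overlap:
  assumes "chart_vec i z $ j \<noteq> 0"
  shows "holo_at (\<lambda>z. chart_inv j (chart_vec i z) (z $ last_ix * chart_vec i z $ j)) z"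
proof (rule holo_atI)
  fix q show "cholo_at (\<lambda>v. chart_inv j (chart_vec i v) (v $ last_ix * chart_vec i v $ j) $ q) z"
    using assms by (cases "q = last_ix")
     (auto simp: chart_inv_def intro!: cholo_at_divide cholo_chart_vec cholo_at_mult cholo_at_nth)
qed

lemma blowup_chart_eqD:
  assumes "blowup_chart i z = blowup_chart j w"
  shows "chart_vec i z $ j \<noteq> 0"
proof -
  have "chart_vec j w \<in> line (chart_vec j w)"
    unfolding line_def by (metis rangeI vector_smult_lid)
  then have "chart_vec j w \<in> line (chart_vec i z)" using assms by (simp add: blowup_chart_eq)
  then obtain c where "chart_vec j w = c *s chart_vec i z" unfolding line_def by auto
  from arg_cong[OF this, of "\<lambda>v. v $ j"] show ?thesis by (auto simp: chart_vec_nth)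
qed


subsection \<open>Compatible charts\<close>

definition chart_compat :: "('n::finite, 'p) chart \<Rightarrow> ('n, 'p) chart \<Rightarrow> bool" where
  "chart_compat c d \<longleftrightarrow> (\<forall>v\<in>overlap c d. \<exists>T g. open T \<and> v \<in> T \<and> T \<subseteq> fst c \<and>
     (\<forall>x\<in>T. holo_at g x \<and> g x \<in> fst d \<and> snd d (g x) = snd c x))"

lemma compatI:
  assumes "\<And>v. v \<in> V \<Longrightarrow> \<phi> v \<in> \<psi> ` U \<Longrightarrow> \<exists>T g. open T \<and> v \<in> T \<and> T \<subseteq> V \<and>
     (\<forall>x\<in>T. holo_at g x \<and> g x \<in> U \<and> \<psi> (g x) = \<phi> x)"
  shows "chart_compat (V, \<phi>) (U, \<psi>)"
  using assms by (force simp: chart_compat_def overlap_def)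

lemma compatE:
  assumes "chart_compat (V, \<phi>) (U, \<psi>)" "v \<in> V" "\<phi> v \<in> \<psi> ` U"
  obtains T g where "open T" "v \<in> T" "T \<subseteq> V" "\<forall>x\<in>T. holo_at g x \<and> g x \<in> U \<and> \<psi> (g x) = \<phi> x"
proof -
  have "v \<in> overlap (V, \<phi>) (U, \<psi>)" using assms by (simp add: overlap_def)
  then show ?thesis using assms(1) that unfolding chart_compat_def by fastforce
qed

lemma compat_transition:
  assumes "chart_compat c d" "inj_on (snd d) (fst d)"
  shows "open (overlap c d) \<and> holo_on (overlap c d) (transition c d)"
proof -
  obtain V \<phi> U \<psi> where c: "c = (V, \<phi>)" "d = (U, \<psi>)" by (metis prod.collapse)
  have *: "\<exists>T. open T \<and> v \<in> T \<and> T \<subseteq> overlap c d \<and> holo_at (transition c d) v" if v: "v \<in> overlap c d" for v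
  proof -
    have "v \<in> V" "\<phi> v \<in> \<psi> ` U" using v by (auto simp: overlap_def c)
    then obtain T g where T': "open T" "v \<in> T" "T \<subseteq> V"
      "\<forall>x\<in>T. holo_at g x \<and> g x \<in> U \<and> \<psi> (g x) = \<phi> x"
      by (rule compatE[OF assms(1)[unfolded c]])
    note T = T'(1-3) T'(4)[THEN bspec, THEN conjunct1] T'(4)[THEN bspec, THEN conjunct2, THEN conjunct1]
      T'(4)[THEN bspec, THEN conjunct2, THEN conjunct2]
    have "T \<subseteq> overlap c d" using T unfolding c overlap_def by (auto simp: subset_iff image_iff) metis
    moreover have "g x = transition c d x" if "x \<in> T" for x
      using T(5,6)[OF that] assms(2) inv_into_f_eq[of \<psi> U "g x" "\<phi> x"] by (simp add: transition_def c)
    ultimately show ?thesis using T holo_at_cong[of g v T "transition c d"] by blast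
  qed
  then have "open (overlap c d)" by (subst open_subopen) blast
  then show ?thesis unfolding holo_on_eq using * by blast
qed

text \<open>Convergence of points in the topology of the charts.\<close>

definition atlas_conv :: "('n::finite, 'p) chart set \<Rightarrow> (nat \<Rightarrow> 'p) \<Rightarrow> 'p \<Rightarrow> bool" where
  "atlas_conv \<A> x a \<longleftrightarrow> (\<exists>V \<phi> f v. (V, \<phi>) \<in> \<A> \<and> (\<forall>m. f m \<in> V \<and> x m = \<phi> (f m)) \<and> v \<in> V \<and> a = \<phi> v \<and> f \<longlonglongrightarrow> v)"

definition atlas_sep :: "('n::finite, 'p) chart set \<Rightarrow> bool" where
  "atlas_sep \<A> \<longleftrightarrow> (\<forall>x a b. atlas_conv \<A> x a \<longrightarrow> atlas_conv \<A> x b \<longrightarrow> a = b)"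

lemma sep_Hausdorff:
  assumes "atlas_sep \<A>" "(V, \<phi>) \<in> \<A>" "(U, \<psi>) \<in> \<A>" "v \<in> V" "u \<in> U" "open V" "open U" "\<phi> v \<noteq> \<psi> u"
  shows "\<exists>V' U'. open V' \<and> v \<in> V' \<and> V' \<subseteq> V \<and> open U' \<and> u \<in> U' \<and> U' \<subseteq> U \<and> \<phi> ` V' \<inter> \<psi> ` U' = {}"
proof (rule ccontr)
  assume H: "\<not> ?thesis"
  have "\<exists>a b. a \<in> V \<and> b \<in> U \<and> dist a v < inverse (real (Suc m)) \<and> dist b u < inverse (real (Suc m)) \<and> \<phi> a = \<psi> b" for m
  proof -
    let ?V = "V \<inter> ball v (inverse (real (Suc m)))" and ?U = "U \<inter> ball u (inverse (real (Suc m)))"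
    have "open ?V" "v \<in> ?V" "?V \<subseteq> V" "open ?U" "u \<in> ?U" "?U \<subseteq> U" using assms by auto
    then have "\<phi> ` ?V \<inter> \<psi> ` ?U \<noteq> {}" using H by blast
    then show ?thesis by (auto simp: dist_commute)
  qed
  then obtain a b where ab: "\<And>m. a m \<in> V \<and> b m \<in> U \<and> dist (a m) v < inverse (real (Suc m)) \<and> dist (b m) u < inverse (real (Suc m)) \<and> \<phi> (a m) = \<psi> (b m)"
    by metis
  have l: "f \<longlonglongrightarrow> w" if "\<And>m. dist (f m) w < inverse (real (Suc m))" for f and w :: "'a cspace"
  proof -
    have "(\<lambda>m. dist (f m) w) \<longlonglongrightarrow> 0"
      by (rule Lim_null_comparison[OF _ LIMSEQ_inverse_real_of_nat])
        (rule always_eventually, rule allI, simp add: less_imp_le[OF that] del: of_nat_Suc)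
    then show ?thesis by (simp add: tendsto_dist_iff[of f])
  qed
  have "a \<longlonglongrightarrow> v" "b \<longlonglongrightarrow> u" using ab l by blast+
  have "atlas_conv \<A> (\<lambda>m. \<phi> (a m)) (\<phi> v)" unfolding atlas_conv_def
    by (rule exI[of _ V], rule exI[of _ \<phi>], rule exI[of _ a], rule exI[of _ v])
      (use ab assms(2,4) \<open>a \<longlonglongrightarrow> v\<close> in auto)
  moreover have "atlas_conv \<A> (\<lambda>m. \<phi> (a m)) (\<psi> u)" unfolding atlas_conv_def
    by (rule exI[of _ U], rule exI[of _ \<psi>], rule exI[of _ b], rule exI[of _ u])
      (use ab assms(3,5) \<open>b \<longlonglongrightarrow> u\<close> in auto)
  ultimately show False using assms(1,8) unfolding atlas_sep_def by blast
qed

lemma complex_manifoldI: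
  assumes "\<And>V \<phi>. (V, \<phi>) \<in> \<A> \<Longrightarrow> open V" "\<And>V \<phi>. (V, \<phi>) \<in> \<A> \<Longrightarrow> inj_on \<phi> V"
    "X = (\<Union>(V, \<phi>)\<in>\<A>. \<phi> ` V)" "\<And>c d. c \<in> \<A> \<Longrightarrow> d \<in> \<A> \<Longrightarrow> chart_compat c d" "atlas_sep \<A>"
  shows "complex_manifold X \<A>"
  unfolding complex_manifold_def
proof (intro conjI ballI)
  fix c assume "c \<in> \<A>"
  then show "case c of (V, \<phi>) \<Rightarrow> open V \<and> inj_on \<phi> V" using assms(1,2) by (cases c) auto
next
  fix c d assume "c \<in> \<A>" "d \<in> \<A>"
  then have "open (overlap c d) \<and> holo_on (overlap c d) (transition c d)"
    by (intro compat_transition assms(4)) (use assms(2) in \<open>cases d, auto\<close>)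
  then show "open (overlap c d)" "holo_on (overlap c d) (transition c d)" by auto
next
  fix c assume c: "c \<in> \<A>"
  obtain V \<phi> where e: "c = (V, \<phi>)" by (cases c)
  show "case c of (V, \<phi>) \<Rightarrow> \<forall>(U, \<psi>)\<in>\<A>. \<forall>v\<in>V. \<forall>u\<in>U. \<phi> v \<noteq> \<psi> u \<longrightarrow>
        (\<exists>V' U'. open V' \<and> v \<in> V' \<and> V' \<subseteq> V \<and> open U' \<and> u \<in> U' \<and> U' \<subseteq> U \<and> \<phi> ` V' \<inter> \<psi> ` U' = {})"
    unfolding e prod.case
  proof (intro ballI, clarify)
    fix U \<psi> v u assume "(U, \<psi>) \<in> \<A>" "v \<in> V" "u \<in> U" "\<phi> v \<noteq> \<psi> u"
    then show "\<exists>V' U'. open V' \<and> v \<in> V' \<and> V' \<subseteq> V \<and> open U' \<and> u \<in> U' \<and> U' \<subseteq> U \<and> \<phi> ` V' \<inter> \<psi> ` U' = {}"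
      using c assms(1) by (intro sep_Hausdorff[OF assms(5)]) (auto simp: e)
  qed
qed (rule assms(3))

subsection \<open>The iterated blow-ups are manifolds\<close>

text \<open>The chart \<open>\<iota> \<circ> f\<^sub>j\<close> at level \<open>p + 1\<close>.\<close>

definition new_chart :: "'n::{finite,wellorder} list \<Rightarrow> nat \<Rightarrow> 'n \<Rightarrow> 'n cspace \<Rightarrow> 'n cspace blowup_point" where
  "new_chart js p j = blowup_embed (Suc p) (sigma_map js p) \<circ> blowup_chart j"

lemma new_chart_eq: "new_chart js p j z =
  (if z $ last_ix = 0 then Exceptional (Suc p) (line (chart_vec j z))
   else sigma_map js p (monomial_map (elem_matrix j) z))"
  by (simp add: new_chart_def blowup_embed_def blowup_chart_def monomial_elem_eq_0 chart_vec_def)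

lemma sigma_map_Suc_new: "sigma_map js (Suc p) = new_chart js p (js ! p)"
  by (simp add: new_chart_def sigma_map.simps(2))

lemma tower_atlas_Suc: "tower_atlas js (Suc p) =
   {({v \<in> V. \<phi> v \<noteq> sigma_map js p 0}, \<phi>) | V \<phi>. (V, \<phi>) \<in> tower_atlas js p} \<union>
   {(UNIV, new_chart js p j) | j. True}"
  by (simp add: new_chart_def)

declare tower_atlas.simps(2) [simp del]

lemma tower_atlas_oldI:
  "(V, \<phi>) \<in> tower_atlas js p \<Longrightarrow> ({v \<in> V. \<phi> v \<noteq> sigma_map js p 0}, \<phi>) \<in> tower_atlas js (Suc p)"
  unfolding tower_atlas_Suc by blast

lemma tower_atlas_newI: "(UNIV, new_chart js p j) \<in> tower_atlas js (Suc p)"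
  unfolding tower_atlas_Suc by blast

lemma sigma_map_not_exc: "sigma_map js p x \<noteq> Exceptional (Suc p) m"
  using sigma_map_in_tower[of js p x] tower_index[of "Suc p" m js p] by fastforce

lemma sigma_map_eq_iff: "sigma_map js p z = sigma_map js p w \<longleftrightarrow> z = w"
  using sigma_map_inj by blast

lemma new_chart_tower: "new_chart js p j z \<in> tower js p \<Longrightarrow> z $ last_ix \<noteq> 0"
  using tower_index[of "Suc p" "line (chart_vec j z)" js p] by (auto simp: new_chart_eq)

lemma sigma_map_chart: "(UNIV, sigma_map js p) \<in> tower_atlas js p"
  by (cases p) (auto simp: tower_atlas_Suc sigma_map_Suc_new)

lemma new_chart_eq_iff:
  "new_chart js p i z = new_chart js p j w \<longleftrightarrow> blowup_chart i z = blowup_chart j w"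
proof
  assume e: "new_chart js p i z = new_chart js p j w"
  have z: "z $ last_ix = 0 \<longleftrightarrow> w $ last_ix = 0"
    using e sigma_map_not_exc[of js p] sigma_map_not_exc[of js p, symmetric]
    unfolding new_chart_eq by metis
  show "blowup_chart i z = blowup_chart j w"
  proof (cases "z $ last_ix = 0")
    case True
    then show ?thesis using e z by (simp add: new_chart_eq blowup_chart_eq)
  next
    case False
    then have "monomial_map (elem_matrix i) z = monomial_map (elem_matrix j) w"
      using e z sigma_map_inj by (auto simp: new_chart_eq)
    then have F: "z $ last_ix *s chart_vec i z = w $ last_ix *s chart_vec j w" by (simp add: monomial_elem)
    moreover have "line (chart_vec i z) = line (chart_vec j w)"
      using line_scale False z F by metis
    ultimately show ?thesis by (simp add: blowup_chart_eq)
  qed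
qed (simp add: new_chart_def)

lemma new_chart_inj: "inj (new_chart js p j)"
  by (rule injI) (auto simp: new_chart_eq_iff intro: blowup_chart_inj)

lemma tower_atlas_image: "(V, \<phi>) \<in> tower_atlas js p \<Longrightarrow> v \<in> V \<Longrightarrow> \<phi> v \<in> tower js p"
proof (induction p arbitrary: V \<phi> v)
  case (Suc p)
  show ?case
  proof (cases "\<exists>V'. (V', \<phi>) \<in> tower_atlas js p \<and> V = {v \<in> V'. \<phi> v \<noteq> sigma_map js p 0}")
    case True
    then show ?thesis using Suc by auto
  next
    case False
    then obtain j where j: "\<phi> = new_chart js p j" using Suc.prems by (auto simp: tower_atlas_Suc)
    have "line (chart_vec j v) \<in> proj_space" unfolding proj_space_def using chart_vec_nonzero by blast
    then show ?thesis using sigma_map_in_tower[of js p]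
      by (simp add: j new_chart_eq monomial_elem_eq_0 sigma_map_eq_iff)
  qed
qed auto

lemma tower_atlas_cover: "x \<in> tower js p \<Longrightarrow> \<exists>(V, \<phi>)\<in>tower_atlas js p. x \<in> \<phi> ` V"
proof (induction p arbitrary: x)
  case (Suc p)
  show ?case
  proof (cases "x \<in> tower js p \<and> x \<noteq> sigma_map js p 0")
    case True
    then obtain V \<phi> v where "(V, \<phi>) \<in> tower_atlas js p" "v \<in> V" "x = \<phi> v" using Suc.IH[of x] by blast
    then show ?thesis using True by (intro bexI[OF _ tower_atlas_oldI]) auto
  next
    case False
    then obtain u where u: "u \<noteq> 0" "x = Exceptional (Suc p) (line u)"
      using Suc.prems by (auto simp: proj_space_def)
    obtain j where j: "u $ j \<noteq> 0" using u by (auto simp: vec_eq_iff)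
    have "blowup_chart j (chart_inv j u 0) = (0, line u)" using blowup_chart_inv[OF j, of 0] by simp
    then have "x = new_chart js p j (chart_inv j u 0)" by (simp add: u new_chart_def blowup_embed_def)
    then show ?thesis by (intro bexI[OF _ tower_atlas_newI]) auto
  qed
qed auto

lemma tower_atlas_inj: "(V, \<phi>) \<in> tower_atlas js p \<Longrightarrow> inj_on \<phi> V"
proof (induction p arbitrary: V \<phi>)
  case (Suc p)
  then show ?case using new_chart_inj by (auto simp: tower_atlas_Suc intro: inj_on_subset)
qed (auto intro: injI)

lemma tower_atlas_open: "(V, \<phi>) \<in> tower_atlas js p \<Longrightarrow> open V"
proof (induction p arbitrary: V \<phi>)
  case (Suc p)
  have "open {v \<in> U. \<phi> v \<noteq> c}" if "(U, \<phi>) \<in> tower_atlas js p" for U c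
  proof -
    have "finite {v \<in> U. \<phi> v = c}"
    proof (cases "\<exists>v. v \<in> U \<and> \<phi> v = c")
      case True
      then obtain v where "v \<in> U" "\<phi> v = c" by blast
      then have "{v \<in> U. \<phi> v = c} \<subseteq> {v}" using tower_atlas_inj[OF that] by (auto dest: inj_onD)
      then show ?thesis using finite_subset by blast
    next
      case False
      then have "{v \<in> U. \<phi> v = c} = {}" by blast
      then show ?thesis by (metis finite.emptyI)
    qed
    then have "open (U - {v \<in> U. \<phi> v = c})" using Suc.IH[OF that] by (intro open_Diff finite_imp_closed)
    moreover have "U - {v \<in> U. \<phi> v = c} = {v \<in> U. \<phi> v \<noteq> c}" by auto
    ultimately show ?thesis by simp
  qed
  then show ?case using Suc.prems by (auto simp: tower_atlas_Suc)
qed auto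

lemma open_preimage:
  assumes "open T" "\<And>x. x \<in> T \<Longrightarrow> holo_at g x" "open S"
  shows "open {x \<in> T. g x \<in> S}"
proof -
  have "continuous_on T g" using assms holo_at_continuous by (auto intro: continuous_at_imp_continuous_on)
  then have "open (g -` S \<inter> T)" using assms(1,3) continuous_on_open_vimage by blast
  then show ?thesis by (simp add: vimage_def Int_def conj_commute)
qed

lemma open_nth_ne: "open {x :: 'n::finite cspace. x $ j \<noteq> 0}"
  by (intro open_Collect_neq continuous_intros)

lemma tower_compat:
  "c \<in> tower_atlas js p \<Longrightarrow> d \<in> tower_atlas js p \<Longrightarrow> chart_compat c d"
proof (induction p arbitrary: c d)
  case 0
  show ?case using 0 cholo_at_nth by (auto intro!: compatI exI[of _ UNIV] exI[of _ "\<lambda>x. x"] holo_atI)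
next
  case (Suc p)
  let ?s = "sigma_map js p" and ?F = "\<lambda>j. monomial_map (elem_matrix j)"
  have old: "chart_compat (V', \<phi>) (U', \<psi>)" if c: "(V, \<phi>) \<in> tower_atlas js p" "V' = {v \<in> V. \<phi> v \<noteq> ?s 0}"
     and d: "(U, \<psi>) \<in> tower_atlas js p" "U' = {v \<in> U. \<psi> v \<noteq> ?s 0}" for V \<phi> V' U \<psi> U'
  proof (rule compatI)
    fix v assume v: "v \<in> V'" "\<phi> v \<in> \<psi> ` U'"
    then have "v \<in> V" "\<phi> v \<in> \<psi> ` U" using c d by auto
    then obtain T g where T': "open T" "v \<in> T" "T \<subseteq> V"
      "\<forall>x\<in>T. holo_at g x \<and> g x \<in> U \<and> \<psi> (g x) = \<phi> x"
      by (rule compatE[OF Suc.IH[OF c(1) d(1)]])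
    note T = T'(1-3) T'(4)[THEN bspec, THEN conjunct1] T'(4)[THEN bspec, THEN conjunct2, THEN conjunct1]
      T'(4)[THEN bspec, THEN conjunct2, THEN conjunct2]
    have "(V', \<phi>) \<in> tower_atlas js (Suc p)" using c unfolding tower_atlas_Suc by blast
    then have "open V'" by (rule tower_atlas_open)
    moreover have "g x \<in> U'" if "x \<in> T \<inter> V'" for x
      using T(5,6)[of x] that c(2) d(2) by auto
    ultimately show "\<exists>T g. open T \<and> v \<in> T \<and> T \<subseteq> V' \<and> (\<forall>x\<in>T. holo_at g x \<and> g x \<in> U' \<and> \<psi> (g x) = \<phi> x)"
      using T v by (intro exI[of _ "T \<inter> V'"] exI[of _ g]) auto
  qed
  have old_new: "chart_compat (V', \<phi>) (UNIV, new_chart js p j)"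
    if c: "(V, \<phi>) \<in> tower_atlas js p" "V' = {v \<in> V. \<phi> v \<noteq> ?s 0}" for V \<phi> V' j
  proof (rule compatI)
    fix v assume v: "v \<in> V'" "\<phi> v \<in> range (new_chart js p j)"
    then obtain z where z: "\<phi> v = new_chart js p j z" by auto
    have "\<phi> v \<in> tower js p" using tower_atlas_image[OF c(1), of v] v(1) c(2) by blast
    then have z0: "z $ last_ix \<noteq> 0" using new_chart_tower z by metis
    then have z': "\<phi> v = ?s (?F j z)" by (simp add: z new_chart_eq)
    have "v \<in> V" using v(1) c(2) by blast
    moreover have "\<phi> v \<in> ?s ` UNIV" using z' by blast
    ultimately obtain T g where T': "open T" "v \<in> T" "T \<subseteq> V"
      "\<forall>x\<in>T. holo_at g x \<and> g x \<in> UNIV \<and> ?s (g x) = \<phi> x"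
      by (rule compatE[OF Suc.IH[OF c(1) sigma_map_chart]])
    note T = T'(1-3) T'(4)[THEN bspec, THEN conjunct1] T'(4)[THEN bspec, THEN conjunct2, THEN conjunct1]
      T'(4)[THEN bspec, THEN conjunct2, THEN conjunct2]
    let ?T = "{x \<in> T. g x \<in> {y. y $ j \<noteq> 0}}"
    have "g v = ?F j z" using T(6)[OF T(2)] z' by (simp add: sigma_map_eq_iff)
    then have "v \<in> ?T" using T z0 by (simp add: monomial_elem chart_vec_nth)
    moreover have "open ?T" by (intro open_preimage T open_nth_ne)
    moreover have "?T \<subseteq> V'"
    proof
      fix x assume "x \<in> ?T"
      then have x: "x \<in> V" "g x \<noteq> 0" "?s (g x) = \<phi> x" using T by auto
      then have "\<phi> x \<noteq> ?s 0" using sigma_map_eq_iff by metis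
      then show "x \<in> V'" using c(2) x(1) by blast
    qed
    moreover have "holo_at (\<lambda>x. chart_inv j (g x) (g x $ j)) x" if "x \<in> ?T" for x
      using holo_at_comp[OF T(4), of x "\<lambda>w. chart_inv j w (w $ j)"] holo_chart_inv_self that by auto
    moreover have "new_chart js p j (chart_inv j (g x) (g x $ j)) = \<phi> x" if "x \<in> ?T" for x
      using elem_chart_inv[of "g x" j] T(6) that by (simp add: new_chart_eq)
    ultimately show "\<exists>T g. open T \<and> v \<in> T \<and> T \<subseteq> V' \<and> (\<forall>x\<in>T. holo_at g x \<and> g x \<in> UNIV \<and> new_chart js p j (g x) = \<phi> x)"
      by (intro exI[of _ ?T] exI[of _ "\<lambda>x. chart_inv j (g x) (g x $ j)"] conjI ballI UNIV_I) blast+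
  qed
  have new_old: "chart_compat (UNIV, new_chart js p j) (V', \<phi>)"
    if c: "(V, \<phi>) \<in> tower_atlas js p" "V' = {v \<in> V. \<phi> v \<noteq> ?s 0}" for V \<phi> V' j
  proof (rule compatI)
    fix z assume "new_chart js p j z \<in> \<phi> ` V'"
    then obtain v where v: "v \<in> V'" "\<phi> v = new_chart js p j z" by auto
    have "\<phi> v \<in> tower js p" using tower_atlas_image[OF c(1), of v] v(1) c(2) by blast
    then have z0: "z $ last_ix \<noteq> 0" using new_chart_tower v(2) by metis
    have "?s (?F j z) = \<phi> v" using v(2) z0 by (simp add: new_chart_eq)
    moreover have "v \<in> V" using v(1) c(2) by blast
    ultimately have "?s (?F j z) \<in> \<phi> ` V" by (rule image_eqI)
    then obtain T g where T': "open T" "?F j z \<in> T" "T \<subseteq> UNIV"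
      "\<forall>x\<in>T. holo_at g x \<and> g x \<in> V \<and> \<phi> (g x) = ?s x"
      by (rule compatE[OF Suc.IH[OF sigma_map_chart c(1)] UNIV_I])
    note T = T'(1-3) T'(4)[THEN bspec, THEN conjunct1] T'(4)[THEN bspec, THEN conjunct2, THEN conjunct1]
      T'(4)[THEN bspec, THEN conjunct2, THEN conjunct2]
    let ?T = "{x \<in> UNIV. ?F j x \<in> T} \<inter> {x. x $ last_ix \<noteq> 0}"
    have "open ?T" by (intro open_Int open_preimage holo_elem T open_UNIV open_nth_ne)
    moreover have "z \<in> ?T" using T z0 by simp
    moreover have "holo_at (\<lambda>x. g (?F j x)) x" if "x \<in> ?T" for x
      using that T(4)[of "?F j x"] holo_at_comp[OF holo_elem, of g j x] by auto
    moreover have "g (?F j x) \<in> V' \<and> \<phi> (g (?F j x)) = new_chart js p j x" if "x \<in> ?T" for x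
      using that T(5,6)[of "?F j x"] c(2)
      by (auto simp: new_chart_eq monomial_elem_eq_0 sigma_map_eq_iff)
    ultimately show "\<exists>T g. open T \<and> z \<in> T \<and> T \<subseteq> UNIV \<and> (\<forall>x\<in>T. holo_at g x \<and> g x \<in> V' \<and> \<phi> (g x) = new_chart js p j x)"
      by (intro exI[of _ ?T] exI[of _ "\<lambda>x. g (?F j x)"] conjI ballI subset_UNIV) blast+
  qed
  have new: "chart_compat (UNIV, new_chart js p i) (UNIV, new_chart js p j)" for i j
  proof (rule compatI)
    fix z assume "new_chart js p i z \<in> range (new_chart js p j)"
    then have z: "chart_vec i z $ j \<noteq> 0" by (auto simp: new_chart_eq_iff dest: blowup_chart_eqD)
    have "open {z. chart_vec i z $ j \<noteq> 0}"
      unfolding chart_vec_nth by (cases "j = i") (simp_all add: open_nth_ne)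
    then show "\<exists>T g. open T \<and> z \<in> T \<and> T \<subseteq> UNIV \<and>
        (\<forall>x\<in>T. holo_at g x \<and> g x \<in> UNIV \<and> new_chart js p j (g x) = new_chart js p i x)"
      using z by (intro exI[of _ "{z. chart_vec i z $ j \<noteq> 0}"]
        exI[of _ "\<lambda>z. chart_inv j (chart_vec i z) (z $ last_ix * chart_vec i z $ j)"])
       (auto simp: new_chart_eq_iff blowup_chart_overlap holo_chart_inv_overlap)
  qed
  have cs: "(\<exists>V \<phi>. (V, \<phi>) \<in> tower_atlas js p \<and> c = ({v \<in> V. \<phi> v \<noteq> ?s 0}, \<phi>)) \<or>
      (\<exists>j. c = (UNIV, new_chart js p j))" if "c \<in> tower_atlas js (Suc p)" for c
    using that unfolding tower_atlas_Suc by blast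
  consider (o) V \<phi> where "(V, \<phi>) \<in> tower_atlas js p" "c = ({v \<in> V. \<phi> v \<noteq> ?s 0}, \<phi>)"
    | (n) i where "c = (UNIV, new_chart js p i)" using cs[OF Suc.prems(1)] by blast
  note c = this
  consider (o) V \<phi> where "(V, \<phi>) \<in> tower_atlas js p" "d = ({v \<in> V. \<phi> v \<noteq> ?s 0}, \<phi>)"
    | (n) i where "d = (UNIV, new_chart js p i)" using cs[OF Suc.prems(2)] by blast
  note d = this
  show ?case
  proof (cases rule: c)
    case o1: o
    show ?thesis
    proof (cases rule: d)
      case o2: o
      show ?thesis unfolding o1(2) o2(2) by (rule old[OF o1(1) refl o2(1) refl])
    next
      case n2: n
      show ?thesis unfolding o1(2) n2 by (rule old_new[OF o1(1) refl])
    qed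
  next
    case n1: n
    show ?thesis
    proof (cases rule: d)
      case o2: o
      show ?thesis unfolding n1 o2(2) by (rule new_old[OF o2(1) refl])
    next
      case n2: n
      show ?thesis unfolding n1 n2 by (rule new)
    qed
  qed
qed

subsection \<open>The iterated blow-ups are Hausdorff\<close>

lemma continuous_elem: "isCont (monomial_map (elem_matrix j)) v"
  by (rule holo_at_continuous[OF holo_elem])

lemma tendsto_chart_vec: "f \<longlonglongrightarrow> v \<Longrightarrow> (\<lambda>m. chart_vec j (f m) $ p) \<longlonglongrightarrow> chart_vec j v $ p"
  unfolding chart_vec_nth by (cases "p = j") (auto intro: tendsto_vec_nth)

lemma convI:
  "(V, \<phi>) \<in> \<A> \<Longrightarrow> (\<And>m. f m \<in> V) \<Longrightarrow> (\<And>m. x m = \<phi> (f m)) \<Longrightarrow> v \<in> V \<Longrightarrow> f \<longlonglongrightarrow> v \<Longrightarrow> atlas_conv \<A> x (\<phi> v)"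
  unfolding atlas_conv_def by blast

lemma blowup_chart_limit:
  assumes e: "\<And>m. blowup_chart i (f m) = blowup_chart j (h m)" and f: "f \<longlonglongrightarrow> z" and h: "h \<longlonglongrightarrow> w"
  shows "blowup_chart i z = blowup_chart j w"
proof -
  let ?F = "\<lambda>j. monomial_map (elem_matrix j)"
  have "(\<lambda>m. ?F i (f m)) \<longlonglongrightarrow> ?F i z" "(\<lambda>m. ?F j (h m)) \<longlonglongrightarrow> ?F j w"
    using f h continuous_elem isCont_tendsto_compose by blast+
  moreover have "(\<lambda>m. ?F i (f m)) = (\<lambda>m. ?F j (h m))" using e by (auto simp: blowup_chart_def)
  ultimately have F: "?F i z = ?F j w" using LIMSEQ_unique by metis
  have c: "chart_vec i (f m) $ b = chart_vec i (f m) $ j * chart_vec j (h m) $ b" for m b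
  proof -
    have "chart_vec i (f m) \<in> line (chart_vec i (f m))"
      unfolding line_def by (metis rangeI vector_smult_lid)
    then have "chart_vec i (f m) \<in> line (chart_vec j (h m))" using e[of m] by (simp add: blowup_chart_eq)
    then obtain c where "chart_vec i (f m) = c *s chart_vec j (h m)" unfolding line_def by auto
    then show ?thesis by (simp add: chart_vec_nth)
  qed
  have "chart_vec i z $ b = chart_vec i z $ j * chart_vec j w $ b" for b
  proof (rule LIMSEQ_unique)
    show "(\<lambda>m. chart_vec i (f m) $ b) \<longlonglongrightarrow> chart_vec i z $ b" by (rule tendsto_chart_vec[OF f])
    show "(\<lambda>m. chart_vec i (f m) $ b) \<longlonglongrightarrow> chart_vec i z $ j * chart_vec j w $ b"
      using tendsto_mult[OF tendsto_chart_vec[OF f, of i j] tendsto_chart_vec[OF h, of j b]]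
      by (simp only: c[symmetric])
  qed
  then have l: "chart_vec i z = chart_vec i z $ j *s chart_vec j w"
    unfolding vec_eq_iff vector_smult_component by blast
  have n: "chart_vec i z $ j \<noteq> 0"
  proof
    assume "chart_vec i z $ j = 0"
    then have "chart_vec i z = 0 *s chart_vec j w" using l by metis
    then show False using chart_vec_nonzero[of i z] by simp
  qed
  have "line (chart_vec i z) = line (chart_vec j w)" by (subst l) (rule line_scale[OF n])
  then show ?thesis using F by (simp add: blowup_chart_def chart_vec_def)
qed

lemma conv_tower_cases:
  assumes "atlas_conv (tower_atlas js (Suc p)) x a"
  obtains (old) "atlas_conv (tower_atlas js p) x a" "a \<noteq> sigma_map js p 0" "\<And>m. x m \<in> tower js p"
  | (new) j f z where "\<And>m. x m = new_chart js p j (f m)" "a = new_chart js p j z" "f \<longlonglongrightarrow> z"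
proof -
  obtain V \<phi> f v where c: "(V, \<phi>) \<in> tower_atlas js (Suc p)" "\<And>m. f m \<in> V" "\<And>m. x m = \<phi> (f m)" "v \<in> V"
      "a = \<phi> v" "f \<longlonglongrightarrow> v"
    using assms unfolding atlas_conv_def by metis
  from c(1) consider (o) U where "(U, \<phi>) \<in> tower_atlas js p" "V = {v \<in> U. \<phi> v \<noteq> sigma_map js p 0}"
    | (n) j where "\<phi> = new_chart js p j" unfolding tower_atlas_Suc by blast
  then show ?thesis
  proof cases
    case o
    have U: "f m \<in> U" for m using c(2)[of m] o(2) by blast
    have v: "v \<in> U" "\<phi> v \<noteq> sigma_map js p 0" using c(4) o(2) by auto
    show ?thesis
    proof (rule old)
      show "atlas_conv (tower_atlas js p) x a" unfolding c(5) by (rule convI[OF o(1) U c(3) v(1) c(6)])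
      show "a \<noteq> sigma_map js p 0" using v c(5) by simp
      show "x m \<in> tower js p" for m unfolding c(3) by (rule tower_atlas_image[OF o(1) U])
    qed
  next
    case n
    then show ?thesis using new[of j f v] c by blast
  qed
qed

lemma tower_sep_aux:
  assumes "atlas_sep (tower_atlas js p)" "atlas_conv (tower_atlas js p) x a" "a \<noteq> sigma_map js p 0" "\<And>m. x m \<in> tower js p"
    "\<And>m. x m = new_chart js p j (f m)" "f \<longlonglongrightarrow> z"
  shows "a = new_chart js p j z"
proof -
  let ?F = "monomial_map (elem_matrix j)"
  have "f m $ last_ix \<noteq> 0" for m using assms(4,5) new_chart_tower by metis
  then have "x m = sigma_map js p (?F (f m))" for m using assms(5) by (simp add: new_chart_eq)
  moreover have "(\<lambda>m. ?F (f m)) \<longlonglongrightarrow> ?F z" using assms(6) continuous_elem isCont_tendsto_compose by blast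
  ultimately have "atlas_conv (tower_atlas js p) x (sigma_map js p (?F z))"
    by (intro convI[OF sigma_map_chart, of "\<lambda>m. ?F (f m)"]) auto
  then have "a = sigma_map js p (?F z)" using assms(1,2) unfolding atlas_sep_def by blast
  then show ?thesis using assms(3) by (auto simp: new_chart_eq monomial_elem_eq_0 sigma_map_eq_iff)
qed

lemma tower_sep: "atlas_sep (tower_atlas js p)"
proof (induction p)
  case 0
  show ?case unfolding atlas_sep_def
  proof (intro allI impI)
    fix x :: "nat \<Rightarrow> 'a cspace blowup_point" and a b
    have *: "\<exists>f v. (\<forall>m. x m = Ambient (f m)) \<and> c = Ambient v \<and> f \<longlonglongrightarrow> v"
      if "atlas_conv (tower_atlas js 0) x c" for c using that unfolding atlas_conv_def by auto
    assume "atlas_conv (tower_atlas js 0) x a" "atlas_conv (tower_atlas js 0) x b"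
    then obtain f v g w where fg: "\<And>m. x m = Ambient (f m)" "a = Ambient v" "f \<longlonglongrightarrow> v"
      "\<And>m. x m = Ambient (g m)" "b = Ambient w" "g \<longlonglongrightarrow> w" using * by metis
    have "f = g" using fg(1,4) by (auto simp: fun_eq_iff)
    then show "a = b" using fg LIMSEQ_unique by metis
  qed
next
  case (Suc p)
  show ?case unfolding atlas_sep_def
  proof (intro allI impI)
    fix x a b assume a: "atlas_conv (tower_atlas js (Suc p)) x a" and b: "atlas_conv (tower_atlas js (Suc p)) x b"
    from a show "a = b"
    proof (cases rule: conv_tower_cases)
      case old
      note a = this
      from b show ?thesis
      proof (cases rule: conv_tower_cases)
        case old
        then show ?thesis using a Suc.IH unfolding atlas_sep_def by blast
      next
        case (new j f z)
        show ?thesis unfolding new(2) by (rule tower_sep_aux[OF Suc.IH a new(1) new(3)])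
      qed
    next
      case (new j f z)
      note a = this
      from b show ?thesis
      proof (cases rule: conv_tower_cases)
        case old
        show ?thesis unfolding a(2) by (rule tower_sep_aux[OF Suc.IH old a(1) a(3), symmetric])
      next
        case (new i h w)
        have "blowup_chart j (f m) = blowup_chart i (h m)" for m
          using a(1)[of m] new(1)[of m] new_chart_eq_iff by metis
        then have "blowup_chart j z = blowup_chart i w" by (rule blowup_chart_limit[OF _ a(3) new(3)])
        then show ?thesis using a(2) new(2) by (simp add: new_chart_eq_iff)
      qed
    qed
  qed
qed

lemma tower_manifold: "complex_manifold (tower js p) (tower_atlas js p)"
proof (rule complex_manifoldI)
  show "tower js p = (\<Union>(V, \<phi>)\<in>tower_atlas js p. \<phi> ` V)"
  proof (intro equalityI subsetI)
    fix x assume "x \<in> tower js p"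
    then show "x \<in> (\<Union>(V, \<phi>)\<in>tower_atlas js p. \<phi> ` V)" using tower_atlas_cover by fastforce
  qed (auto intro: tower_atlas_image)
qed (auto intro: tower_atlas_open tower_atlas_inj tower_compat tower_sep)

subsection \<open>The projection\<close>

definition tower_proj :: "'n::{finite,wellorder} list \<Rightarrow> nat \<Rightarrow> 'n cspace blowup_point \<Rightarrow> 'n cspace" where
  "tower_proj js p x = ambient_coord (blow_down_comp js p x)"

lemma kato_pi_proj: "kato_pi js = tower_proj js (length js)"
  by (simp add: kato_pi_def tower_proj_def fun_eq_iff)

lemma proj_sigma: "p \<le> length js \<Longrightarrow> tower_proj js p (sigma_map js p z) = monomial_map (word_matrix (take p js)) z"
  by (simp add: tower_proj_def kato_pi_sigma_aux)

lemma blow_down_old: "x \<in> tower js p \<Longrightarrow> blow_down js (Suc p) x = x"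
  using tower_index[of "Suc p" _ js p] by (force simp: blow_down_def)

lemma blow_down_new: "blow_down js (Suc p) (new_chart js p j z) = sigma_map js p (monomial_map (elem_matrix j) z)"
proof (cases "z $ last_ix = 0")
  case True
  then show ?thesis by (simp add: new_chart_eq blow_down_def monomial_elem_eq_0[THEN iffD2])
next
  case False
  then show ?thesis using blow_down_old[OF sigma_map_in_tower] by (simp add: new_chart_eq)
qed

lemma proj_Suc: "tower_proj js (Suc p) x = tower_proj js p (blow_down js (Suc p) x)"
  by (simp add: tower_proj_def)

lemma proj_continuous:
  "(V, \<phi>) \<in> tower_atlas js p \<Longrightarrow> p \<le> length js \<Longrightarrow> continuous_on V (\<lambda>v. tower_proj js p (\<phi> v))"
proof (induction p arbitrary: V \<phi>)
  case 0
  then show ?case by (simp add: tower_proj_def)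
next
  case (Suc p)
  from Suc.prems(1) consider (o) U where "(U, \<phi>) \<in> tower_atlas js p" "V = {v \<in> U. \<phi> v \<noteq> sigma_map js p 0}"
    | (n) j where "\<phi> = new_chart js p j" unfolding tower_atlas_Suc by blast
  then show ?case
  proof cases
    case o
    have "continuous_on V (\<lambda>v. tower_proj js p (\<phi> v))"
      by (rule continuous_on_subset[OF Suc.IH[OF o(1)]]) (use Suc.prems o in auto)
    moreover have "tower_proj js (Suc p) (\<phi> v) = tower_proj js p (\<phi> v)" if "v \<in> V" for v
    proof -
      have "\<phi> v \<in> tower js p" using tower_atlas_image[OF o(1)] that o(2) by blast
      then show ?thesis by (simp add: proj_Suc blow_down_old)
    qed
    ultimately show ?thesis by simp
  next
    case n
    have "tower_proj js (Suc p) (\<phi> v) = monomial_map (word_matrix (take p js)) (monomial_map (elem_matrix j) v)" for v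
      using Suc.prems by (simp add: n proj_Suc blow_down_new proj_sigma)
    then show ?thesis
      by (simp, intro continuous_at_imp_continuous_on ballI holo_at_continuous holo_at_comp[OF holo_elem holo_word])
  qed
qed

lemma proj_Ambient: "tower_proj js p (Ambient z) = z"
proof (induction p)
  case (Suc p)
  have "blow_down js (Suc p) (Ambient z) = Ambient z" by (auto simp: blow_down_def)
  then show ?case using Suc by (simp add: proj_Suc)
qed (simp add: tower_proj_def)

lemma monomial_word_0: "monomial_map (word_matrix js) 0 = 0"
  by (induction js) (auto simp: monomial_map_one monomial_map_Cons monomial_elem)

lemma proj_exceptional: "Exceptional i l \<in> tower js p \<Longrightarrow> p \<le> length js \<Longrightarrow> tower_proj js p (Exceptional i l) = 0"
proof (induction p)
  case (Suc p)
  show ?case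
  proof (cases "i = Suc p")
    case True
    then show ?thesis using Suc.prems by (simp add: proj_Suc blow_down_def proj_sigma monomial_word_0)
  next
    case False
    then have "Exceptional i l \<in> tower js p" using Suc.prems by auto
    then show ?thesis using Suc by (simp add: proj_Suc blow_down_old)
  qed
qed auto

lemma Ambient_chart: "\<exists>V. - {0} \<subseteq> V \<and> (V, Ambient) \<in> tower_atlas js p"
proof (induction p)
  case (Suc p)
  then obtain V where V: "- {0} \<subseteq> V" "(V, Ambient) \<in> tower_atlas js p" by blast
  have "Ambient v \<noteq> sigma_map js p 0" if "v \<noteq> 0" for v
    using that by (cases p) (auto simp: sigma_map_Suc_new new_chart_eq)
  then show ?case using V tower_atlas_oldI[OF V(2)] by (intro exI[of _ "{v \<in> V. Ambient v \<noteq> sigma_map js p 0}"]) auto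
qed auto

lemma Ambient_tower: "z \<noteq> 0 \<Longrightarrow> Ambient z \<in> tower js p"
  using Ambient_chart[of js p] tower_atlas_image[of _ Ambient js p z] by blast

lemma tower_proj_nonzero:
  assumes "x \<in> tower js p" "p \<le> length js" "tower_proj js p x \<noteq> 0"
  shows "x = Ambient (tower_proj js p x)"
  using assms proj_exceptional[of _ _ js p] by (cases x) (auto simp: proj_Ambient)


subsection \<open>Charts of the glued manifold\<close>

text \<open>The map \<open>\<phi>\<close> agrees with a chart of the tower near \<open>v\<close>.\<close>

definition lchart :: "'n::{finite,wellorder} list \<Rightarrow> 'n cspace set \<Rightarrow> ('n cspace \<Rightarrow> 'n cspace blowup_point) \<Rightarrow> 'n cspace \<Rightarrow> bool" where
  "lchart js V \<phi> v \<longleftrightarrow> (\<exists>S W \<psi>. open S \<and> v \<in> S \<and> S \<subseteq> V \<inter> W \<and> (W, \<psi>) \<in> tower_atlas js (length js) \<and> (\<forall>x\<in>S. \<phi> x = \<psi> x))"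

lemma lchart_compat:
  assumes "lchart js V \<phi> v" "lchart js U \<psi> u" "\<phi> v = \<psi> u"
  shows "\<exists>T g. open T \<and> v \<in> T \<and> T \<subseteq> V \<and> (\<forall>x\<in>T. holo_at g x \<and> g x \<in> U \<and> \<psi> (g x) = \<phi> x)"
proof -
  obtain S V1 \<phi>1 where S: "open S" "v \<in> S" "S \<subseteq> V \<inter> V1" "(V1, \<phi>1) \<in> tower_atlas js (length js)"
    "\<forall>x\<in>S. \<phi> x = \<phi>1 x" using assms(1) unfolding lchart_def by blast
  obtain R U1 \<psi>1 where R: "open R" "u \<in> R" "R \<subseteq> U \<inter> U1" "(U1, \<psi>1) \<in> tower_atlas js (length js)"
    "\<forall>x\<in>R. \<psi> x = \<psi>1 x" using assms(2) unfolding lchart_def by blast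
  have vV: "v \<in> V1" and uU: "u \<in> U1" using S R by auto
  have e: "\<phi>1 v = \<psi>1 u" using S R assms(3) by metis
  then have "\<phi>1 v \<in> \<psi>1 ` U1" using uU by (rule image_eqI)
  then obtain T g where T: "open T" "v \<in> T" "T \<subseteq> V1"
    "\<forall>x\<in>T. holo_at g x \<and> g x \<in> U1 \<and> \<psi>1 (g x) = \<phi>1 x"
    by (rule compatE[OF tower_compat[OF S(4) R(4)] vV])
  have "\<psi>1 (g v) = \<psi>1 u" "g v \<in> U1" using T(2,4) e by auto
  then have gv: "g v = u" using tower_atlas_inj[OF R(4)] uU by (meson inj_onD)
  let ?T = "{x \<in> T. g x \<in> R} \<inter> S"
  have "open ?T" using T S R by (intro open_Int open_preimage) auto
  moreover have "v \<in> ?T" using gv T S R by auto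
  moreover have "?T \<subseteq> V" using S by auto
  moreover have "holo_at g x \<and> g x \<in> U \<and> \<psi> (g x) = \<phi> x" if "x \<in> ?T" for x
    using that T(4) S(5) R(3,5) by auto
  ultimately show ?thesis by blast
qed

lemma pair_set_eq: "{(I V \<phi>, c \<phi>) | V \<phi>. P V \<phi>} = {(V, c \<phi>) | V \<phi>. \<exists>U. P U \<phi> \<and> V = I U \<phi>}"
  by blast

locale kato =
  fixes js :: "'n::{finite,wellorder} list"
  assumes kato: "\<exists>j\<in>set js. j \<noteq> last_ix"
begin

abbreviation "D \<equiv> kato_domain :: 'n cspace set"
abbreviation "\<sigma> \<equiv> kato_sigma js"
abbreviation "\<pi> \<equiv> kato_pi js"
abbreviation "F \<equiv> monomial_map (word_matrix js)"
abbreviation "X \<equiv> tower js (length js)"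
abbreviation "E \<equiv> {x \<in> X. \<pi> x \<in> D \<and> x \<notin> \<sigma> ` D}"
definition "gam z = (if z \<in> D then Ambient z else \<sigma> z)"

lemma pi_sigma: "\<pi> (\<sigma> z) = F z" by (rule kato_pi_sigma)
lemma pi_Ambient: "\<pi> (Ambient z) = z" by (simp add: kato_pi_proj proj_Ambient)
lemma sigma_X: "\<sigma> z \<in> X" by (simp add: kato_sigma_def sigma_map_in_tower)
lemma sigma_eq: "\<sigma> z = \<sigma> w \<longleftrightarrow> z = w" by (simp add: kato_sigma_def sigma_map_eq_iff)
lemma sigma_chart: "(UNIV, \<sigma>) \<in> tower_atlas js (length js)" unfolding kato_sigma_def by (rule sigma_map_chart)
lemma F_cont: "isCont F z" by (rule holo_at_continuous[OF holo_word])
lemma F_closure: "z \<in> closure D \<Longrightarrow> F z \<in> D"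
  using knorm_word(2)[OF closure_kato_domain kato] by (auto simp: kato_domain_eq[where 'a = 'n])
lemma zero_D: "0 \<in> D" by (simp add: kato_domain_def)
lemma D_closure: "z \<in> D \<Longrightarrow> z \<in> closure D" using closure_subset by blast
lemma frontier_iff: "z \<in> frontier D \<longleftrightarrow> z \<in> closure D \<and> z \<notin> D" by (auto simp: frontier_kato_domain)

lemma bounded_D: "bounded D"
proof -
  have "norm z \<le> real CARD('n)" if "z \<in> D" for z
  proof -
    have c: "cmod (z $ i) \<le> 1" for i
    proof -
      have "(cmod (z $ i))\<^sup>2 \<le> knorm z"
      proof (cases "i = last_ix")
        case True
        have "0 \<le> (\<Sum>j\<in>UNIV - {last_ix}. (cmod (z $ j))\<^sup>2)" by (intro sum_nonneg) auto
        moreover have "0 \<le> (cmod (z $ last_ix))\<^sup>2" by simp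
        ultimately show ?thesis unfolding knorm_def True by linarith
      next
        case False
        then have "(cmod (z $ i))\<^sup>2 \<le> (\<Sum>j\<in>UNIV - {last_ix}. (cmod (z $ j))\<^sup>2)"
          by (intro member_le_sum) auto
        moreover have "0 \<le> (cmod (z $ last_ix))\<^sup>2" by simp
        ultimately show ?thesis unfolding knorm_def by linarith
      qed
      also have "\<dots> \<le> 1" using that by (simp add: kato_domain_eq)
      finally show ?thesis by (simp add: power_le_one_iff)
    qed
    have "norm z \<le> (\<Sum>i\<in>UNIV. cmod (z $ i))" unfolding norm_vec_def by (rule L2_set_le_sum) auto
    also have "\<dots> \<le> (\<Sum>i\<in>(UNIV::'n set). 1)" by (intro sum_mono c)
    finally show ?thesis by simp
  qed
  then show ?thesis unfolding bounded_iff by blast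
qed

lemma compact_cD: "compact (closure D)" using bounded_D by (simp add: compact_closure)

lemma glue_E: "x \<in> E \<Longrightarrow> kato_glue js x = x" by (simp add: kato_glue_def frontier_iff)

lemma E_pre: "x \<in> E \<Longrightarrow> x \<in> kato_pre js" by (auto simp: kato_pre_def D_closure)

lemma class_eqI: "kato_glue js x = kato_glue js y \<Longrightarrow> kato_class js x = kato_class js y"
  by (simp add: kato_class_def)

lemma class_inj: "x \<in> E \<Longrightarrow> y \<in> E \<Longrightarrow> kato_class js x = kato_class js y \<Longrightarrow> x = y"
proof -
  assume x: "x \<in> E" and y: "y \<in> E" and e: "kato_class js x = kato_class js y"
  have "x \<in> kato_class js x" unfolding kato_class_def using E_pre[OF x] by blast
  then have "x \<in> kato_class js y" unfolding e .
  then have "kato_glue js x = kato_glue js y" unfolding kato_class_def by blast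
  then show "x = y" by (simp only: glue_E[OF x] glue_E[OF y])
qed

lemma sigma_E: "z \<notin> D \<Longrightarrow> F z \<in> D \<Longrightarrow> \<sigma> z \<in> E"
  by (auto simp: sigma_X pi_sigma sigma_eq)

lemma class_frontier: "x \<in> X \<Longrightarrow> \<pi> x \<in> frontier D \<Longrightarrow> kato_class js x = kato_class js (\<sigma> (\<pi> x))"
proof (rule class_eqI)
  assume "x \<in> X" and p: "\<pi> x \<in> frontier D"
  then have "\<sigma> (\<pi> x) \<in> E" using frontier_iff F_closure by (intro sigma_E) auto
  then show "kato_glue js x = kato_glue js (\<sigma> (\<pi> x))" using p glue_E by (simp add: kato_glue_def)
qed

lemma space_E: "kato_class js ` kato_pre js = kato_class js ` E"
proof (intro equalityI subsetI)
  fix c assume "c \<in> kato_class js ` kato_pre js"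
  then obtain x where x: "x \<in> kato_pre js" "c = kato_class js x" by blast
  show "c \<in> kato_class js ` E"
  proof (cases "\<pi> x \<in> D")
    case True
    then show ?thesis using x by (auto simp: kato_pre_def)
  next
    case False
    then have p: "\<pi> x \<in> frontier D" "x \<in> X" using x by (auto simp: frontier_iff kato_pre_def)
    then have "\<sigma> (\<pi> x) \<in> E" using frontier_iff F_closure by (intro sigma_E) auto
    then show ?thesis using class_frontier[OF p(2,1)] x(2) by blast
  qed
next
  fix c assume "c \<in> kato_class js ` E"
  then show "c \<in> kato_class js ` kato_pre js" using E_pre by blast
qed

lemma collar_map: "kato_collar_map js = kato_class js \<circ> gam"
  by (auto simp: kato_collar_map_def gam_def)

lemma collar_iff: "z \<in> kato_collar js \<longleftrightarrow>
  (if z \<in> D then z \<noteq> 0 \<and> Ambient z \<notin> \<sigma> ` closure D else F z \<in> D)"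
  by (simp add: kato_collar_def pi_sigma)

lemma gam_E: "z \<in> kato_collar js \<Longrightarrow> gam z \<in> E"
  using sigma_E[of z] Ambient_tower[of z js "length js"] D_closure
  by (auto simp: collar_iff gam_def pi_Ambient split: if_splits)

lemma pi_cont: "(V, \<phi>) \<in> tower_atlas js (length js) \<Longrightarrow> continuous_on V (\<lambda>v. \<pi> (\<phi> v))"
  unfolding kato_pi_proj by (rule proj_continuous) auto

lemma interior_open:
  assumes V: "(V, \<phi>) \<in> tower_atlas js (length js)"
  shows "open {v \<in> V. \<pi> (\<phi> v) \<in> D \<and> \<phi> v \<notin> \<sigma> ` closure D}"
proof -
  have oV: "open V" by (rule tower_atlas_open[OF V])
  define T where "T = {v \<in> V. \<phi> v \<in> \<sigma> ` closure D}"
  have cl: "v \<in> T" if vc: "v \<in> closure T" "v \<in> V" for v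
  proof -
    obtain f where a: "(\<forall>n. f n \<in> T) \<and> v \<in> V \<and> f \<longlonglongrightarrow> v"
      using vc unfolding closure_sequential by blast
    then have "\<forall>n. \<exists>k. k \<in> closure D \<and> \<phi> (f n) = \<sigma> k" unfolding T_def by blast
    then obtain k where k: "\<And>n. k n \<in> closure D" "\<And>n. \<phi> (f n) = \<sigma> (k n)" by metis
    obtain l r where r: "l \<in> closure D" "strict_mono r" "(k \<circ> r) \<longlonglongrightarrow> l"
      using compact_cD k(1) unfolding compact_def by metis
    have "atlas_conv (tower_atlas js (length js)) (\<lambda>n. \<phi> (f (r n))) (\<sigma> l)"
      using r(3) k(2) by (intro convI[OF sigma_chart, of "\<lambda>n. k (r n)"]) (auto simp: o_def)
    moreover have "atlas_conv (tower_atlas js (length js)) (\<lambda>n. \<phi> (f (r n))) (\<phi> v)"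
      using a LIMSEQ_subseq_LIMSEQ[of f v r] r(2) by (intro convI[OF V, of "\<lambda>n. f (r n)"]) (auto simp: o_def T_def)
    ultimately have "\<sigma> l = \<phi> v" using tower_sep[of js "length js"] unfolding atlas_sep_def by blast
    then have "\<phi> v \<in> \<sigma> ` closure D" using r(1) by (metis image_eqI)
    then show "v \<in> T" using vc(2) by (simp add: T_def)
  qed
  have "V - T = V - closure T"
    using cl closure_subset[of T] by blast
  moreover have "open (V - closure T)" by (rule open_Diff[OF oV closed_closure])
  ultimately have o1: "open (V - T)" by simp
  have "open (V \<inter> (\<lambda>v. \<pi> (\<phi> v)) -` D)"
    by (rule continuous_open_preimage[OF pi_cont[OF V] oV open_kato_domain])
  then have "open (V \<inter> (\<lambda>v. \<pi> (\<phi> v)) -` D \<inter> (V - T))" using o1 by (rule open_Int)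
  moreover have "V \<inter> (\<lambda>v. \<pi> (\<phi> v)) -` D \<inter> (V - T) = {v \<in> V. \<pi> (\<phi> v) \<in> D \<and> \<phi> v \<notin> \<sigma> ` closure D}"
    unfolding T_def by blast
  ultimately show ?thesis by simp
qed

text \<open>The two kinds of charts, before passing to classes.\<close>

definition "int_chart V \<phi> \<longleftrightarrow> (\<exists>U. (U, \<phi>) \<in> tower_atlas js (length js) \<and>
  V = {v \<in> U. \<pi> (\<phi> v) \<in> D \<and> \<phi> v \<notin> \<sigma> ` closure D})"
definition "col_chart N \<longleftrightarrow> open N \<and> N \<subseteq> kato_collar js \<and> inj_on (kato_collar_map js) N"

lemma word_atlas_eq: "kato_word_atlas js =
  {(V, kato_class js \<circ> \<phi>) | V \<phi>. int_chart V \<phi>} \<union> {(N, kato_class js \<circ> gam) | N. col_chart N}"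
  unfolding kato_word_atlas_def int_chart_def col_chart_def collar_map by (subst pair_set_eq) (rule refl)

lemma int_E: "int_chart V \<phi> \<Longrightarrow> v \<in> V \<Longrightarrow> \<phi> v \<in> E \<and> \<phi> v \<notin> \<sigma> ` closure D"
proof -
  assume a: "int_chart V \<phi>" and v: "v \<in> V"
  obtain U where U: "(U, \<phi>) \<in> tower_atlas js (length js)"
    "V = {v \<in> U. \<pi> (\<phi> v) \<in> D \<and> \<phi> v \<notin> \<sigma> ` closure D}" using a unfolding int_chart_def by (elim exE conjE)
  have w: "v \<in> U" "\<pi> (\<phi> v) \<in> D" "\<phi> v \<notin> \<sigma> ` closure D" using v unfolding U(2) by simp_all
  have "\<sigma> ` D \<subseteq> \<sigma> ` closure D" by (rule image_mono[OF closure_subset])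
  then have "\<phi> v \<notin> \<sigma> ` D" using w(3) by (rule contra_subsetD)
  then show ?thesis using w tower_atlas_image[OF U(1) w(1)] by simp
qed

lemma col_E: "col_chart N \<Longrightarrow> z \<in> N \<Longrightarrow> gam z \<in> E"
  using gam_E unfolding col_chart_def by blast

lemma col_inj: "col_chart N \<Longrightarrow> inj_on gam N"
  unfolding col_chart_def collar_map by (simp add: inj_on_def)

lemma int_open: "int_chart V \<phi> \<Longrightarrow> open V"
  unfolding int_chart_def by (elim exE conjE) (simp add: interior_open)

lemma int_inj:
  assumes "int_chart V \<phi>"
  shows "inj_on \<phi> V"
proof -
  obtain U where U: "(U, \<phi>) \<in> tower_atlas js (length js)"
    "V = {v \<in> U. \<pi> (\<phi> v) \<in> D \<and> \<phi> v \<notin> \<sigma> ` closure D}" using assms unfolding int_chart_def by (elim exE conjE)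
  show ?thesis by (rule inj_on_subset[OF tower_atlas_inj[OF U(1)]]) (simp add: U(2) subset_iff)
qed

lemma word_atlas_int: "int_chart V \<phi> \<Longrightarrow> (V, kato_class js \<circ> \<phi>) \<in> kato_word_atlas js"
  unfolding word_atlas_eq by (rule UnI1, rule CollectI, intro exI conjI) (rule refl)

lemma word_atlas_col: "col_chart N \<Longrightarrow> (N, kato_class js \<circ> gam) \<in> kato_word_atlas js"
  unfolding word_atlas_eq by (rule UnI2, rule CollectI, intro exI conjI) (rule refl)

lemma word_atlas_cases:
  assumes "(V, \<phi>) \<in> kato_word_atlas js"
  obtains (i) \<psi> where "int_chart V \<psi>" "\<phi> = kato_class js \<circ> \<psi>" | (c) "col_chart V" "\<phi> = kato_class js \<circ> gam"
  using assms unfolding word_atlas_eq by (elim UnE CollectE exE conjE) simp_all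

lemma int_lchart: "int_chart V \<phi> \<Longrightarrow> v \<in> V \<Longrightarrow> lchart js V \<phi> v"
proof -
  assume a: "int_chart V \<phi>" and v: "v \<in> V"
  obtain U where U: "(U, \<phi>) \<in> tower_atlas js (length js)"
    "V = {v \<in> U. \<pi> (\<phi> v) \<in> D \<and> \<phi> v \<notin> \<sigma> ` closure D}" using a unfolding int_chart_def by (elim exE conjE)
  have "open V" unfolding U(2) by (rule interior_open[OF U(1)])
  then show ?thesis unfolding lchart_def using v U
    by (intro exI[of _ V] exI[of _ U] exI[of _ \<phi>]) auto
qed

lemma col_lchart:
  assumes N: "col_chart N" and z: "z \<in> N" "z \<notin> frontier D"
  shows "lchart js N gam z"
proof (cases "z \<in> D")
  case True
  obtain V where V: "- {0} \<subseteq> V" "(V, Ambient) \<in> tower_atlas js (length js)" using Ambient_chart by blast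
  have "open (N \<inter> D)" using N open_kato_domain by (auto simp: col_chart_def)
  moreover have "x \<in> V" if "x \<in> N \<inter> D" for x
  proof -
    have "x \<in> kato_collar js" using that N by (auto simp: col_chart_def)
    then have "x \<noteq> 0" using that by (simp add: collar_iff)
    then show ?thesis using V(1) by blast
  qed
  ultimately show ?thesis unfolding lchart_def using z True V(2)
    by (intro exI[of _ "N \<inter> D"] exI[of _ V] exI[of _ Ambient]) (auto simp: gam_def)
next
  case False
  have "open (N - closure D)" using N by (auto simp: col_chart_def)
  then show ?thesis unfolding lchart_def using z False sigma_chart D_closure frontier_iff
    by (intro exI[of _ "N - closure D"] exI[of _ UNIV] exI[of _ \<sigma>]) (auto simp: gam_def)
qed

lemma int_col_frontier:
  assumes "int_chart V \<phi>" "v \<in> V" "\<phi> v = gam z"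
  shows "z \<notin> frontier D"
  using int_E[OF assms(1,2)] assms(3) by (auto simp: gam_def frontier_iff)

lemma col_col_frontier:
  assumes "col_chart N" "col_chart N'" "z \<in> N" "w \<in> N'" "gam z = gam w" "z \<noteq> w"
  shows "z \<notin> frontier D" "w \<notin> frontier D"
proof -
  have *: "z \<in> kato_collar js" "w \<in> kato_collar js" using assms by (auto simp: col_chart_def)
  have h: "y \<notin> closure D" if "x \<in> D" "x \<in> kato_collar js" "Ambient x = \<sigma> y" for x y
    using that by (auto simp: collar_iff)
  have "z \<notin> frontier D \<and> w \<notin> frontier D"
    using * h[of z w] h[of w z]assms(5,6)
    by (cases "z \<in> D"; cases "w \<in> D") (simp_all add: gam_def frontier_iff sigma_eq)
  then show "z \<notin> frontier D" "w \<notin> frontier D" by auto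
qed

lemma class_compat:
  assumes "\<And>v. v \<in> V \<Longrightarrow> \<phi> v \<in> E" "\<And>u. u \<in> U \<Longrightarrow> \<psi> u \<in> E"
    "\<And>v u. v \<in> V \<Longrightarrow> u \<in> U \<Longrightarrow> \<phi> v = \<psi> u \<Longrightarrow>
      \<exists>T g. open T \<and> v \<in> T \<and> T \<subseteq> V \<and> (\<forall>x\<in>T. holo_at g x \<and> g x \<in> U \<and> \<psi> (g x) = \<phi> x)"
  shows "chart_compat (V, kato_class js \<circ> \<phi>) (U, kato_class js \<circ> \<psi>)"
proof (rule compatI)
  fix v assume v: "v \<in> V" and "(kato_class js \<circ> \<phi>) v \<in> (kato_class js \<circ> \<psi>) ` U"
  then obtain u where u: "u \<in> U" "kato_class js (\<phi> v) = kato_class js (\<psi> u)" by auto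
  have "\<phi> v = \<psi> u" by (rule class_inj[OF assms(1)[OF v] assms(2)[OF u(1)] u(2)])
  then obtain T g where "open T \<and> v \<in> T \<and> T \<subseteq> V \<and> (\<forall>x\<in>T. holo_at g x \<and> g x \<in> U \<and> \<psi> (g x) = \<phi> x)"
    using assms(3)[OF v u(1)] by blast
  then show "\<exists>T g. open T \<and> v \<in> T \<and> T \<subseteq> V \<and>
    (\<forall>x\<in>T. holo_at g x \<and> g x \<in> U \<and> (kato_class js \<circ> \<psi>) (g x) = (kato_class js \<circ> \<phi>) x)"
    by (intro exI[of _ T] exI[of _ g]) simp
qed

lemma holo_id: "holo_at (\<lambda>x. x) v"
  by (rule holo_atI) (rule cholo_at_nth)

lemma word_compat:
  assumes "c \<in> kato_word_atlas js" "d \<in> kato_word_atlas js"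
  shows "chart_compat c d"
proof -
  have ii: "chart_compat (V, kato_class js \<circ> \<phi>) (U, kato_class js \<circ> \<psi>)" if "int_chart V \<phi>" "int_chart U \<psi>" for V \<phi> U \<psi>
  proof (rule class_compat)
    fix v u assume a: "v \<in> V" "u \<in> U" "\<phi> v = \<psi> u"
    show "\<exists>T g. open T \<and> v \<in> T \<and> T \<subseteq> V \<and> (\<forall>x\<in>T. holo_at g x \<and> g x \<in> U \<and> \<psi> (g x) = \<phi> x)"
      by (rule lchart_compat[OF int_lchart[OF that(1) a(1)] int_lchart[OF that(2) a(2)] a(3)])
  next
    show "\<phi> v \<in> E" if "v \<in> V" for v using int_E[OF \<open>int_chart V \<phi>\<close> that] by (rule conjunct1)
    show "\<psi> v \<in> E" if "v \<in> U" for v using int_E[OF \<open>int_chart U \<psi>\<close> that] by (rule conjunct1)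
  qed
  have ic: "chart_compat (V, kato_class js \<circ> \<phi>) (N, kato_class js \<circ> gam)" if "int_chart V \<phi>" "col_chart N" for V \<phi> N
  proof (rule class_compat)
    fix v z assume a: "v \<in> V" "z \<in> N" "\<phi> v = gam z"
    note f = int_col_frontier[OF that(1) a(1,3)]
    show "\<exists>T g. open T \<and> v \<in> T \<and> T \<subseteq> V \<and> (\<forall>x\<in>T. holo_at g x \<and> g x \<in> N \<and> gam (g x) = \<phi> x)"
      by (rule lchart_compat[OF int_lchart[OF that(1) a(1)] col_lchart[OF that(2) a(2) f] a(3)])
  next
    show "\<phi> v \<in> E" if "v \<in> V" for v using int_E[OF \<open>int_chart V \<phi>\<close> that] by (rule conjunct1)
    show "gam v \<in> E" if "v \<in> N" for v by (rule col_E[OF \<open>col_chart N\<close> that])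
  qed
  have ci: "chart_compat (N, kato_class js \<circ> gam) (V, kato_class js \<circ> \<phi>)" if "int_chart V \<phi>" "col_chart N" for V \<phi> N
  proof (rule class_compat)
    fix v z assume a: "z \<in> N" "v \<in> V" "gam z = \<phi> v"
    note f = int_col_frontier[OF that(1) a(2) a(3)[symmetric]]
    show "\<exists>T g. open T \<and> z \<in> T \<and> T \<subseteq> N \<and> (\<forall>x\<in>T. holo_at g x \<and> g x \<in> V \<and> \<phi> (g x) = gam x)"
      by (rule lchart_compat[OF col_lchart[OF that(2) a(1) f] int_lchart[OF that(1) a(2)] a(3)])
  next
    show "\<phi> v \<in> E" if "v \<in> V" for v using int_E[OF \<open>int_chart V \<phi>\<close> that] by (rule conjunct1)
    show "gam v \<in> E" if "v \<in> N" for v by (rule col_E[OF \<open>col_chart N\<close> that])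
  qed
  have cc: "chart_compat (N, kato_class js \<circ> gam) (M, kato_class js \<circ> gam)" if "col_chart N" "col_chart M" for N M
  proof (rule class_compat)
    fix z w assume a: "z \<in> N" "w \<in> M" "gam z = gam w"
    show "\<exists>T g. open T \<and> z \<in> T \<and> T \<subseteq> N \<and> (\<forall>x\<in>T. holo_at g x \<and> g x \<in> M \<and> gam (g x) = gam x)"
    proof (cases "z = w")
      case True
      then show ?thesis using a that by (intro exI[of _ "N \<inter> M"] exI[of _ "\<lambda>x. x"]) (auto simp: holo_id col_chart_def)
    next
      case False
      note f = col_col_frontier[OF that a False]
      show ?thesis by (rule lchart_compat[OF col_lchart[OF that(1) a(1) f(1)] col_lchart[OF that(2) a(2) f(2)] a(3)])
    qed
  qed (fact col_E[OF that(1)] col_E[OF that(2)])+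
  obtain V \<phi> U \<psi> where c: "c = (V, \<phi>)" and d: "d = (U, \<psi>)" by (cases c, cases d)
  show ?thesis
    using assms(1)[unfolded c]
  proof (cases rule: word_atlas_cases)
    case i1: (i \<phi>')
    show ?thesis
      using assms(2)[unfolded d]
    proof (cases rule: word_atlas_cases)
      case i2: (i \<psi>')
      show ?thesis unfolding c d i1(2) i2(2) by (rule ii[OF i1(1) i2(1)])
    next
      case c2: c
      show ?thesis unfolding c d i1(2) c2(2) by (rule ic[OF i1(1) c2(1)])
    qed
  next
    case c1: c
    show ?thesis
      using assms(2)[unfolded d]
    proof (cases rule: word_atlas_cases)
      case i2: (i \<psi>')
      show ?thesis unfolding c d c1(2) i2(2) by (rule ci[OF i2(1) c1(1)])
    next
      case c2: c
      show ?thesis unfolding c d c1(2) c2(2) by (rule cc[OF c1(1) c2(1)])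
    qed
  qed
qed

lemma word_open: "(V, \<phi>) \<in> kato_word_atlas js \<Longrightarrow> open V"
  by (erule word_atlas_cases) (auto simp: col_chart_def int_open)

lemma word_inj: assumes "(V, \<phi>) \<in> kato_word_atlas js" shows "inj_on \<phi> V"
proof -
  from assms show ?thesis
  proof (cases rule: word_atlas_cases)
    case (i \<psi>)
    have inj: "inj_on \<psi> V" by (rule int_inj[OF i(1)])
    show ?thesis
    proof (rule inj_onI)
      fix x y assume xy: "x \<in> V" "y \<in> V" "\<phi> x = \<phi> y"
      have "kato_class js (\<psi> x) = kato_class js (\<psi> y)" using xy(3) unfolding i(2) by simp
      then have "\<psi> x = \<psi> y"
        by (rule class_inj[OF int_E[OF i(1) xy(1), THEN conjunct1] int_E[OF i(1) xy(2), THEN conjunct1]])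
      then show "x = y" by (rule inj_onD[OF inj _ xy(1,2)])
    qed
  next
    case c
    then show ?thesis by (simp add: col_chart_def collar_map)
  qed
qed

lemma collar_cover:
  assumes z0: "z0 \<in> frontier D"
  shows "\<exists>N. z0 \<in> N \<and> col_chart N"
proof -
  have z0': "z0 \<in> closure D" "z0 \<notin> D" using z0 by (simp_all add: frontier_iff)
  have F0: "F z0 \<in> D" by (rule F_closure[OF z0'(1)])
  then have "z0 \<noteq> F z0" using z0'(2) by metis
  then obtain A B where AB: "open A" "open B" "z0 \<in> A" "F z0 \<in> B" "A \<inter> B = {}" by (meson separation_t2)
  have cF: "continuous_on S F" for S by (intro continuous_at_imp_continuous_on ballI F_cont)
  have o1: "closed (F ` closure D)" by (intro compact_imp_closed compact_continuous_image cF compact_cD)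
  have o2: "open (UNIV \<inter> F -` (B \<inter> D))"
    by (rule continuous_open_preimage[OF cF open_UNIV open_Int[OF AB(2) open_kato_domain]])
  define N where "N = A \<inter> (UNIV \<inter> F -` (B \<inter> D)) - F ` closure D"
  have op: "open N" unfolding N_def by (intro open_Diff open_Int AB(1) o1 o2)
  have Nn: "z \<noteq> F w" if "z \<in> N" "w \<in> closure D" for z w
    using that unfolding N_def by (metis DiffD2 imageI)
  have Ni: "z \<in> A" "F z \<in> B" "F z \<in> D" if "z \<in> N" for z
    using that unfolding N_def by simp_all
  have z: "z0 \<in> N"
  proof -
    have "z0 \<notin> F ` closure D"
    proof
      assume "z0 \<in> F ` closure D"
      then obtain w where "w \<in> closure D" "z0 = F w" by (elim imageE)
      then show False using F_closure[of w] z0'(2) by metis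
    qed
    then show ?thesis using AB F0 unfolding N_def by simp
  qed
  have nm: "Ambient z \<noteq> \<sigma> w" if "z \<noteq> F w" for z w
  proof
    assume "Ambient z = \<sigma> w"
    from arg_cong[OF this, of \<pi>] show False using that unfolding pi_Ambient pi_sigma by metis
  qed
  have col: "z \<in> kato_collar js" if "z \<in> N" for z
  proof -
    have "z \<noteq> 0" using Nn[OF that D_closure[OF zero_D]] unfolding monomial_word_0 .
    moreover have "Ambient z \<notin> \<sigma> ` closure D" using nm Nn[OF that] by (metis imageE)
    ultimately show ?thesis using Ni(3)[OF that] by (simp add: collar_iff)
  qed
  have "inj_on (kato_collar_map js) N"
  proof (rule inj_onI)
    fix z w assume zw: "z \<in> N" "w \<in> N" "kato_collar_map js z = kato_collar_map js w"
    have n: "Ambient a \<noteq> \<sigma> b" if "a \<in> N" "b \<in> N" for a b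
    proof (rule nm)
      show "a \<noteq> F b" using Ni(1)[OF that(1)] Ni(2)[OF that(2)] AB(5) by (metis IntI emptyE)
    qed
    have "kato_class js (gam z) = kato_class js (gam w)" using zw(3) by (simp add: collar_map)
    then have "gam z = gam w" by (rule class_inj[OF gam_E[OF col[OF zw(1)]] gam_E[OF col[OF zw(2)]]])
    then show "z = w" using n[OF zw(1,2)] n[OF zw(2,1), symmetric]
      by (cases "z \<in> D"; cases "w \<in> D") (simp_all add: gam_def sigma_eq)
  qed
  then have "col_chart N" unfolding col_chart_def using op col by (intro conjI subsetI)
  then show ?thesis using z by (intro exI conjI)
qed

lemma word_cover: "kato_class js ` kato_pre js = (\<Union>(V, \<phi>)\<in>kato_word_atlas js. \<phi> ` V)"
proof (intro equalityI subsetI)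
  fix c assume "c \<in> kato_class js ` kato_pre js"
  then obtain x where x: "x \<in> E" "c = kato_class js x" unfolding space_E by (elim imageE)
  have "\<exists>(V, \<phi>)\<in>kato_word_atlas js. c \<in> \<phi> ` V"
  proof (cases "x \<in> \<sigma> ` closure D")
    case True
    then obtain z where z: "z \<in> closure D" "x = \<sigma> z" by blast
    then have zD: "z \<notin> D" using x(1) by auto
    then obtain N where N: "z \<in> N" "col_chart N" using collar_cover frontier_iff z by blast
    have "(N, kato_class js \<circ> gam) \<in> kato_word_atlas js" by (rule word_atlas_col[OF N(2)])
    moreover have "c = (kato_class js \<circ> gam) z" using x(2) z zD by (simp add: gam_def)
    ultimately show ?thesis using N(1) by (intro bexI[of _ "(N, kato_class js \<circ> gam)"]) simp_all
  next
    case False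
    have "x \<in> X" using x(1) by simp
    then obtain V \<phi> v where V: "(V, \<phi>) \<in> tower_atlas js (length js)" "v \<in> V" "x = \<phi> v"
      using tower_atlas_cover by blast
    let ?V = "{v \<in> V. \<pi> (\<phi> v) \<in> D \<and> \<phi> v \<notin> \<sigma> ` closure D}"
    have "int_chart ?V \<phi>" unfolding int_chart_def using V(1) by (intro exI conjI) (assumption, rule refl)
    then have "(?V, kato_class js \<circ> \<phi>) \<in> kato_word_atlas js" by (rule word_atlas_int)
    moreover have "v \<in> ?V" using V x(1) False by simp
    moreover have "c = (kato_class js \<circ> \<phi>) v" using x(2) V(3) by simp
    ultimately show ?thesis by (intro bexI[of _ "(?V, kato_class js \<circ> \<phi>)"]) simp_all
  qed
  then show "c \<in> (\<Union>(V, \<phi>)\<in>kato_word_atlas js. \<phi> ` V)" by fastforce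
next
  fix c assume "c \<in> (\<Union>(V, \<phi>)\<in>kato_word_atlas js. \<phi> ` V)"
  then obtain V \<phi> v where V: "(V, \<phi>) \<in> kato_word_atlas js" "v \<in> V" "c = \<phi> v" by auto
  have "c \<in> kato_class js ` E"
    using V(1)
  proof (cases rule: word_atlas_cases)
    case (i \<psi>)
    have "c = kato_class js (\<psi> v)" using V(3) i(2) by simp
    then show ?thesis by (rule image_eqI[OF _ int_E[OF i(1) V(2), THEN conjunct1]])
  next
    case c
    have "c = kato_class js (gam v)" using V(3) c(2) by simp
    then show ?thesis by (rule image_eqI[OF _ col_E[OF c(1) V(2)]])
  qed
  then show "c \<in> kato_class js ` kato_pre js" unfolding space_E .
qed

lemma conv_subseq: "atlas_conv \<A> x a \<Longrightarrow> strict_mono r \<Longrightarrow> atlas_conv \<A> (\<lambda>m. x (r m)) a"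
  unfolding atlas_conv_def
proof (elim exE conjE)
  fix V \<phi> f v
  assume r: "strict_mono r" and a: "(V, \<phi>) \<in> \<A>" "\<forall>m. f m \<in> V \<and> x m = \<phi> (f m)" "v \<in> V" "a = \<phi> v" "f \<longlonglongrightarrow> v"
  have "(\<lambda>m. f (r m)) \<longlonglongrightarrow> v" using LIMSEQ_subseq_LIMSEQ[OF a(5) r] by (simp add: o_def)
  then show "\<exists>V \<phi> f v. (V, \<phi>) \<in> \<A> \<and> (\<forall>m. f m \<in> V \<and> x (r m) = \<phi> (f m)) \<and> v \<in> V \<and> a = \<phi> v \<and> f \<longlonglongrightarrow> v"
    using a by (intro exI[of _ V] exI[of _ \<phi>] exI[of _ "\<lambda>m. f (r m)"] exI[of _ v]) auto
qed

lemma conv_lift: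
  assumes "atlas_conv (kato_word_atlas js) x a"
  shows "\<exists>r y b. strict_mono r \<and> (\<forall>m. y m \<in> E \<and> x (r m) = kato_class js (y m)) \<and>
    atlas_conv (tower_atlas js (length js)) y b \<and> a = kato_class js b"
proof -
  obtain V \<phi> f v where c: "(V, \<phi>) \<in> kato_word_atlas js" "\<And>m. f m \<in> V" "\<And>m. x m = \<phi> (f m)" "v \<in> V"
      "a = \<phi> v" "f \<longlonglongrightarrow> v"
    using assms unfolding atlas_conv_def by metis
  from c(1) show ?thesis
  proof (cases rule: word_atlas_cases)
    case (i \<psi>)
    obtain U where U: "(U, \<psi>) \<in> tower_atlas js (length js)"
      "V = {v \<in> U. \<pi> (\<psi> v) \<in> D \<and> \<psi> v \<notin> \<sigma> ` closure D}" using i(1) unfolding int_chart_def by (elim exE conjE)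
    have VU: "x \<in> U" if "x \<in> V" for x using that unfolding U(2) by simp
    have "atlas_conv (tower_atlas js (length js)) (\<lambda>m. \<psi> (f m)) (\<psi> v)"
      by (rule convI[OF U(1), of f, OF VU[OF c(2)] refl VU[OF c(4)] c(6)])
    moreover have "\<psi> (f m) \<in> E" for m by (rule int_E[OF i(1) c(2), THEN conjunct1])
    moreover have "x (id m) = kato_class js (\<psi> (f m))" "a = kato_class js (\<psi> v)" for m
      using c(3,5) i(2) by simp_all
    ultimately show ?thesis
      by (intro exI[of _ id] exI[of _ "\<lambda>m. \<psi> (f m)"] exI[of _ "\<psi> v"] conjI allI strict_mono_id)
  next
    case c': c
    have E: "gam (f m) \<in> E" for m by (rule col_E[OF c'(1) c(2)])
    have co: "f m \<in> kato_collar js" "v \<in> kato_collar js" for m using c'(1) c(2,4) by (auto simp: col_chart_def)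
    show ?thesis
    proof (cases "infinite {m. f m \<in> D}")
      case True
      then obtain r :: "nat \<Rightarrow> nat" where r: "strict_mono r" "\<And>m. f (r m) \<in> D"
        using infinite_enumerate[of "{m. f m \<in> D}"] by auto
      have l: "(\<lambda>m. f (r m)) \<longlonglongrightarrow> v" using LIMSEQ_subseq_LIMSEQ[OF c(6) r(1)] by (simp add: o_def)
      have vc: "v \<in> closure D" unfolding closure_sequential using l r(2) by (intro exI[of _ "\<lambda>m. f (r m)"]) simp
      obtain W where W: "- {0} \<subseteq> W" "(W, Ambient) \<in> tower_atlas js (length js)" using Ambient_chart by blast
      have "f (r m) \<noteq> 0" for m using co(1)[of "r m"] r(2) by (simp add: collar_iff)
      then have 1: "f (r m) \<in> W" for m using W(1) by blast
      have "v \<noteq> 0" using co(2) zero_D by (auto simp: collar_iff)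
      then have 2: "v \<in> W" using W(1) by blast
      have "atlas_conv (tower_atlas js (length js)) (\<lambda>m. gam (f (r m))) (Ambient v)"
        using 1 2 l r(2) by (intro convI[OF W(2), of "\<lambda>m. f (r m)"]) (auto simp: gam_def)
      moreover have "kato_class js (gam v) = kato_class js (Ambient v)"
      proof (cases "v \<in> D")
        case False
        then have "v \<in> frontier D" using vc frontier_iff by blast
        then show ?thesis using class_frontier[of "Ambient v"] Ambient_tower[OF \<open>v \<noteq> 0\<close>] False
          by (simp add: pi_Ambient gam_def)
      qed (simp add: gam_def)
      moreover have "x (r m) = kato_class js (gam (f (r m)))" "a = kato_class js (gam v)" for m
        using c(3,5) c'(2) by simp_all
      ultimately show ?thesis
        by (intro exI[of _ r] exI[of _ "\<lambda>m. gam (f (r m))"] exI[of _ "Ambient v"] conjI allI r(1) E) simp_all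
    next
      case False
      have "infinite (- {m. f m \<in> D})" using False infinite_UNIV_nat by (metis Compl_partition finite_Un)
      then obtain r :: "nat \<Rightarrow> nat" where r: "strict_mono r" "\<And>m. f (r m) \<notin> D"
        using infinite_enumerate[of "- {m. f m \<in> D}"] by auto
      have l: "(\<lambda>m. f (r m)) \<longlonglongrightarrow> v" using LIMSEQ_subseq_LIMSEQ[OF c(6) r(1)] by (simp add: o_def)
      have "closed (- D)" using open_kato_domain by (simp add: closed_def)
      then have vD: "v \<in> - D" by (rule closed_sequentially[OF _ _ l]) (use r(2) in simp)
      have "atlas_conv (tower_atlas js (length js)) (\<lambda>m. gam (f (r m))) (\<sigma> v)"
        using l r(2) by (intro convI[OF sigma_chart, of "\<lambda>m. f (r m)"]) (auto simp: gam_def)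
      moreover have "x (r m) = kato_class js (gam (f (r m)))" "a = kato_class js (\<sigma> v)" for m
        using c(3,5) c'(2) vD by (simp_all add: gam_def)
      ultimately show ?thesis
        by (intro exI[of _ r] exI[of _ "\<lambda>m. gam (f (r m))"] exI[of _ "\<sigma> v"] conjI allI r(1) E) simp_all
    qed
  qed
qed

lemma word_sep: "atlas_sep (kato_word_atlas js)"
  unfolding atlas_sep_def
proof (intro allI impI)
  fix x a b assume a: "atlas_conv (kato_word_atlas js) x a" and b: "atlas_conv (kato_word_atlas js) x b"
  obtain r y a' where 1: "strict_mono r" "\<forall>m. y m \<in> E \<and> x (r m) = kato_class js (y m)"
    "atlas_conv (tower_atlas js (length js)) y a'" "a = kato_class js a'" using conv_lift[OF a] by blast
  obtain s w b' where 2: "strict_mono s" "\<forall>m. w m \<in> E \<and> x (r (s m)) = kato_class js (w m)"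
    "atlas_conv (tower_atlas js (length js)) w b'" "b = kato_class js b'"
    using conv_lift[OF conv_subseq[OF b 1(1)]] by blast
  have "y (s m) = w m" for m
  proof (rule class_inj)
    show "y (s m) \<in> E" "w m \<in> E" using 1(2) 2(2) by blast+
    show "kato_class js (y (s m)) = kato_class js (w m)" using 1(2) 2(2) by metis
  qed
  then have "atlas_conv (tower_atlas js (length js)) w a'" using conv_subseq[OF 1(3) 2(1)] by simp
  then have "a' = b'" using 2(3) tower_sep[of js "length js"] unfolding atlas_sep_def by blast
  then show "a = b" using 1(4) 2(4) by simp
qed

lemma word_manifold: "complex_manifold (kato_class js ` kato_pre js) (kato_word_atlas js)"
  by (rule complex_manifoldI) (fact word_open word_inj word_cover word_compat word_sep)+

end

theorem complex_manifold_kato: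
  fixes A :: "int^'n::{finite,wellorder}^'n::{finite,wellorder}"
  assumes "kato_matrix A"
  shows "complex_manifold (kato_space A) (kato_manifold A)"
proof -
  obtain js where js: "A = word_matrix js" using assms unfolding kato_matrix_def by blast
  interpret kato js by unfold_locales (rule kato_word(2)[OF assms js])
  show ?thesis using word_manifold kato_word(1)[OF assms js] by (simp add: kato_space_def kato_manifold_def)
qed

end

theory Submission
  imports Defs "HOL-Complex_Analysis.Conformal_Mappings"
begin

text \<open>Near \<open>\<partial>D\<close> and on \<open>D - F(D)\<close>, with \<open>F = F\<^sub>A\<close>, a holomorphic one-form on \<open>M\<^sub>A\<close> is a form
  \<open>\<Sum>\<^sub>i h\<^sub>i dz\<^sub>i/z\<^sub>i\<close> on an open set of \<open>\<complex>\<^sup>n\<close>, and the gluing gives \<open>h = A\<^sup>T (h \<circ> F)\<close>. As \<open>F\<close> contracts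
  \<open>D\<close> and is injective off \<open>F\<^sup>-\<^sup>1(0)\<close>, this equation extends \<open>h\<close> to \<open>D - {0}\<close>. The extension of
  \<open>h\<^sub>i\<close> vanishes where \<open>z\<^sub>i = 0\<close>, hence \<open>\<bar>h\<^sub>i\<bar> \<le> C \<bar>z\<^sub>i\<bar>\<close> near the origin by the Schwarz lemma, and iterating
  \<open>h = A\<^sup>T (h \<circ> F)\<close> forces \<open>h = 0\<close>.\<close>

subsection \<open>Holomorphic maps of several variables\<close>

lemma cholo_at_component: "holo_at f v \<Longrightarrow> cholo_at (\<lambda>x. f x $ i) v"
  unfolding holo_at_def cholo_at_def
  by (elim exE conjE, rule_tac x = "\<lambda>h. f' h $ i" in exI)
    (auto intro!: bounded_linear.has_derivative[OF bounded_linear_vec_nth])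

lemma cholo_at_continuous: "cholo_at f v \<Longrightarrow> isCont f v"
  unfolding cholo_at_def using has_derivative_continuous by blast

lemma cholo_at_cong:
  assumes "cholo_at f v" "open T" "v \<in> T" "\<And>x. x \<in> T \<Longrightarrow> f x = g x"
  shows "cholo_at g v"
  using assms has_derivative_transform_within_open[of f _ v UNIV T g]
  unfolding cholo_at_def by metis

lemma cholo_at_comp:
  assumes "holo_at f v" "cholo_at g (f v)"
  shows "cholo_at (\<lambda>x. g (f x)) v"
proof -
  obtain f' g' where "(f has_derivative f') (at v)" "\<forall>c h. f' (c *s h) = c *s f' h"
    "(g has_derivative g') (at (f v))" "\<forall>c h. g' (c *s h) = c * g' h"
    using assms unfolding holo_at_def cholo_at_def by blast
  then show ?thesis unfolding cholo_at_def
    by (intro exI[of _ "\<lambda>h. g' (f' h)"]) (auto intro: has_derivative_compose)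
qed

lemma cholo_at_cmult: "cholo_at f v \<Longrightarrow> cholo_at (\<lambda>x. c * f x) v"
  unfolding cholo_at_def
  by (elim exE conjE, rule_tac x = "\<lambda>h. c * f' h" in exI)
    (auto intro!: bounded_linear.has_derivative[OF bounded_linear_mult_right])

lemma cholo_at_sum:
  assumes "\<And>i. cholo_at (f i) v"
  shows "cholo_at (\<lambda>x. \<Sum>i\<in>S. f i x) v"
proof -
  obtain F where F: "\<And>i. (f i has_derivative F i) (at v)" "\<And>i c h. F i (c *s h) = c * F i h"
    using assms unfolding cholo_at_def by metis
  have "((\<lambda>x. \<Sum>i\<in>S. f i x) has_derivative (\<lambda>h. \<Sum>i\<in>S. F i h)) (at v)"
    by (intro has_derivative_sum F(1))
  then show ?thesis unfolding cholo_at_def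
    by (intro exI[of _ "\<lambda>h. \<Sum>i\<in>S. F i h"]) (simp add: F(2) sum_distrib_left)
qed

lemma cholo_at_funpow_mult:
  fixes M :: "complex^'n::finite^'n::finite"
  assumes "\<And>i. cholo_at (\<lambda>x. f x $ i) v"
  shows "cholo_at (\<lambda>x. (((*v) M ^^ m) (f x)) $ i) v"
proof (induction m arbitrary: i)
  case (Suc m)
  then show ?case by (simp add: matrix_vector_mult_def) (intro cholo_at_sum cholo_at_cmult)
qed (simp add: assms)

lemma bounded_linear_smult_left: "bounded_linear (\<lambda>c::complex. c *s (u::'n::finite cspace))"
proof -
  have "linear (\<lambda>c::complex. c *s u)"
    by (rule linearI) (auto simp: vec_eq_iff algebra_simps)
  then show ?thesis by (simp add: linear_conv_bounded_linear)
qed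

text \<open>Complex linearity of the derivative turns \<open>f' (h *s u)\<close> into
  \<open>h * f' u\<close>, so the restriction to the line has the field derivative
  \<open>f' u\<close>. This gives access to one-variable theory.\<close>

lemma holomorphic_on_complex_line:
  assumes "\<And>c. c \<in> S \<Longrightarrow> cholo_at f (a + c *s u)"
  shows "(\<lambda>c. f (a + c *s u)) holomorphic_on S"
  unfolding holomorphic_on_def
proof
  fix c assume "c \<in> S"
  then obtain f' where f: "(f has_derivative f') (at (a + c *s u))" "\<And>c h. f' (c *s h) = c * f' h"
    using assms unfolding cholo_at_def by blast
  have "((\<lambda>c. a + c *s u) has_derivative (\<lambda>h. h *s u)) (at c)"
    using has_derivative_add[OF has_derivative_const bounded_linear_imp_has_derivative[OF bounded_linear_smult_left]]
    by simp
  from has_derivative_compose[OF this f(1)]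
  have "((\<lambda>c. f (a + c *s u)) has_field_derivative f' u) (at c)"
    unfolding has_field_derivative_def f(2) by (simp add: mult_commute_abs)
  then show "(\<lambda>c. f (a + c *s u)) field_differentiable at c within S"
    unfolding field_differentiable_def using has_field_derivative_at_within by blast
qed

text \<open>The quotient \<open>f z / z\<close>, completed by \<open>deriv f 0\<close> at the
  origin, is holomorphic, so the maximum modulus principle carries the bound \<open>B / r\<close>
  from the circle to the disc.\<close>

lemma Schwarz_bound:
  assumes "f holomorphic_on S" "open S" "cball 0 r \<subseteq> S" "f 0 = 0" "0 < r"
    and "\<And>x. cmod x = r \<Longrightarrow> cmod (f x) \<le> B" and "cmod c \<le> r"
  shows "cmod (f c) \<le> B / r * cmod c"
proof -
  define g where "g z = (if z = 0 then deriv f 0 else f z / z)" for z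
  have "0 \<in> S" using assms(3,5) by (auto simp: subset_iff)
  then have g: "g holomorphic_on S"
    by (intro pole_theorem_open_0[OF assms(1,2), of 0]) (auto simp: g_def assms(4))
  have "cmod (g c) \<le> B / r"
  proof (rule maximum_modulus_frontier[of g "cball (0::complex) r"])
    show "g holomorphic_on interior (cball (0::complex) r)"
      by (rule holomorphic_on_subset[OF g]) (use assms(3) ball_subset_cball in auto)
    show "continuous_on (closure (cball (0::complex) r)) g"
      using holomorphic_on_imp_continuous_on[OF g] assms(3) continuous_on_subset by auto
    fix z assume "z \<in> frontier (cball (0::complex) r)"
    then have "cmod z = r" using assms(5) by simp
    then show "cmod (g z) \<le> B / r"
      using assms(5,6) by (auto simp: g_def norm_divide divide_right_mono)
  qed (use assms(7) in auto)
  moreover have "f c = g c * c" using assms(4) by (simp add: g_def)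
  ultimately show ?thesis using mult_right_mono[OF _ norm_ge_zero[of c]] by (simp only: norm_mult)
qed

section \<open>Density of the points without zero coordinates\<close>

definition torus :: "'n::finite cspace set" where
  "torus = {z. \<forall>i. z $ i \<noteq> 0}"

text \<open>Move \<open>v\<close> along the real diagonal: the coordinate \<open>i\<close> can
  vanish only at the parameter \<open>- Re (v $ i)\<close>, so small nonzero parameters reach the
  torus.\<close>

lemma torus_dense:
  assumes "open S" "v \<in> S"
  obtains z where "z \<in> S" "z \<in> torus"
proof -
  define p where "p t = v + (\<chi> i. of_real t)" for t :: real
  have "(p \<longlongrightarrow> p 0) (at 0)"
    unfolding p_def by (intro tendsto_add tendsto_const vec_tendstoI)
      (use tendsto_of_real[OF tendsto_ident_at[of "0::real" UNIV]] in simp)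
  moreover have "p 0 = v" by (simp add: p_def vec_eq_iff)
  ultimately have 1: "\<forall>\<^sub>F t in at 0. p t \<in> S" using assms topological_tendstoD by metis
  have "\<forall>\<^sub>F t in at 0. p t $ i \<noteq> 0" for i
    using eventually_neq_at_within[of "- Re (v $ i)" 0 UNIV]
    by eventually_elim (auto simp: p_def complex_eq_iff)
  then have "\<forall>\<^sub>F t in at 0. \<forall>i. p t $ i \<noteq> 0" by (simp add: eventually_all_finite)
  with 1 have "\<forall>\<^sub>F t in at 0. p t \<in> S \<and> p t \<in> torus" by eventually_elim (simp add: torus_def)
  then obtain t where "p t \<in> S" "p t \<in> torus" using eventually_happens'[of "at (0::real)"] by force
  then show thesis by (rule that)
qed

lemma zero_on_torus_imp_zero:
  assumes "open V" "holo_on V f" "\<And>x. x \<in> V \<Longrightarrow> x \<in> torus \<Longrightarrow> f x = 0" "v \<in> V"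
  shows "f v = 0"
proof (rule ccontr)
  assume "f v \<noteq> 0"
  moreover have "open {x \<in> V. f x \<in> - {0}}"
    using assms(2) by (intro open_preimage assms(1)) (auto simp: holo_on_eq)
  ultimately obtain z where "z \<in> {x \<in> V. f x \<in> - {0}}" "z \<in> torus"
    using torus_dense[of "{x \<in> V. f x \<in> - {0}}" v] assms(4) by auto
  then show False using assms(3) by auto
qed

subsection \<open>Monomial maps with non-negative exponents\<close>

lemma word_matrix_append: "word_matrix (js @ ks) = word_matrix js ** word_matrix ks"
  by (induction js) (auto simp: word_matrix_def matrix_mul_assoc)

lemma monomial_append:
  "monomial_map (word_matrix (js @ ks)) z = monomial_map (word_matrix js) (monomial_map (word_matrix ks) z)"
  unfolding word_matrix_append by (intro monomial_mult word_matrix_nonneg)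

lemma monomial_torus: "z \<in> torus \<Longrightarrow> monomial_map A z \<in> torus"
  by (simp add: torus_def monomial_map_def)

lemma zero_notin_torus: "0 \<notin> torus"
  by (simp add: torus_def)

text \<open>Used twice: differentiation in \<open>c\<close> at 1 yields the logarithmic derivative,
  and a factor \<open>c > 1\<close> later absorbs the growth of the exponents.\<close>

lemma monomial_scale_coord:
  assumes "\<And>p q. 0 \<le> A $ p $ q"
  shows "monomial_map A (\<chi> q. if q = i then c * z $ q else z $ q) $ p = c ^ nat (A $ p $ i) * monomial_map A z $ p"
proof -
  have "monomial_map A (\<chi> q. if q = i then c * z $ q else z $ q) $ p =
    (\<Prod>q\<in>UNIV. (if q = i then c powi (A $ p $ q) else 1) * (z $ q) powi (A $ p $ q))"
    unfolding monomial_map_def by (auto intro!: prod.cong simp: power_int_mult_distrib)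
  also have "\<dots> = c ^ nat (A $ p $ i) * monomial_map A z $ p"
    using assms by (simp add: prod.distrib monomial_map_def power_int_def)
  finally show ?thesis .
qed

lemma monomial_scale:
  assumes "\<And>p q. 0 \<le> A $ p $ q"
  shows "monomial_map A (c *s z) $ p = c ^ nat (\<Sum>q\<in>UNIV. A $ p $ q) * monomial_map A z $ p"
proof -
  have "0 \<le> (\<Sum>q\<in>UNIV. A $ p $ q)" using assms by (intro sum_nonneg)
  then have "c ^ nat (\<Sum>q\<in>UNIV. A $ p $ q) = (\<Prod>q\<in>UNIV. c powi (A $ p $ q))"
    using powi_sum_nonneg[of UNIV "\<lambda>q. A $ p $ q" c] assms by (simp add: power_int_def)
  then show ?thesis
    by (simp add: monomial_map_def power_int_mult_distrib prod.distrib)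
qed

lemma monomial_log_derivative:
  assumes "\<And>p q. 0 \<le> A $ p $ q"
    and F': "(monomial_map A has_derivative F') (at z)" "\<And>c h. F' (c *s h) = c *s F' h"
  shows "z $ i * F' (axis i 1) $ p = of_int (A $ p $ i) * monomial_map A z $ p"
proof -
  \<comment> \<open>The curve multiplies the \<open>i\<close>-th coordinate by \<open>1 + t\<close>,
    so along it the \<open>p\<close>-th component is a constant times a power of
    \<open>1 + t\<close>.\<close>
  define \<gamma> where "\<gamma> t = z + t *\<^sub>R (z $ i *s axis i 1)" for t :: real
  have \<gamma>: "\<gamma> t = (\<chi> q. if q = i then (1 + of_real t) * z $ q else z $ q)" for t
  proof -
    have "\<gamma> t $ q = (if q = i then (1 + of_real t) * z $ q else z $ q)" for q
      by (simp add: \<gamma>_def axis_def) (simp add: scaleR_conv_of_real algebra_simps)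
    then show ?thesis by (simp add: vec_eq_iff)
  qed
  have 0: "(\<gamma> has_derivative (\<lambda>t. t *\<^sub>R (z $ i *s axis i 1))) (at 0)"
    unfolding \<gamma>_def by (auto intro!: derivative_eq_intros)
  have "\<gamma> 0 = z" by (simp add: \<gamma>_def)
  then have "((\<lambda>t. monomial_map A (\<gamma> t) $ p) has_derivative (\<lambda>t. F' (t *\<^sub>R (z $ i *s axis i 1)) $ p)) (at 0)"
    using F'(1) by (intro bounded_linear.has_derivative[OF bounded_linear_vec_nth] has_derivative_compose[OF 0]) simp
  moreover have "monomial_map A (\<gamma> t) $ p = (1 + of_real t) ^ nat (A $ p $ i) * monomial_map A z $ p" for t
    unfolding \<gamma> by (rule monomial_scale_coord[OF assms(1)])
  ultimately have 1: "((\<lambda>t. (1 + of_real t) ^ nat (A $ p $ i) * monomial_map A z $ p) has_derivative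
      (\<lambda>t. F' (t *\<^sub>R (z $ i *s axis i 1)) $ p)) (at (0::real))" by simp
  have 2: "((\<lambda>t. (1 + of_real t) ^ nat (A $ p $ i) * monomial_map A z $ p) has_derivative
      (\<lambda>t. of_nat (nat (A $ p $ i)) * of_real t * monomial_map A z $ p)) (at (0::real))"
    by (auto intro!: derivative_eq_intros simp: fun_eq_iff)
  from has_derivative_unique[OF 1 2]
  have "F' (z $ i *s axis i 1) $ p = of_nat (nat (A $ p $ i)) * monomial_map A z $ p"
    by (metis (no_types, lifting) mult.right_neutral of_real_1 scaleR_one)
  then show ?thesis using assms(1)[of p i] by (simp add: F'(2))
qed

text \<open>Over a nonzero point of \<complex>^n the tower has a single point, because all
  exceptional divisors lie over the origin.\<close>

lemma sigma_eq_Ambient: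
  assumes "monomial_map (word_matrix js) w \<noteq> 0"
  shows "kato_sigma js w = Ambient (monomial_map (word_matrix js) w)"
  using tower_proj_nonzero[of "kato_sigma js w" js "length js"] assms kato_pi_sigma[of js w]
  by (simp add: kato_pi_proj kato_sigma_def sigma_map_in_tower)

text \<open>Inherited from the injectivity of \<open>kato_sigma\<close>, with which the map agrees
  off the fibre over the origin.\<close>

lemma monomial_word_inj:
  assumes "monomial_map (word_matrix js) z = monomial_map (word_matrix js) w" "monomial_map (word_matrix js) w \<noteq> 0"
  shows "z = w"
proof -
  have "kato_sigma js z = kato_sigma js w" using sigma_eq_Ambient[of js] assms by simp
  then show ?thesis by (simp add: kato_sigma_def sigma_map_eq_iff)
qed

text \<open>The local inverse is the chart change of the tower from \<open>Ambient\<close> to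
  \<open>kato_sigma\<close>; no Jacobian has to be computed.\<close>

lemma monomial_word_local_inverse:
  assumes "monomial_map (word_matrix js) w \<noteq> 0"
  obtains T g where "open T" "monomial_map (word_matrix js) w \<in> T" "g (monomial_map (word_matrix js) w) = w"
    "\<And>x. x \<in> T \<Longrightarrow> holo_at g x" "\<And>x. x \<in> T \<Longrightarrow> monomial_map (word_matrix js) (g x) = x"
proof -
  let ?F = "monomial_map (word_matrix js)"
  obtain V where V: "- {0} \<subseteq> V" "(V, Ambient) \<in> tower_atlas js (length js)" using Ambient_chart by blast
  have "?F w \<in> V" using V(1) assms by blast
  moreover have "Ambient (?F w) \<in> kato_sigma js ` UNIV" using sigma_eq_Ambient[OF assms] by (metis rangeI)
  ultimately obtain T g where T: "open T" "?F w \<in> T"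
    "\<forall>x\<in>T. holo_at g x \<and> g x \<in> UNIV \<and> kato_sigma js (g x) = Ambient x"
    using compatE[OF tower_compat[OF V(2) sigma_map_chart]] unfolding kato_sigma_def by metis
  have F: "?F (g x) = x" if "x \<in> T" for x
    using T(3) that kato_pi_sigma[of js "g x"] by (simp add: kato_pi_proj proj_Ambient)
  have "g (?F w) = w" by (rule monomial_word_inj[OF F[OF T(2)] assms])
  then show thesis using that T F by blast
qed

subsection \<open>Scaling of the domain\<close>

lemma knorm_nonneg: "0 \<le> knorm z"
  unfolding knorm_def by (auto intro!: add_nonneg_nonneg sum_nonneg)

lemma knorm_scale: "knorm (c *s z) = (cmod c)\<^sup>2 * knorm z"
  by (simp add: knorm_def norm_mult power_mult_distrib sum_distrib_left algebra_simps)

lemma coord_le_knorm: "(cmod (z $ i))\<^sup>2 \<le> knorm z"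
proof (cases "i = last_ix")
  case True
  have "0 \<le> (\<Sum>j\<in>UNIV - {last_ix}. (cmod (z $ j))\<^sup>2)" by (intro sum_nonneg) auto
  moreover have "0 \<le> (cmod (z $ last_ix))\<^sup>2" by simp
  ultimately show ?thesis unfolding knorm_def True by linarith
next
  case False
  then have "(cmod (z $ i))\<^sup>2 \<le> (\<Sum>j\<in>UNIV - {last_ix}. (cmod (z $ j))\<^sup>2)"
    by (intro member_le_sum) auto
  moreover have "0 \<le> (cmod (z $ last_ix))\<^sup>2" by simp
  ultimately show ?thesis unfolding knorm_def by linarith
qed

lemma knorm_pos: "z \<noteq> 0 \<Longrightarrow> 0 < knorm z"
proof -
  assume "z \<noteq> 0"
  then obtain i where "z $ i \<noteq> 0" by (auto simp: vec_eq_iff)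
  then have "0 < (cmod (z $ i))\<^sup>2" by simp
  also have "\<dots> \<le> knorm z" by (rule coord_le_knorm)
  finally show ?thesis .
qed

lemma knorm_le:
  fixes z :: "'n::{finite,wellorder} cspace"
  assumes "\<And>i. cmod (z $ i) \<le> r"
  shows "knorm z \<le> (real CARD('n) + 2) * r\<^sup>2"
proof -
  have c: "(cmod (z $ i))\<^sup>2 \<le> r\<^sup>2" for i using assms by (simp add: power_mono)
  have "(\<Sum>j\<in>UNIV - {last_ix}. (cmod (z $ j))\<^sup>2) \<le> (\<Sum>j\<in>(UNIV::'n set). (cmod (z $ j))\<^sup>2)"
    by (rule sum_mono2) auto
  also have "\<dots> \<le> (\<Sum>j\<in>(UNIV::'n set). r\<^sup>2)" by (intro sum_mono c)
  finally show ?thesis using c[of last_ix] unfolding knorm_def by (simp add: algebra_simps)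
qed

lemma closure_kato_domain_eq: "closure kato_domain = {z. knorm z \<le> 1}"
proof (intro equalityI subsetI CollectI)
  fix z :: "'a cspace" assume "z \<in> {z. knorm z \<le> 1}"
  then have z: "knorm z \<le> 1" by simp
  define c where "c n = 1 - inverse (real (Suc n))" for n
  have c: "0 \<le> c n" "c n < 1" for n by (auto simp: c_def inverse_le_1_iff)
  have "c \<longlonglongrightarrow> 1 - 0" unfolding c_def by (intro tendsto_intros LIMSEQ_inverse_real_of_nat)
  then have "(\<lambda>n. of_real (c n) *s z) \<longlonglongrightarrow> 1 *s z"
    by (intro bounded_linear.tendsto[OF bounded_linear_smult_left]) (metis diff_zero of_real_1 tendsto_of_real)
  moreover have "of_real (c n) *s z \<in> kato_domain" for n
  proof -
    have "(c n)\<^sup>2 * knorm z \<le> (c n)\<^sup>2 * 1" using z by (intro mult_left_mono) auto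
    also have "\<dots> < 1" using c[of n] by (simp add: power_less_one_iff)
    finally show ?thesis by (simp add: kato_domain_eq knorm_scale)
  qed
  ultimately show "z \<in> closure kato_domain"
    unfolding closure_sequential by (intro exI[of _ "\<lambda>n. of_real (c n) *s z"]) simp
qed (rule closure_kato_domain)

subsection \<open>One-forms\<close>

lemma one_form_pullback:
  assumes "\<omega> \<in> holomorphic_one_forms \<A>" "c \<in> \<A>" "d \<in> \<A>" "v \<in> overlap c d"
  shows "\<omega> c v = pullback_covector (transition c d) v (\<omega> d (transition c d v))"
  using assms by (simp add: holomorphic_one_forms_def)

text \<open>The transformation rule for a chart change given by an explicit \<open>g\<close> with a
  known derivative, instead of \<open>inv_into\<close> and
  \<open>frechet_derivative\<close>.\<close>

lemma one_form_transition:
  assumes \<omega>: "\<omega> \<in> holomorphic_one_forms \<A>" and c: "(V, \<phi>) \<in> \<A>" "(U, \<psi>) \<in> \<A>" "inj_on \<psi> U"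
    and T: "open T" "v \<in> T" "\<And>x. x \<in> T \<Longrightarrow> x \<in> V \<and> g x \<in> U \<and> \<psi> (g x) = \<phi> x"
    and g: "(g has_derivative g') (at v)"
  shows "\<omega> (V, \<phi>) v $ i = (\<Sum>j\<in>UNIV. \<omega> (U, \<psi>) (g v) $ j * g' (axis i 1) $ j)"
proof -
  have t: "transition (V, \<phi>) (U, \<psi>) x = g x" if "x \<in> T" for x
    using T(3)[OF that] inv_into_f_eq[OF c(3)] by (simp add: transition_def)
  have "v \<in> overlap (V, \<phi>) (U, \<psi>)"
    using T(3)[OF T(2)] by (auto simp: overlap_def intro: image_eqI[of _ _ "g v"])
  moreover have "(transition (V, \<phi>) (U, \<psi>) has_derivative g') (at v)"
    by (rule has_derivative_transform_within_open[OF g T(1,2)]) (simp add: t)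
  ultimately show ?thesis
    using one_form_pullback[OF \<omega> c(1,2)] t[OF T(2)] frechet_derivative_at[of "transition (V, \<phi>) (U, \<psi>)" g' v]
    by (simp add: pullback_covector_def)
qed

text \<open>The zero covector pulls back to zero whatever the derivative is, so it is enough to know
  that both charts hit the same point.\<close>

lemma one_form_zero:
  assumes \<omega>: "\<omega> \<in> holomorphic_one_forms \<A>" and c: "(V, \<phi>) \<in> \<A>" "(U, \<psi>) \<in> \<A>" "inj_on \<psi> U"
    and v: "v \<in> V" "u \<in> U" "\<phi> v = \<psi> u" "\<omega> (U, \<psi>) u = 0"
  shows "\<omega> (V, \<phi>) v = 0"
proof -
  have "transition (V, \<phi>) (U, \<psi>) v = u"
    using v inv_into_f_eq[OF c(3)] by (simp add: transition_def)
  moreover have "v \<in> overlap (V, \<phi>) (U, \<psi>)" using v by (auto simp: overlap_def)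
  ultimately have "\<omega> (V, \<phi>) v = pullback_covector (transition (V, \<phi>) (U, \<psi>)) v (\<omega> (U, \<psi>) u)"
    using one_form_pullback[OF \<omega> c(1,2)] by metis
  then show ?thesis using v(4) by (simp add: pullback_covector_def vec_eq_iff)
qed

lemma one_form_holo: "\<omega> \<in> holomorphic_one_forms \<A> \<Longrightarrow> (V, \<phi>) \<in> \<A> \<Longrightarrow> holo_on V (\<omega> (V, \<phi>))"
  by (auto simp: holomorphic_one_forms_def)

lemma zero_one_form: "(\<lambda>_ _. 0) \<in> holomorphic_one_forms \<A>"
  by (auto simp: holomorphic_one_forms_def pullback_covector_def holo_on_def vec_eq_iff
      intro!: exI[of _ "\<lambda>_. 0"])

text \<open>A new chart meets its exceptional divisor only where the last coordinate is 0; elsewhere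
  it is the previous \<open>sigma_map\<close> after a monomial map, which preserves the
  torus.\<close>

lemma tower_atlas_torus:
  "(V, \<phi>) \<in> tower_atlas js p \<Longrightarrow> v \<in> V \<Longrightarrow> v \<in> torus \<Longrightarrow> \<exists>z\<in>torus. \<phi> v = Ambient z"
proof (induction p arbitrary: V \<phi> v)
  case (Suc p)
  show ?case
  proof (cases "\<exists>V'. (V', \<phi>) \<in> tower_atlas js p \<and> V = {v \<in> V'. \<phi> v \<noteq> sigma_map js p 0}")
    case True
    then show ?thesis using Suc by auto
  next
    case False
    then obtain j where j: "\<phi> = new_chart js p j" using Suc.prems by (auto simp: tower_atlas_Suc)
    have "v $ last_ix \<noteq> 0" using Suc.prems(3) by (simp add: torus_def)
    then show ?thesis
      using Suc.IH[OF sigma_map_chart UNIV_I monomial_torus[OF Suc.prems(3)], of "elem_matrix j"]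
      by (simp add: j new_chart_eq)
  qed
qed auto

lemma Ambient_0_notin_tower: "Ambient 0 \<notin> tower js (Suc p)"
  by (induction p) auto

section \<open>Contraction of the domain and iterates of \<open>F\<close>\<close>

context kato
begin

text \<open>By compactness \<open>knorm (F z)\<close> has a maximum below 1 on
  \<open>closure D\<close>; rescaling to the unit sphere of \<open>knorm\<close> makes this bound
  linear in \<open>knorm z\<close>.\<close>

lemma knorm_F_contract:
  obtains s where "0 < s" "s < 1" "\<And>z. knorm z \<le> 1 \<Longrightarrow> knorm (F z) \<le> s * knorm z"
proof -
  have "continuous_on (closure D) (\<lambda>z. knorm (F z))"
    by (rule continuous_on_compose2[OF continuous_knorm])
      (auto intro: continuous_at_imp_continuous_on F_cont)
  then obtain w where w: "w \<in> closure D" "\<And>z. z \<in> closure D \<Longrightarrow> knorm (F z) \<le> knorm (F w)"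
    using continuous_attains_sup[OF compact_cD] D_closure[OF zero_D] by (metis empty_iff)
  \<comment> \<open>The lower bound 1/2 only keeps \<open>s\<close> positive.\<close>
  define s where "s = max (knorm (F w)) (1/2)"
  have s: "0 < s" "s < 1" using F_closure[OF w(1)] by (auto simp: s_def kato_domain_eq)
  have "knorm (F z) \<le> s * knorm z" if z: "knorm z \<le> 1" for z
  proof (cases "z = 0")
    case True
    then show ?thesis by (simp add: monomial_word_0 knorm_def)
  next
    case False
    define c where "c = sqrt (knorm z)"
    have c: "0 < c" "c \<le> 1" "c\<^sup>2 = knorm z" using knorm_pos[OF False] z by (auto simp: c_def)
    define u where "u = of_real (inverse c) *s z"
    have zu: "z = of_real c *s u" using c(1) by (simp add: u_def vec_eq_iff)
    have "knorm u = 1" using c knorm_pos[OF False]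
      by (simp add: u_def knorm_scale norm_inverse power_inverse)
    then have u: "knorm (F u) \<le> s" using w(2)[of u] by (simp add: closure_kato_domain_eq s_def)
    have "cmod (F z $ p) \<le> cmod ((of_real c *s F u) $ p)" for p
    proof -
      let ?d = "nat (\<Sum>q\<in>UNIV. word_matrix js $ p $ q)"
      \<comment> \<open>Each component of \<open>F\<close> is a monomial of degree at least 1, so a
        factor \<open>c \<le> 1\<close> in the argument shrinks it at least by
        \<open>c\<close>.\<close>
      have "1 \<le> ?d" using word_matrix_row_pos[of js p] by simp
      then have "c ^ ?d \<le> c" using power_decreasing[of 1 ?d c] c by simp
      then show ?thesis unfolding zu monomial_scale[OF word_matrix_nonneg]
        using c(1) by (simp add: norm_mult norm_power mult_right_mono)
    qed
    then have "(cmod (F z $ p))\<^sup>2 \<le> (cmod ((of_real c *s F u) $ p))\<^sup>2" for p by (simp add: power_mono)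
    then have "knorm (F z) \<le> knorm (of_real c *s F u)"
      unfolding knorm_def by (intro add_mono sum_mono mult_left_mono) auto
    also have "\<dots> = knorm z * knorm (F u)" using c by (simp add: knorm_scale)
    also have "\<dots> \<le> knorm z * s" by (rule mult_left_mono[OF u knorm_nonneg])
    finally show ?thesis by (simp add: mult.commute)
  qed
  then show thesis using that s by blast
qed

lemma funpow_F: "(F ^^ m) z = monomial_map (word_matrix (concat (replicate m js))) z"
  by (induction m) (auto simp: monomial_map_one monomial_append)

text \<open>A letter different from \<open>last_ix\<close> forces the dimension to be at least
  2.\<close>

lemma ex_ne_ix: "\<exists>p. p \<noteq> (i::'n)"
  using kato by metis

definition A_transpose :: "complex^'n::{finite,wellorder}^'n::{finite,wellorder}" where
  "A_transpose = (\<chi> i p. of_int (word_matrix js $ p $ i))"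

end

subsection \<open>The fundamental domain\<close>

text \<open>\<open>B\<close> is the inverse of \<open>A_transpose\<close> and serves to continue
  coefficients inwards along \<open>F\<close>; \<open>s\<close> is the contraction factor of
  \<open>knorm_F_contract\<close>.\<close>

locale kato_form = kato js for js :: "'n::{finite,wellorder} list" +
  fixes \<omega> :: "('n, 'n cspace blowup_point set) chart \<Rightarrow> 'n cspace \<Rightarrow> 'n cspace"
    and B :: "complex^'n::{finite,wellorder}^'n::{finite,wellorder}" and s :: real
  assumes form: "\<omega> \<in> holomorphic_one_forms (kato_word_atlas js)"
    and B: "A_transpose ** B = mat 1" "B ** A_transpose = mat 1"
    and s: "0 < s" "s < 1" "\<And>z. knorm z \<le> 1 \<Longrightarrow> knorm (F z) \<le> s * knorm z"
begin

text \<open>A level separating the boundary of \<open>D\<close>, where \<open>knorm\<close> is 1,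
  from the image of \<open>closure D\<close> under \<open>F\<close>, where it is at most
  \<open>s\<close>.\<close>

definition "\<rho> = (s + 1) / 2"
text \<open>A shell around the boundary of \<open>D\<close> that is disjoint from its image under
  \<open>F\<close>; this makes the collar parametrisation injective on it.\<close>

definition "N = {z. \<rho> < knorm z \<and> knorm (F z) < \<rho>}"
definition "U = {z \<in> D. z \<notin> F ` closure D}"
definition "\<omega>U = \<omega> (U, kato_class js \<circ> Ambient)"
definition "\<omega>N = \<omega> (N, kato_class js \<circ> gam)"

lemma rho: "s < \<rho>" "\<rho> < 1" "0 < \<rho>"
  using s(1,2) by (auto simp: \<rho>_def)

lemma D_iff: "z \<in> D \<longleftrightarrow> knorm z < 1"
  by (simp add: kato_domain_eq)

lemma knorm_F: "knorm z \<le> 1 \<Longrightarrow> knorm (F z) \<le> s"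
  using s(3)[of z] mult_left_mono[of "knorm z" 1 s] s(1) by linarith

lemma Ambient_in_sigma_iff:
  assumes "v \<noteq> 0"
  shows "Ambient v \<in> \<sigma> ` S \<longleftrightarrow> v \<in> F ` S"
proof
  assume "Ambient v \<in> \<sigma> ` S"
  then obtain w where "w \<in> S" "Ambient v = \<sigma> w" by (elim imageE)
  moreover from this(2) have "v = F w" using pi_Ambient[of v] pi_sigma[of w] by simp
  ultimately show "v \<in> F ` S" by (intro image_eqI)
next
  assume "v \<in> F ` S"
  then obtain w where "w \<in> S" "v = F w" by (elim imageE)
  then show "Ambient v \<in> \<sigma> ` S" using sigma_eq_Ambient[of js w] assms by (intro image_eqI[of _ _ w]) simp_all
qed

lemma zero_notin_U: "0 \<notin> U"
  using D_closure[OF zero_D] monomial_word_0[of js] by (force simp: U_def)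

text \<open>A chart is a pair, so \<open>U\<close> must be exactly the domain listed in the atlas.
  The domain of \<open>Ambient\<close> in the tower omits 0 because the word is not empty, and
  \<open>U\<close> omits 0 because \<open>F\<close> fixes it.\<close>

lemma U_atlas: "(U, kato_class js \<circ> Ambient) \<in> kato_word_atlas js"
proof (rule word_atlas_int)
  obtain V where V: "- {0} \<subseteq> V" "(V, Ambient) \<in> tower_atlas js (length js)" using Ambient_chart by blast
  have "length js = Suc (length js - 1)" using kato by (cases js) auto
  then have "0 \<notin> V" using tower_atlas_image[OF V(2)] Ambient_0_notin_tower by metis
  then have V': "v \<in> V \<longleftrightarrow> v \<noteq> 0" for v using V(1) by auto
  have "v \<in> U \<longleftrightarrow> v \<in> V \<and> \<pi> (Ambient v) \<in> D \<and> Ambient v \<notin> \<sigma> ` closure D" for v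
    using zero_notin_U Ambient_in_sigma_iff[of v "closure D"] by (auto simp: V' U_def pi_Ambient)
  then show "int_chart U Ambient" unfolding int_chart_def using V(2) by blast
qed

lemma N_D_subset_U: "N \<inter> D \<subseteq> U"
proof
  fix z assume z: "z \<in> N \<inter> D"
  have "z \<noteq> F w" if "w \<in> closure D" for w
    using z knorm_F[of w] rho that by (auto simp: N_def closure_kato_domain_eq)
  then show "z \<in> U" using z by (auto simp: U_def)
qed

lemma open_N: "open N"
proof -
  have 1: "continuous_on UNIV (\<lambda>z. knorm (F z))"
    by (rule continuous_on_compose2[OF continuous_knorm])
      (auto intro: continuous_at_imp_continuous_on F_cont)
  show ?thesis unfolding N_def
    by (intro open_Collect_conj open_Collect_less continuous_knorm 1 continuous_intros)
qed

lemma N_atlas: "(N, kato_class js \<circ> gam) \<in> kato_word_atlas js"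
proof (rule word_atlas_col)
  have col: "z \<in> kato_collar js" if "z \<in> N" for z
  proof (cases "z \<in> D")
    case True
    then have "z \<in> U" using that N_D_subset_U by auto
    then have "z \<noteq> 0" "z \<notin> F ` closure D" using zero_notin_U by (auto simp: U_def)
    then show ?thesis using True Ambient_in_sigma_iff[of z "closure D"] by (simp add: collar_iff)
  next
    case False
    then show ?thesis using that rho by (auto simp: collar_iff N_def D_iff)
  qed
  have n: "Ambient z \<noteq> \<sigma> w" if "z \<in> N" "w \<in> N" for z w
  proof
    assume "Ambient z = \<sigma> w"
    then have "z = F w" using pi_Ambient[of z] pi_sigma[of w] by simp
    then show False using that by (auto simp: N_def)
  qed
  have "inj_on (kato_collar_map js) N"
  proof (rule inj_onI)
    fix z w assume zw: "z \<in> N" "w \<in> N" "kato_collar_map js z = kato_collar_map js w"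
    have "kato_class js (gam z) = kato_class js (gam w)" using zw(3) by (simp add: collar_map)
    then have "gam z = gam w" by (rule class_inj[OF gam_E[OF col[OF zw(1)]] gam_E[OF col[OF zw(2)]]])
    then show "z = w" using n[OF zw(1,2)] n[OF zw(2,1), symmetric]
      by (cases "z \<in> D"; cases "w \<in> D") (simp_all add: gam_def sigma_eq)
  qed
  then show "col_chart N" unfolding col_chart_def using open_N col by (intro conjI subsetI)
qed

lemma open_U: "open U"
  by (rule word_open[OF U_atlas])

lemma holo_U: "z \<in> U \<Longrightarrow> holo_at \<omega>U z"
  and holo_N: "z \<in> N \<Longrightarrow> holo_at \<omega>N z"
  using one_form_holo[OF form U_atlas] one_form_holo[OF form N_atlas]
  by (simp_all add: holo_on_eq \<omega>U_def \<omega>N_def)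

text \<open>Inside \<open>D\<close> the map \<open>gam\<close> is \<open>Ambient\<close>, so the
  chart change is the identity.\<close>

lemma \<omega>N_eq_\<omega>U: "z \<in> N \<Longrightarrow> z \<in> U \<Longrightarrow> \<omega>N z = \<omega>U z"
proof -
  assume z: "z \<in> N" "z \<in> U"
  have "\<omega>N z $ i = (\<Sum>j\<in>UNIV. \<omega>U z $ j * (axis i 1 :: 'n cspace) $ j)" for i
    unfolding \<omega>U_def \<omega>N_def
  proof (rule one_form_transition[OF form N_atlas U_atlas word_inj[OF U_atlas], of "N \<inter> U"])
    show "((\<lambda>x. x) has_derivative (\<lambda>x. x)) (at z)" by (rule has_derivative_ident)
    show "x \<in> N \<and> x \<in> U \<and> (kato_class js \<circ> Ambient) x = (kato_class js \<circ> gam) x" if "x \<in> N \<inter> U" for x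
      using that by (auto simp: gam_def U_def)
  qed (use z open_N open_U in auto)
  also have "(\<Sum>j\<in>UNIV. \<omega>U z $ j * (axis i 1 :: 'n cspace) $ j) = \<omega>U z $ i" for i
    by (simp add: axis_def if_distrib[of "\<lambda>x. _ * x"] cong: if_cong)
  finally show ?thesis by (simp add: vec_eq_iff)
qed

text \<open>The coefficients of the form with respect to \<open>dz\<^sub>i / z\<^sub>i\<close>. Pulling back along the monomial map
  \<open>F\<close> acts on them by the constant matrix \<open>A\<^sup>T\<close>.\<close>

definition "h z = (\<chi> i. z $ i * (if z \<in> N then \<omega>N z else \<omega>U z) $ i)"

lemma h_U: "z \<in> U \<Longrightarrow> h z = (\<chi> i. z $ i * \<omega>U z $ i)"
  by (simp add: h_def \<omega>N_eq_\<omega>U)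

lemma h_cholo: "z \<in> N \<union> U \<Longrightarrow> cholo_at (\<lambda>z. h z $ i) z"
proof (elim UnE)
  assume z: "z \<in> N"
  then have "cholo_at (\<lambda>z. z $ i * \<omega>N z $ i) z"
    by (intro cholo_at_mult cholo_at_nth cholo_at_component holo_N)
  then show ?thesis by (rule cholo_at_cong[OF _ open_N z]) (simp add: h_def)
next
  assume z: "z \<in> U"
  then have "cholo_at (\<lambda>z. z $ i * \<omega>U z $ i) z"
    by (intro cholo_at_mult cholo_at_nth cholo_at_component holo_U)
  then show ?thesis by (rule cholo_at_cong[OF _ open_U z]) (simp add: h_U)
qed

text \<open>Outside \<open>closure D\<close> the collar chart is \<sigma>, which is
  \<open>Ambient\<close> after \<open>F\<close> where \<open>F\<close> is nonzero. Hence
  \<open>F\<close> is the chart change from \<open>N\<close> to \<open>U\<close>, and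
  \<open>monomial_log_derivative\<close> supplies the constant matrix.\<close>

lemma h_step:
  assumes z: "z \<in> N" "z \<notin> closure D" "F z \<noteq> 0"
  shows "h z = A_transpose *v h (F z)"
proof -
  \<comment> \<open>Injectivity off the fibre over 0 keeps \<open>F x\<close> out of the image of
    \<open>closure D\<close>.\<close>
  have FU: "F x \<in> U" if x: "x \<in> N" "x \<notin> closure D" "F x \<noteq> 0" for x
  proof -
    have "F x \<noteq> F w" if "w \<in> closure D" for w
      using monomial_word_inj[of js w x] that x by metis
    moreover have "F x \<in> D" using x(1) rho by (auto simp: N_def D_iff)
    ultimately show ?thesis by (auto simp: U_def)
  qed
  obtain F' where F': "(F has_derivative F') (at z)" "\<And>c h. F' (c *s h) = c *s F' h"
    using holo_word[of js z] unfolding holo_at_def by blast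
  let ?T = "{x \<in> N - closure D. F x \<in> - {0}}"
  have "\<omega>N z $ i = (\<Sum>j\<in>UNIV. \<omega>U (F z) $ j * F' (axis i 1) $ j)" for i
    unfolding \<omega>U_def \<omega>N_def
  proof (rule one_form_transition[OF form N_atlas U_atlas word_inj[OF U_atlas], of ?T])
    show "open ?T" by (intro open_preimage open_Diff open_N holo_word) auto
    show "x \<in> N \<and> F x \<in> U \<and> (kato_class js \<circ> Ambient) (F x) = (kato_class js \<circ> gam) x" if "x \<in> ?T" for x
      using that FU[of x] D_closure[of x] sigma_eq_Ambient[of js x] by (auto simp: gam_def)
  qed (use z F' in auto)
  then have "h z $ i = (\<Sum>j\<in>UNIV. \<omega>U (F z) $ j * (z $ i * F' (axis i 1) $ j))" for i
    using z(1) by (simp add: h_def sum_distrib_left mult_ac)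
  then show ?thesis
    using h_U[OF FU[OF z]]
    by (simp add: monomial_log_derivative[OF word_matrix_nonneg F'] vec_eq_iff matrix_vector_mult_def
        A_transpose_def mult_ac)
qed

subsection \<open>Extension to the punctured domain\<close>

lemma funpow_F_inj: "(F ^^ m) z = (F ^^ m) w \<Longrightarrow> (F ^^ m) w \<noteq> 0 \<Longrightarrow> z = w"
  unfolding funpow_F by (rule monomial_word_inj)

lemma funpow_F_0: "(F ^^ m) 0 = 0"
  unfolding funpow_F by (rule monomial_word_0)

lemma funpow_F_torus: "z \<in> torus \<Longrightarrow> (F ^^ m) z \<in> torus"
  unfolding funpow_F by (rule monomial_torus)

lemma knorm_funpow_F: "knorm z \<le> 1 \<Longrightarrow> knorm ((F ^^ m) z) \<le> s ^ m"
proof (induction m)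
  case (Suc m)
  have "knorm ((F ^^ m) z) \<le> 1" using Suc power_le_one[of s m] s by force
  then have "knorm ((F ^^ Suc m) z) \<le> s * knorm ((F ^^ m) z)" using s(3) by simp
  also have "\<dots> \<le> s * s ^ m" using Suc s(1) by simp
  finally show ?case by simp
qed simp

lemma funpow_F_D: "z \<in> D \<Longrightarrow> (F ^^ m) z \<in> D"
  by (induction m) (simp_all add: F_closure D_closure)

lemma F_NU: "w \<in> N \<union> U \<Longrightarrow> knorm (F w) < \<rho>"
  using knorm_F[of w] rho by (auto simp: N_def U_def D_iff)

text \<open>\<open>N \<union> U\<close> is a neighbourhood of the fundamental domain \<open>D - F(D)\<close> of the action of \<open>F\<close>
  on \<open>D - {0}\<close>.\<close>

lemma ex_orbit:
  assumes "z \<in> D" "z \<noteq> 0"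
  shows "\<exists>m w. w \<in> N \<union> U \<and> z = (F ^^ m) w"
proof -
  \<comment> \<open>The exponent \<open>k\<close> bounds the number of steps back along
    \<open>F\<close>: each raises \<open>knorm\<close> at least by the factor \<open>1 / s\<close>,
    while it stays below 1 in \<open>D\<close>.\<close>
  have "(\<lambda>k. s ^ k) \<longlonglongrightarrow> 0" using s by (intro LIMSEQ_realpow_zero) auto
  then have "\<forall>\<^sub>F k in sequentially. s ^ k < knorm z" using knorm_pos[OF assms(2)] by (rule order_tendstoD)
  then obtain k where "s ^ k < knorm z" by (metis eventually_happens sequentially_bot)
  then show ?thesis using assms
  proof (induction k arbitrary: z)
    case 0
    then show ?case by (simp add: D_iff)
  next
    case (Suc k)
    show ?case
    proof (cases "z \<in> U")
      case True
      then show ?thesis by (intro exI[of _ 0] exI[of _ z]) simp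
    next
      case False
      then obtain w where w: "w \<in> closure D" "z = F w" using Suc.prems by (auto simp: U_def)
      then have w1: "knorm w \<le> 1" by (simp add: closure_kato_domain_eq)
      show ?thesis
      proof (cases "w \<in> D")
        case True
        have "s * s ^ k < s * knorm w" using Suc.prems(1) s(3)[OF w1] w(2) by simp
        then have "s ^ k < knorm w" using s(1) by simp
        moreover have "w \<noteq> 0" using Suc.prems(3) w(2) monomial_word_0 by metis
        ultimately obtain m u where "u \<in> N \<union> U" "w = (F ^^ m) u" using Suc.IH True by blast
        then show ?thesis using w(2) by (intro exI[of _ "Suc m"] exI[of _ u]) simp
      next
        case False
        then have "w \<in> N" using w1 knorm_F[OF w1] rho by (auto simp: N_def D_iff)
        then show ?thesis using w(2) by (intro exI[of _ "1::nat"] exI[of _ w]) simp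
      qed
    qed
  qed
qed

text \<open>Makes \<open>H\<close> below well defined. An orbit meets \<open>N \<union> U\<close>
  either once or in two consecutive points, the first in \<open>N\<close> outside
  \<open>closure D\<close> and the second in \<open>U\<close>; in the latter case
  \<open>h_step\<close> compares the values.\<close>

lemma h_orbit:
  assumes "w \<in> N \<union> U" "w' \<in> N \<union> U" "(F ^^ m) w = (F ^^ k) w'" "(F ^^ m) w \<noteq> 0" "m \<le> k"
  shows "((*v) B ^^ m) (h w) = ((*v) B ^^ k) (h w')"
proof -
  obtain d where d: "k = m + d" using assms(5) le_Suc_ex by blast
  have "(F ^^ m) w = (F ^^ m) ((F ^^ d) w')" using assms(3) by (simp add: d funpow_add)
  then have w: "w = (F ^^ d) w'" using funpow_F_inj[of m w] assms(4) by metis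
  have w0: "w \<noteq> 0" using assms(4) funpow_F_0 by metis
  show ?thesis
  proof (cases d)
    case 0
    then show ?thesis using w d by simp
  next
    case (Suc e)
    define u where "u = (F ^^ e) w'"
    have wu: "w = F u" using w Suc by (simp add: u_def)
    \<comment> \<open>For positive \<open>e\<close> the point \<open>u\<close> is an iterate of
      \<open>F w'\<close>, which lies in \<open>D\<close>. As \<open>u\<close> turns out to lie
      outside \<open>closure D\<close>, this forces \<open>e = 0\<close>.\<close>
    have u: "u \<in> D" if "e \<noteq> 0"
    proof -
      obtain e' where e': "e = Suc e'" using \<open>e \<noteq> 0\<close> not0_implies_Suc by blast
      have "u = (F ^^ e') (F w')" by (simp add: u_def e' funpow_swap1)
      moreover have "F w' \<in> D" using F_NU[OF assms(2)] rho by (simp add: D_iff)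
      ultimately show ?thesis using funpow_F_D by simp
    qed
    have "w \<notin> N"
    proof (cases "e = 0")
      case True
      then have "knorm w < \<rho>" using F_NU[OF assms(2)] wu by (simp add: u_def)
      then show ?thesis by (auto simp: N_def)
    next
      case False
      then have "knorm w \<le> s" using u knorm_F[of u] wu by (simp add: D_iff)
      then show ?thesis using rho by (auto simp: N_def)
    qed
    then have wU: "w \<in> U" using assms(1) by blast
    then have uc: "u \<notin> closure D" using wu by (auto simp: U_def)
    then have e0: "e = 0" using u D_closure by blast
    then have "w' = u" by (simp add: u_def)
    moreover from this have "u \<in> N" using assms(2) uc D_closure by (auto simp: U_def)
    ultimately have "h w' = A_transpose *v h w" using h_step[of u] uc wu w0 by simp
    then have "B *v h w' = h w" by (simp add: matrix_vector_mul_assoc B)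
    moreover have "k = Suc m" using d Suc e0 by simp
    ultimately show ?thesis by (simp add: funpow_swap1)
  qed
qed

text \<open>The equation for \<open>h\<close> solved for its value at \<open>F w\<close>, namely
  \<open>B *v h w\<close>, and iterated along the orbit. By \<open>H_eq\<close> the value does not
  depend on the chosen \<open>m\<close> and \<open>w\<close>.\<close>

definition "H z = (SOME y. \<exists>m w. w \<in> N \<union> U \<and> z = (F ^^ m) w \<and> y = ((*v) B ^^ m) (h w))"

lemma H_eq:
  assumes "w \<in> N \<union> U" "(F ^^ m) w \<noteq> 0"
  shows "H ((F ^^ m) w) = ((*v) B ^^ m) (h w)"
  unfolding H_def
proof (rule some_equality)
  fix y assume "\<exists>k u. u \<in> N \<union> U \<and> (F ^^ m) w = (F ^^ k) u \<and> y = ((*v) B ^^ k) (h u)"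
  then obtain k u where u: "u \<in> N \<union> U" "(F ^^ m) w = (F ^^ k) u" "y = ((*v) B ^^ k) (h u)" by blast
  show "y = ((*v) B ^^ m) (h w)"
  proof (cases "m \<le> k")
    case True
    then show ?thesis using h_orbit[OF assms(1) u(1,2) assms(2)] u(3) by simp
  next
    case False
    then show ?thesis using h_orbit[OF u(1) assms(1) u(2)[symmetric]] u(2,3) assms(2) by simp
  qed
qed (use assms in blast)

lemma H_NU: "w \<in> N \<union> U \<Longrightarrow> w \<noteq> 0 \<Longrightarrow> H w = h w"
  using H_eq[of w 0] by simp

lemma H_step:
  assumes "z \<in> D" "z \<noteq> 0" "F z \<noteq> 0"
  shows "H z = A_transpose *v H (F z)"
proof -
  obtain m w where w: "w \<in> N \<union> U" "z = (F ^^ m) w" using ex_orbit[OF assms(1,2)] by blast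
  have "H (F z) = B *v H z" using H_eq[of w m] H_eq[of w "Suc m"] w assms by simp
  then show ?thesis by (simp add: matrix_vector_mul_assoc B)
qed

text \<open>With \<open>m\<close> fixed and \<open>g\<close> a local inverse of
  \<open>F ^^ m\<close>, the extension is \<open>h\<close> after \<open>g\<close>, multiplied
  \<open>m\<close> times by \<open>B\<close>.\<close>

lemma H_cholo:
  assumes "z \<in> D" "z \<noteq> 0"
  shows "cholo_at (\<lambda>z. H z $ i) z"
proof -
  obtain m w where w: "w \<in> N \<union> U" "z = (F ^^ m) w" using ex_orbit[OF assms] by blast
  obtain T g where T: "open T" "z \<in> T" "g z = w" "\<And>x. x \<in> T \<Longrightarrow> holo_at g x" "\<And>x. x \<in> T \<Longrightarrow> (F ^^ m) (g x) = x"
    using monomial_word_local_inverse[of "concat (replicate m js)" w] assms(2) w(2)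
    unfolding funpow_F[symmetric] by metis
  have "cholo_at (\<lambda>x. h (g x) $ j) z" for j
    by (rule cholo_at_comp[OF T(4)[OF T(2)]]) (use T(3) h_cholo[OF w(1)] in simp)
  then have "cholo_at (\<lambda>x. (((*v) B ^^ m) (h (g x))) $ i) z" by (rule cholo_at_funpow_mult)
  moreover let ?T = "{x \<in> T. g x \<in> N \<union> U} \<inter> - {0}"
  have "open ?T" using open_preimage[OF T(1,4), of "N \<union> U"] open_N open_U by blast
  moreover have "z \<in> ?T" using T w assms by simp
  moreover have "(((*v) B ^^ m) (h (g x))) $ i = H x $ i" if "x \<in> ?T" for x
    using H_eq[of "g x" m] T(5)[of x] that by simp
  ultimately show ?thesis by (rule cholo_at_cong)
qed

subsection \<open>Vanishing\<close>

text \<open>The identity theorem on the punctured disc \<open>{c z | c \<noteq> 0} \<inter> D\<close>, near whose boundary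
  \<open>H\<^sub>i = z\<^sub>i \<omega>\<^sub>i\<close>.\<close>

lemma H_coord_zero:
  assumes z: "z \<in> D" "z \<noteq> 0" "z $ i = 0"
  shows "H z $ i = 0"
proof -
  let ?k = "knorm z"
  have k: "0 < ?k" "?k < 1" using z knorm_pos by (auto simp: D_iff)
  define S where "S = ball (0::complex) (1 / sqrt ?k) - {0}"
  have S: "c *s z \<in> D \<longleftrightarrow> c \<in> ball 0 (1 / sqrt ?k)" for c
  proof -
    have "(cmod c)\<^sup>2 * ?k < 1 \<longleftrightarrow> (cmod c * sqrt ?k)\<^sup>2 < 1" using k by (simp add: power_mult_distrib)
    also have "\<dots> \<longleftrightarrow> cmod c * sqrt ?k < 1" using k abs_square_less_1[of "cmod c * sqrt ?k"] by simp
    finally show ?thesis using k by (simp add: D_iff knorm_scale field_simps)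
  qed
  \<comment> \<open>An annulus of parameters for which \<open>c *s z\<close> lies in
    \<open>N \<inter> D\<close>. There \<open>H\<close> equals \<open>h\<close>, whose
    \<open>i\<close>-th component carries the vanishing factor \<open>z $ i\<close>.\<close>
  define R where "R = {c :: complex. \<rho> < (cmod c)\<^sup>2 * ?k \<and> (cmod c)\<^sup>2 * ?k < 1}"
  define t where "t = (\<rho> + 1) / 2"
  have t: "\<rho> < t" "t < 1" "0 < t" using rho by (auto simp: t_def)
  have RD: "c *s z \<in> D" "c \<noteq> 0" "c *s z \<in> N" if "c \<in> R" for c
    using that rho knorm_F[of "c *s z"] by (auto simp: R_def D_iff N_def knorm_scale)
  have "(\<lambda>c. H (c *s z) $ i) 1 = (\<lambda>_. 0) (1::complex)"
  proof (rule analytic_continuation_open[of R S "\<lambda>c. H (c *s z) $ i" "\<lambda>_. 0" 1])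
    show "open R" unfolding R_def
      by (intro open_Collect_conj open_Collect_less continuous_intros)
    show "open S" by (simp add: S_def open_delete)
    have "of_real (sqrt (t / ?k)) \<in> R" using t k by (simp add: R_def)
    then show "R \<noteq> {}" by blast
    show "connected S" unfolding S_def by (rule connected_punctured_ball) simp
    show "R \<subseteq> S" using RD S unfolding S_def by blast
    have "cholo_at (\<lambda>z. H z $ i) (c *s z)" if "c \<in> S" for c
      using that z(2) S[of c] by (intro H_cholo) (auto simp: S_def)
    then show "(\<lambda>c. H (c *s z) $ i) holomorphic_on S"
      using holomorphic_on_complex_line[of S "\<lambda>z. H z $ i" 0 z] by simp
    show "H (c *s z) $ i = 0" if "c \<in> R" for c
    proof -
      have "H (c *s z) = h (c *s z)" using RD[OF that] z(2) by (intro H_NU) auto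
      then show ?thesis by (simp add: h_def z(3))
    qed
    show "1 \<in> S" using S[of 1] z(1) unfolding S_def by simp
  qed auto
  then show ?thesis by simp
qed

text \<open>Since \<open>n \<ge> 2\<close>, a line through a point of the torus parallel to an axis avoids the origin,
  so the Schwarz lemma on it bounds \<open>H\<^sub>i\<close> near the origin although \<open>H\<close> need not
  be defined there.\<close>

lemma H_Schwarz:
  obtains r C where "0 < r"
    "\<And>z. z \<in> torus \<Longrightarrow> (\<And>p. cmod (z $ p) \<le> r) \<Longrightarrow> cmod (H z $ i) \<le> C * cmod (z $ i)"
proof -
  let ?n = "real CARD('n) + 2"
  \<comment> \<open>Chosen so that the closed polydisc of radius \<open>r\<close> lies in
    \<open>D\<close>: the bound \<open>?n * r\<^sup>2\<close> equals \<open>r\<close>.\<close>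
  define r where "r = 1 / ?n"
  have r: "0 < r" by (simp add: r_def)
  have D: "z \<in> D" if "\<And>p. cmod (z $ p) \<le> r" for z
  proof -
    have "knorm z \<le> ?n * r\<^sup>2" using that by (rule knorm_le)
    also have "\<dots> = r" by (simp add: r_def power2_eq_square)
    also have "\<dots> < 1" by (simp add: r_def)
    finally show ?thesis by (simp add: D_iff)
  qed
  \<comment> \<open>This compact part of the polydisc contains the boundary circles of all the discs
    used below and avoids the origin, so one bound serves for all of them.\<close>
  define K where "K = {z :: 'n cspace. cmod (z $ i) = r \<and> (\<forall>p. cmod (z $ p) \<le> r)}"
  have KD: "z \<in> D" "z \<noteq> 0" if "z \<in> K" for z using that D r by (auto simp: K_def)
  have "closed K" unfolding K_def
    by (intro closed_Collect_conj closed_Collect_all closed_Collect_eq closed_Collect_le continuous_intros)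
  moreover have "K \<subseteq> closure D" using KD D_closure by blast
  ultimately have "compact K" using compact_cD by (metis closed_Int_compact inf.absorb1)
  moreover have "continuous_on K (\<lambda>z. H z $ i)"
    by (intro continuous_at_imp_continuous_on ballI cholo_at_continuous H_cholo KD)
  ultimately have "bounded ((\<lambda>z. H z $ i) ` K)" by (intro compact_imp_bounded compact_continuous_image)
  then obtain b where b: "\<And>z. z \<in> K \<Longrightarrow> cmod (H z $ i) \<le> b" unfolding bounded_iff by auto
  have "cmod (H z $ i) \<le> b / r * cmod (z $ i)" if z: "z \<in> torus" "\<And>p. cmod (z $ p) \<le> r" for z
  proof -
    \<comment> \<open>The disc is centred at the projection of \<open>z\<close> to the hyperplane
      where the \<open>i\<close>-th coordinate vanishes, so \<open>H_coord_zero\<close> gives the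
      zero at its centre.\<close>
    define a where "a = (\<chi> p. if p = i then 0 else z $ p)"
    have nth: "(a + c *s axis i 1) $ p = (if p = i then c else z $ p)" for c p
      by (simp add: a_def axis_def)
    obtain q where q: "q \<noteq> i" using ex_ne_ix by blast
    have ne: "a + c *s axis i 1 \<noteq> 0" for c
    proof
      assume "a + c *s axis i 1 = 0"
      from arg_cong[OF this, of "\<lambda>v. v $ q"] show False using nth[of c q] q z(1) by (simp add: torus_def)
    qed
    let ?S = "{c. a + c *s axis i 1 \<in> D}"
    have "continuous_on UNIV (\<lambda>c. a + c *s axis i 1)"
      by (intro continuous_intros linear_continuous_on bounded_linear_smult_left)
    then have "open ?S"
      using open_vimage[OF open_kato_domain, of "\<lambda>c. a + c *s axis i 1"] by (simp add: vimage_def)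
    moreover have "(\<lambda>c. H (a + c *s axis i 1) $ i) holomorphic_on ?S"
      by (rule holomorphic_on_complex_line) (simp add: H_cholo ne)
    moreover have in_D: "cball 0 r \<subseteq> ?S"
    proof
      fix c :: complex assume "c \<in> cball 0 r"
      then have "cmod ((a + c *s axis i 1) $ p) \<le> r" for p using z(2) unfolding nth by simp
      then show "c \<in> ?S" using D by blast
    qed
    moreover have "H (a + 0 *s axis i 1) $ i = 0"
    proof (rule H_coord_zero[OF _ ne])
      show "a + 0 *s axis i 1 \<in> D" using subsetD[OF in_D, of 0] r by simp
      show "(a + 0 *s axis i 1) $ i = 0" unfolding nth by simp
    qed
    moreover have "cmod (H (a + c *s axis i 1) $ i) \<le> b" if "cmod c = r" for c
      by (rule b) (use z(2) that in \<open>simp add: K_def nth del: vector_add_component\<close>)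
    ultimately have "cmod (H (a + z $ i *s axis i 1) $ i) \<le> b / r * cmod (z $ i)"
      using z(2)[of i] r by (intro Schwarz_bound) auto
    moreover have "a + z $ i *s axis i 1 = z" using nth[of "z $ i"] by (simp add: vec_eq_iff)
    ultimately show ?thesis by simp
  qed
  then show thesis using that r by blast
qed

text \<open>The iterate of \<open>H_step\<close>, valid because torus orbits never reach 0. Its
  coefficients are the exponents of \<open>F ^^ m\<close>, hence comparable with the effect of
  scaling a coordinate.\<close>

lemma H_funpow:
  assumes "z \<in> torus" "z \<in> D"
  shows "H z $ i = (\<Sum>p\<in>UNIV. of_int (word_matrix (concat (replicate m js)) $ p $ i) * H ((F ^^ m) z) $ p)"
proof (induction m)
  case 0
  have "of_int (mat 1 $ p $ i) * H z $ p = (if p = i then H z $ p else 0)" for p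
    by (simp add: mat_def)
  then show ?case by (simp add: word_matrix_def)
next
  case (Suc m)
  let ?W = "word_matrix (concat (replicate m js)) :: 'n int_mat" and ?y = "(F ^^ m) z"
  have y: "?y \<in> torus" by (rule funpow_F_torus[OF assms(1)])
  have "?y \<in> D" by (rule funpow_F_D[OF assms(2)])
  moreover have "?y \<noteq> 0" "F ?y \<noteq> 0" using zero_notin_torus y monomial_torus[OF y] by metis+
  ultimately have "H ?y = A_transpose *v H (F ?y)" by (intro H_step)
  then have e: "H ?y $ p = (\<Sum>q\<in>UNIV. of_int (word_matrix js $ q $ p) * H (F ?y) $ q)" for p
    by (simp add: matrix_vector_mult_def A_transpose_def)
  have "H z $ i = (\<Sum>p\<in>UNIV. \<Sum>q\<in>UNIV. of_int (word_matrix js $ q $ p * ?W $ p $ i) * H (F ?y) $ q)"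
    unfolding Suc.IH e by (simp add: sum_distrib_left mult_ac)
  also have "\<dots> = (\<Sum>q\<in>UNIV. of_int (\<Sum>p\<in>UNIV. word_matrix js $ q $ p * ?W $ p $ i) * H (F ?y) $ q)"
    by (subst sum.swap) (simp add: sum_distrib_right)
  finally show ?case by (simp add: word_matrix_append matrix_matrix_mult_def)
qed

text \<open>The growth of the exponents \<open>a\<^sub>p\<^sub>i\<close> of \<open>F\<^sup>m\<close> is absorbed by scaling the \<open>i\<close>-th coordinate
  by \<open>t > 1\<close>, which multiplies the \<open>p\<close>-th component of \<open>F\<^sup>m\<close> by \<open>t\<close> to the power \<open>a\<^sub>p\<^sub>i\<close>.\<close>

lemma H_torus:
  assumes z: "z \<in> torus" "z \<in> D"
  shows "H z = 0"
proof -
  have "H z $ i = 0" for i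
  proof -
    define y where "y t = (\<chi> q. if q = i then of_real t * z $ q else z $ q)" for t :: real
    have "(y \<longlongrightarrow> y 1) (at_right 1)"
      unfolding y_def by (intro vec_tendstoI) (auto intro!: tendsto_eq_intros)
    moreover have "y 1 = z" by (simp add: y_def vec_eq_iff)
    ultimately have "\<forall>\<^sub>F t in at_right 1. y t \<in> D" using z(2) open_kato_domain topological_tendstoD by metis
    moreover have "\<forall>\<^sub>F t in at_right (1::real). t > 1" by (simp add: eventually_at_filter)
    ultimately have "\<forall>\<^sub>F t in at_right 1. y t \<in> D \<and> t > 1" by eventually_elim simp
    \<comment> \<open>As \<open>D\<close> is open, the \<open>i\<close>-th coordinate of
      \<open>z\<close> can be enlarged slightly within \<open>D\<close>.\<close>
    then obtain t where t: "y t \<in> D" "t > 1" using eventually_happens'[of "at_right (1::real)"] by force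
    have "\<forall>p. \<exists>r C. 0 < r \<and> (\<forall>z. z \<in> torus \<longrightarrow> (\<forall>p. cmod (z $ p) \<le> r) \<longrightarrow> cmod (H z $ p) \<le> C * cmod (z $ p))"
      using H_Schwarz by metis
    then obtain r C where rC: "\<And>p. 0 < r p"
      "\<And>p z. z \<in> torus \<Longrightarrow> (\<And>q. cmod (z $ q) \<le> r p) \<Longrightarrow> cmod (H z $ p) \<le> C p * cmod (z $ p)"
      by metis
    define C' where "C' p = \<bar>C p\<bar>" for p
    have small: "cmod ((F ^^ m) x $ p) \<le> sqrt (s ^ m)" if "x \<in> D" for x m p
    proof -
      have "(cmod ((F ^^ m) x $ p))\<^sup>2 \<le> s ^ m"
        using coord_le_knorm[of "(F ^^ m) x" p] knorm_funpow_F[of x m] that by (simp add: D_iff)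
      then show ?thesis by (rule real_le_rsqrt)
    qed
    have "(\<lambda>m. s ^ m) \<longlonglongrightarrow> 0" using s by (intro LIMSEQ_realpow_zero) auto
    then have lim: "(\<lambda>m. sqrt (s ^ m)) \<longlonglongrightarrow> 0" using tendsto_real_sqrt by fastforce
    have "\<forall>\<^sub>F m in sequentially. sqrt (s ^ m) < r p" for p by (rule order_tendstoD(2)[OF lim rC(1)])
    then have "\<forall>\<^sub>F m in sequentially. \<forall>p. sqrt (s ^ m) < r p" by (simp add: eventually_all_finite)
    then have "\<forall>\<^sub>F m in sequentially. cmod (H z $ i) \<le> (\<Sum>p\<in>UNIV. C' p * (sqrt (s ^ m) / (t - 1)))"
    proof eventually_elim
      case (elim m)
      let ?a = "\<lambda>p. word_matrix (concat (replicate m js)) $ p $ i"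
      have "cmod (of_int (?a p) * H ((F ^^ m) z) $ p) \<le> C' p * (sqrt (s ^ m) / (t - 1))" for p
      proof -
        define a where "a = nat (?a p)"
        have a: "?a p = int a" using word_matrix_nonneg[of "concat (replicate m js)" p i] by (simp add: a_def)
        have "(F ^^ m) (y t) $ p = of_real t ^ a * (F ^^ m) z $ p"
          unfolding funpow_F y_def a_def by (rule monomial_scale_coord[OF word_matrix_nonneg])
        then have F: "cmod ((F ^^ m) (y t) $ p) = t ^ a * cmod ((F ^^ m) z $ p)"
          using t(2) by (simp add: norm_mult norm_power)
        \<comment> \<open>Bernoulli's inequality trades the factor \<open>a\<close> for the power of
          \<open>t\<close> that appears in \<open>F ^^ m\<close> at \<open>y t\<close>, where the
          decay \<open>small\<close> still applies.\<close>
        have "real a * (t - 1) \<le> t ^ a" using Bernoulli_inequality[of "t - 1" a] t(2) by simp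
        then have "real a * (t - 1) * cmod ((F ^^ m) z $ p) \<le> cmod ((F ^^ m) (y t) $ p)"
          unfolding F by (intro mult_right_mono) auto
        also have "\<dots> \<le> sqrt (s ^ m)" by (rule small[OF t(1)])
        finally have 1: "real a * cmod ((F ^^ m) z $ p) \<le> sqrt (s ^ m) / (t - 1)"
          using t(2) by (simp add: field_simps)
        have "cmod (H ((F ^^ m) z) $ p) \<le> C p * cmod ((F ^^ m) z $ p)"
          using elim small[OF z(2), of m] by (intro rC(2) funpow_F_torus z(1)) (meson less_imp_le order_trans)
        also have "\<dots> \<le> C' p * cmod ((F ^^ m) z $ p)" by (simp add: C'_def mult_right_mono)
        finally have "real a * cmod (H ((F ^^ m) z) $ p) \<le> real a * (C' p * cmod ((F ^^ m) z $ p))"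
          by (rule mult_left_mono) simp
        also have "\<dots> = C' p * (real a * cmod ((F ^^ m) z $ p))" by simp
        also have "\<dots> \<le> C' p * (sqrt (s ^ m) / (t - 1))" by (rule mult_left_mono[OF 1]) (simp add: C'_def)
        finally show ?thesis by (simp add: norm_mult a)
      qed
      then show ?case unfolding H_funpow[OF z, of i m] by (intro norm_sum[THEN order_trans] sum_mono)
    qed
    moreover have "(\<lambda>m. \<Sum>p\<in>UNIV. C' p * (sqrt (s ^ m) / (t - 1))) \<longlonglongrightarrow> (\<Sum>p\<in>(UNIV::'n set). C' p * (0 / (t - 1)))"
      by (intro tendsto_intros lim) (use t(2) in auto)
    ultimately have "cmod (H z $ i) \<le> 0"
      using tendsto_lowerbound[of _ _ sequentially "cmod (H z $ i)"] by force
    then show ?thesis by simp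
  qed
  then show ?thesis by (simp add: vec_eq_iff)
qed

section \<open>Vanishing of the form in all charts\<close>

lemma h_torus:
  assumes "z \<in> torus" "z \<in> N \<union> U"
  shows "h z = 0"
proof -
  \<comment> \<open>Since \<open>z\<close> may lie outside \<open>D\<close>, the vanishing of
    \<open>H\<close> is used at \<open>F z\<close> and pulled back by
    \<open>A_transpose\<close>.\<close>
  have F: "F z \<in> torus" by (rule monomial_torus[OF assms(1)])
  then have F0: "F z \<noteq> 0" using zero_notin_torus by metis
  have "F z \<in> D" using F_NU[OF assms(2)] rho by (simp add: D_iff)
  then have "H (F z) = 0" by (rule H_torus[OF F])
  moreover have "H (F z) = B *v h z" using H_eq[OF assms(2), of 1] F0 by simp
  moreover have "h z = A_transpose *v (B *v h z)" by (simp add: matrix_vector_mul_assoc B)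
  ultimately show ?thesis by simp
qed

lemma \<omega>U_0: "z \<in> U \<Longrightarrow> \<omega>U z = 0"
proof (rule zero_on_torus_imp_zero[OF open_U, of \<omega>U])
  show "\<omega>U x = 0" if "x \<in> U" "x \<in> torus" for x
    using h_torus[OF that(2)] that by (simp add: h_U torus_def vec_eq_iff)
qed (simp_all add: holo_on_eq holo_U)

lemma \<omega>N_0: "z \<in> N \<Longrightarrow> \<omega>N z = 0"
proof (rule zero_on_torus_imp_zero[OF open_N, of \<omega>N])
  show "\<omega>N x = 0" if "x \<in> N" "x \<in> torus" for x
    using h_torus[OF that(2)] that by (simp add: h_def torus_def vec_eq_iff)
qed (simp_all add: holo_on_eq holo_N)

text \<open>Up to gluing, a point with torus coordinates in any chart lies in the chart of
  \<open>U\<close> or that of \<open>N\<close>, and \<open>one_form_zero\<close> transports the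
  vanishing.\<close>

lemma chart_torus:
  assumes "(V, \<phi>) \<in> kato_word_atlas js" "v \<in> V" "v \<in> torus"
  shows "\<omega> (V, \<phi>) v = 0"
proof -
  have U: ?thesis if "u \<in> U" "\<phi> v = kato_class js (Ambient u)" for u
    using that \<omega>U_0[OF that(1)]
    by (intro one_form_zero[OF form assms(1) U_atlas word_inj[OF U_atlas] assms(2), of u]) (simp_all add: \<omega>U_def)
  have N: ?thesis if "u \<in> N" "\<phi> v = kato_class js (gam u)" for u
    using that \<omega>N_0[OF that(1)]
    by (intro one_form_zero[OF form assms(1) N_atlas word_inj[OF N_atlas] assms(2), of u]) (simp_all add: \<omega>N_def)
  have v0: "F v \<noteq> 0" "v \<noteq> 0" using assms(3) monomial_torus[OF assms(3)] zero_notin_torus by metis+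
  from assms(1) show ?thesis
  proof (cases rule: word_atlas_cases)
    case (i \<psi>)
    obtain W where W: "(W, \<psi>) \<in> tower_atlas js (length js)"
      "V = {v \<in> W. \<pi> (\<psi> v) \<in> D \<and> \<psi> v \<notin> \<sigma> ` closure D}" using i(1) unfolding int_chart_def by (elim exE conjE)
    have v: "v \<in> W" "\<pi> (\<psi> v) \<in> D" "\<psi> v \<notin> \<sigma> ` closure D" using assms(2) unfolding W(2) by simp_all
    obtain u where u: "u \<in> torus" "\<psi> v = Ambient u" using tower_atlas_torus[OF W(1) v(1) assms(3)] by blast
    have "u \<noteq> 0" using u(1) zero_notin_torus by metis
    then have "u \<in> U" using v(2,3) u(2) Ambient_in_sigma_iff[of u "closure D"] by (simp add: U_def pi_Ambient)
    then show ?thesis using i(2) u(2) by (intro U) simp_all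
  next
    case c
    have v: "v \<in> kato_collar js" using c(1) assms(2) by (auto simp: col_chart_def)
    \<comment> \<open>Inside \<open>D\<close> the point \<open>v\<close> lies in \<open>U\<close>;
      on the boundary it lies in the shell \<open>N\<close>; outside \<open>closure D\<close> its
      representative in \<open>U\<close> is \<open>F v\<close>.\<close>
    consider "v \<in> D" | "v \<in> closure D" "v \<notin> D" | "v \<notin> closure D" by blast
    then show ?thesis
    proof cases
      case 1
      then have "v \<in> U" using v v0 Ambient_in_sigma_iff[of v "closure D"] by (simp add: U_def collar_iff)
      then show ?thesis using c(2) 1 by (intro U) (simp_all add: gam_def)
    next
      case 2
      then have "v \<in> N" using knorm_F[of v] rho by (auto simp: N_def closure_kato_domain_eq D_iff)
      then show ?thesis using c(2) by (intro N) simp_all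
    next
      case 3
      then have D: "v \<notin> D" using D_closure by blast
      have "F v \<noteq> F w" if "w \<in> closure D" for w using monomial_word_inj[of js w v] that 3 v0 by metis
      then have "F v \<in> U" using v D by (auto simp: U_def collar_iff)
      then show ?thesis using c(2) D v0 sigma_eq_Ambient[of js v] by (intro U) (simp_all add: gam_def)
    qed
  qed
qed

lemma form_eq_0: "\<omega> = (\<lambda>_ _. 0)"
proof (intro ext)
  fix c :: "('n, 'n cspace blowup_point set) chart" and v
  obtain V \<phi> where c: "c = (V, \<phi>)" by (cases c)
  show "\<omega> c v = 0"
  proof (cases "c \<in> kato_word_atlas js \<and> v \<in> V")
    case True
    then have a: "(V, \<phi>) \<in> kato_word_atlas js" "v \<in> V" by (auto simp: c)
    show ?thesis unfolding c
      by (rule zero_on_torus_imp_zero[OF word_open[OF a(1)] one_form_holo[OF form a(1)] chart_torus[OF a(1)] a(2)])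
  next
    case False
    then show ?thesis using form by (auto simp: holomorphic_one_forms_def c)
  qed
qed

end

theorem proposition6p3:
  fixes A :: "int^'n::{finite,wellorder}^'n::{finite,wellorder}"
  assumes "invertible A" and "kato_matrix A"
  shows "holomorphic_one_forms (kato_manifold A) = {\<lambda>_ _. 0}"
proof -
  obtain js where js: "A = word_matrix js" using assms(2) unfolding kato_matrix_def by blast
  interpret kato js by unfold_locales (rule kato_word(2)[OF assms(2) js])
  have M: "kato_manifold A = kato_word_atlas js"
    using kato_word(1)[OF assms(2) js] by (simp add: kato_manifold_def)
  obtain A' where A': "A ** A' = mat 1" "A' ** A = mat 1" using assms(1) unfolding invertible_def by blast
  \<comment> \<open>The transpose of the integral inverse with complex entries; the ring
    homomorphism \<open>of_int\<close> carries both inverse identities over.\<close>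
  define B :: "complex^'n::{finite,wellorder}^'n::{finite,wellorder}"
    where "B = (\<chi> i p. of_int (A' $ p $ i))"
  have "(\<Sum>k\<in>UNIV. A $ i $ k * A' $ k $ j) = (if i = j then 1 else 0)"
    "(\<Sum>k\<in>UNIV. A' $ i $ k * A $ k $ j) = (if i = j then 1 else 0)" for i j
    using A' by (simp_all add: vec_eq_iff matrix_matrix_mult_def mat_def)
  from this[THEN arg_cong[where f = "of_int :: int \<Rightarrow> complex"]]
  have B: "A_transpose ** B = mat 1" "B ** A_transpose = mat 1"
    by (auto simp: A_transpose_def B_def vec_eq_iff matrix_matrix_mult_def mat_def js mult.commute)
  obtain s where s: "0 < s" "s < 1" "\<And>z. knorm z \<le> 1 \<Longrightarrow> knorm (F z) \<le> s * knorm z"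
    using knorm_F_contract by blast
  have "\<omega> = (\<lambda>_ _. 0)" if "\<omega> \<in> holomorphic_one_forms (kato_word_atlas js)" for \<omega>
  proof -
    interpret kato_form js \<omega> B s by unfold_locales (fact that B s)+
    show ?thesis by (rule form_eq_0)
  qed
  then show ?thesis unfolding M using zero_one_form by auto
qed

end
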